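(* Let $p\ge 1$, let $\Omega\subset\mathbb{R}^{4p}$ be open, and let $0\le s\le r\le 2p$ be such that the symplectic cell $\mathbb{S}^r_s$ is defined. Let $U_s=\mathbb{S}^r_s$, let $V_c=W_1\oplus W_2$ be a decomposition of $V_c=\mathbb{C}^{4p}$ into irreducible $\mathfrak{sp}(p)$-submodules, and let $D_{1,\pm},D_{2,\pm}$ be the corresponding Stein–Weiss gradients on $\mathcal{C}^\infty(\Omega,U_s)$. Then a differentiable function $f:\Omega\to\mathbb{S}^r_s$ is q-monogenic if and only if on $\Omega$ it satisfies the system $$D_{1,+}(f)=0,\quad D_{1,-}(f)=0,\quad D_{2,+}(f)=0,\quad D_{2,-}(f)=0 .$$
   Context: Coordinates on $\mathbb{R}^{4p}$: $(X_1,\dots,X_{4p})=(x_1,y_1,\dots,x_{2p},y_{2p})$. $\mathbb{C}_{4p}$ is the complex Clifford algebra generated by $e_1,\dots,e_{4p}$ with $e_\alpha e_\beta+e_\beta e_\alpha=-2\delta_{\alpha\beta}$. Witt basis: $\mathfrak f_k=\tfrac12(-e_{2k-1}+ie_{2k})$, $\mathfrak f_k^\dagger=\tfrac12(e_{2k-1}+ie_{2k})$, $k=1,\dots,2p$. Let $I=\prod_{k=1}^{2p}\mathfrak f_k\mathfrak f_k^\dagger$ and the spinor space $\mathbb{S}=\mathbb{C}_{4p}I$; it has basis $\mathfrak f^\dagger_{j_1}\cdots\mathfrak f^\dagger_{j_r}I$ ($j_1<\dots<j_r$), and $\mathbb{S}^r$ denotes the span of those with $r$ factors. Let $P=\sum_{j=1}^p\mathfrak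 f_{2j}\mathfrak f_{2j-1}$ and $Q=\sum_{j=1}^p\mathfrak f^\dagger_{2j-1}\mathfrak f^\dagger_{2j}$ act by left multiplication. For $0\le r\le p$: $\mathbb{S}^r_r=\{\psi\in\mathbb{S}^r:P\psi=0\}$, $\mathbb{S}^{2p-r}_r=\{\psi\in\mathbb{S}^{2p-r}:Q\psi=0\}$, and for $0\le k\le p-r$: $\mathbb{S}^{r+2k}_r=Q^k\mathbb{S}^r_r$, $\mathbb{S}^{2p-r-2k}_r=P^k\mathbb{S}^{2p-r}_r$ (symplectic cells). Define real linear maps on $\mathrm{span}_{\mathbb{R}}\{e_\alpha\}$: $\mathbb{I}(e_{2k-1})=e_{2k}$, $\mathbb{I}(e_{2k})=-e_{2k-1}$; for $j=1,\dots,p$: $\mathbb{J}(e_{4j-3})=e_{4j-1}$, $\mathbb{J}(e_{4j-2})=-e_{4j}$, $\mathbb{J}(e_{4j-1})=-e_{4j-3}$, $\mathbb{J}(e_{4j})=e_{4j-2}$; $\mathbb{K}=\mathbb{I}\mathbb{J}$. Dirac operator $\underline\partial=\sum_\alpha e_\alpha\partial_{X_\alpha}$ and for $M\in\{\mathbb I,\mathbb J,\mathbb K\}$, $\underline\partial_M=\sum_\alpha M(e_\alpha)\partial_{X_\alpha}$, acting by left multiplication on $\mathbb S$-valued functions. A differentiable $F:\Omega\to\mathbb{S}$ is q-monogenic if $\underline\partial F=\underline\partial_{\mathbb I}F=\underline\partial_{\mathbb J}F=\underline\partial_{\mathbb K}F=0$ on $\Omega$. Symmetry: $\mathrm{SO}_{\mathbb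 Q}(4p)=\{A\in\mathrm{SO}(4p):A\mathbb I=\mathbb IA,\ A\mathbb J=\mathbb JA\}\cong\mathrm{Sp}(p)$, with Lie algebra $\mathfrak{sp}(p)$. It is doubly covered by $\mathrm{Spin}_{\mathbb Q}(4p)$, the elements of $\mathrm{Spin}(4p)$ commuting with $s_{\mathbb I}=\prod_{j=1}^{2p}\tfrac{\sqrt2}{2}(1+e_{2j-1}e_{2j})$ and $s_{\mathbb J}=\prod_{j=1}^p\tfrac12(1+e_{4j-3}e_{4j-1})(1-e_{4j-2}e_{4j})$; this group acts on $\mathbb S$ by left multiplication, preserving each $\mathbb S^r_s$, which is an irreducible $\mathfrak{sp}(p)$-module with highest weight $(1,\dots,1,0,\dots,0)$ ($s$ ones); it acts on $V_c=\mathbb{C}^{4p}$ (complexification of $\mathbb R^{4p}$) via the covering. Stein–Weiss gradients: for an irreducible $\mathfrak{sp}(p)$-module $U_s$ with highest weight $(1,\dots,1,0,\dots,0)$ ($s$ ones) and an irreducible decomposition $V_c=W_1\oplus W_2$, each $W_i\otimes U_s$ decomposes as $U_{i,s+1}\oplus U_{i,s-1}\oplus U'_{i,s}$, where $U_{i,s\pm1}$ is irreducible of highest weight with $s\pm1$ ones (absent, i.e. zero, if $s\pm1\notin\{0,\dots,p\}$) and $U'_{i,s}$ is the Cartan product. Let $\pi_{i,\pm}$ be the invariant projections of $V_c\otimes U_s$ onto $U_{i,s\pm1}$. For $f\in\mathcal C^\infty(\Omega,U_s)$ let $\nabla f=\sum_\alpha e_\alpha\otimes\partial_{X_\alpha}f\in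 V_c\otimes U_s$ and $D_{i,\pm}(f)=\pi_{i,\pm}(\nabla f)$. *)

theory Defs
  imports "HOL-Analysis.Analysis"
begin

text \<open>An element of the complex Clifford algebra on generators e_1..e_n is represented by its
coefficient function on subsets of {1..n}: x A is the coefficient of e_A = e_a1...e_ak (a1<...<ak).\<close>

type_synonym cl = "nat set \<Rightarrow> complex"

definition csign :: "nat set \<Rightarrow> nat set \<Rightarrow> complex" where
  "csign A B = (-1) ^ (card {(a,b). a \<in> A \<and> b \<in> B \<and> b < a} + card (A \<inter> B))"

text \<open>Clifford product with e_a e_b + e_b e_a = -2 delta_ab: e_A e_B = csign A B e_(A sym.diff. B).\<close>
definition clmul :: "nat \<Rightarrow> cl \<Rightarrow> cl \<Rightarrow> cl" where
  "clmul n x y = (\<lambda>C. \<Sum>A\<in>Pow {1..n}. x A * y ((A - C) \<union> (C - A)) * csign A ((A - C) \<union> (C - A)))"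

definition clone :: cl where "clone = (\<lambda>A. if A = {} then 1 else 0)"
definition cle :: "nat \<Rightarrow> cl" where "cle a = (\<lambda>A. if A = {a} then 1 else 0)"
definition cladd :: "cl \<Rightarrow> cl \<Rightarrow> cl" where "cladd x y = (\<lambda>A. x A + y A)"
definition clscale :: "complex \<Rightarrow> cl \<Rightarrow> cl" where "clscale c x = (\<lambda>A. c * x A)"
definition clprod :: "nat \<Rightarrow> cl list \<Rightarrow> cl" where "clprod n xs = foldr (clmul n) xs clone"

definition fw :: "nat \<Rightarrow> cl" where
  "fw k = clscale (1/2) (cladd (clscale (-1) (cle (2*k - 1))) (clscale \<i> (cle (2*k))))"
definition fwd :: "nat \<Rightarrow> cl" where
  "fwd k = clscale (1/2) (cladd (cle (2*k - 1)) (clscale \<i> (cle (2*k))))"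

definition Iprim :: "nat \<Rightarrow> cl" where
  "Iprim p = clprod (4*p) (map (\<lambda>k. clmul (4*p) (fw k) (fwd k)) [1..<2*p+1])"

definition csubspace :: "('a \<Rightarrow> complex) set \<Rightarrow> bool" where
  "csubspace V \<longleftrightarrow> (\<lambda>_. 0) \<in> V \<and> (\<forall>x\<in>V. \<forall>y\<in>V. (\<lambda>i. x i + y i) \<in> V)
      \<and> (\<forall>c. \<forall>x\<in>V. (\<lambda>i. c * x i) \<in> V)"

definition cspan :: "('a \<Rightarrow> complex) set \<Rightarrow> ('a \<Rightarrow> complex) set" where
  "cspan S = \<Inter>{V. csubspace V \<and> S \<subseteq> V}"

definition Sdeg :: "nat \<Rightarrow> nat \<Rightarrow> cl set" where
  "Sdeg p r = cspan {clmul (4*p) (clprod (4*p) (map fwd (sorted_list_of_set J))) (Iprim p) | J.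
                       J \<subseteq> {1..2*p} \<and> card J = r}"

definition Pop :: "nat \<Rightarrow> cl" where
  "Pop p = (\<lambda>A. \<Sum>j\<in>{1..p}. clmul (4*p) (fw (2*j)) (fw (2*j - 1)) A)"
definition Qop :: "nat \<Rightarrow> cl" where
  "Qop p = (\<lambda>A. \<Sum>j\<in>{1..p}. clmul (4*p) (fwd (2*j - 1)) (fwd (2*j)) A)"

definition cell0 :: "nat \<Rightarrow> nat \<Rightarrow> cl set" where
  "cell0 p s = {\<psi> \<in> Sdeg p s. clmul (4*p) (Pop p) \<psi> = (\<lambda>_. 0)}"

definition cell_ok :: "nat \<Rightarrow> nat \<Rightarrow> nat \<Rightarrow> bool" where
  "cell_ok p r s \<longleftrightarrow> s \<le> p \<and> s \<le> r \<and> r + s \<le> 2*p \<and> even (r - s)"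

definition cell :: "nat \<Rightarrow> nat \<Rightarrow> nat \<Rightarrow> cl set" where
  "cell p r s = (if cell_ok p r s
       then ((clmul (4*p) (Qop p)) ^^ ((r - s) div 2)) ` cell0 p s else {\<lambda>_. 0})"

definition IM :: "nat \<Rightarrow> cl" where
  "IM a = (if odd a then cle (a + 1) else clscale (-1) (cle (a - 1)))"

definition JM :: "nat \<Rightarrow> cl" where
  "JM a = (if a mod 4 = 1 then cle (a + 2)
           else if a mod 4 = 2 then clscale (-1) (cle (a + 2))
           else if a mod 4 = 3 then clscale (-1) (cle (a - 2))
           else cle (a - 2))"

definition Ilin :: "nat \<Rightarrow> cl \<Rightarrow> cl" where
  "Ilin n v = (\<lambda>A. \<Sum>a\<in>{1..n}. v {a} * IM a A)"

definition KM :: "nat \<Rightarrow> nat \<Rightarrow> cl" where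
  "KM n a = Ilin n (JM a)"

definition Imat :: "nat \<Rightarrow> nat \<Rightarrow> real" where "Imat a b = Re (IM b {a})"
definition Jmat :: "nat \<Rightarrow> nat \<Rightarrow> real" where "Jmat a b = Re (JM b {a})"

definition sp_alg :: "nat \<Rightarrow> (nat \<Rightarrow> nat \<Rightarrow> real) set" where
  "sp_alg p = {A. (\<forall>a b. (a \<notin> {1..4*p} \<or> b \<notin> {1..4*p}) \<longrightarrow> A a b = 0)
     \<and> (\<forall>a b. A a b = - A b a)
     \<and> (\<forall>a\<in>{1..4*p}. \<forall>c\<in>{1..4*p}.
          (\<Sum>b\<in>{1..4*p}. A a b * Imat b c) = (\<Sum>b\<in>{1..4*p}. Imat a b * A b c))
     \<and> (\<forall>a\<in>{1..4*p}. \<forall>c\<in>{1..4*p}.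
          (\<Sum>b\<in>{1..4*p}. A a b * Jmat b c) = (\<Sum>b\<in>{1..4*p}. Jmat a b * A b c))}"

definition Vc :: "nat \<Rightarrow> (nat \<Rightarrow> complex) set" where
  "Vc p = {v. \<forall>a. a \<notin> {1..4*p} \<longrightarrow> v a = 0}"

definition vact :: "nat \<Rightarrow> (nat \<Rightarrow> nat \<Rightarrow> real) \<Rightarrow> (nat \<Rightarrow> complex) \<Rightarrow> (nat \<Rightarrow> complex)" where
  "vact p A v = (\<lambda>a. \<Sum>b\<in>{1..4*p}. of_real (A a b) * v b)"

text \<open>Spin lift: A corresponds to the bivector -1/4 sum A_ab e_a e_b, acting by left multiplication.\<close>
definition spin_act :: "nat \<Rightarrow> (nat \<Rightarrow> nat \<Rightarrow> real) \<Rightarrow> cl \<Rightarrow> cl" where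
  "spin_act p A \<psi> = (\<lambda>C. \<Sum>a\<in>{1..4*p}. \<Sum>b\<in>{1..4*p}.
       (- of_real (A a b) / 4) * clmul (4*p) (cle a) (clmul (4*p) (cle b) \<psi>) C)"

text \<open>Tensors in V_c (x) C_{4p}: t (a, B) is the coefficient of e_a (x) e_B.\<close>
type_synonym tens = "nat \<times> nat set \<Rightarrow> complex"

definition tact :: "nat \<Rightarrow> (nat \<Rightarrow> nat \<Rightarrow> real) \<Rightarrow> tens \<Rightarrow> tens" where
  "tact p A t = (\<lambda>(a, B). (\<Sum>b\<in>{1..4*p}. of_real (A a b) * t (b, B))
                         + spin_act p A (\<lambda>C. t (a, C)) B)"

definition tensor :: "nat \<Rightarrow> (nat \<Rightarrow> complex) set \<Rightarrow> cl set \<Rightarrow> tens set" where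
  "tensor p W U = cspan {(\<lambda>(a, B). w a * u B) | w u. w \<in> W \<and> u \<in> U}"

definition invariant :: "nat \<Rightarrow> ((nat \<Rightarrow> nat \<Rightarrow> real) \<Rightarrow> ('a \<Rightarrow> complex) \<Rightarrow> ('a \<Rightarrow> complex))
     \<Rightarrow> ('a \<Rightarrow> complex) set \<Rightarrow> bool" where
  "invariant p act V \<longleftrightarrow> (\<forall>A\<in>sp_alg p. \<forall>x\<in>V. act A x \<in> V)"

definition submodule :: "nat \<Rightarrow> ((nat \<Rightarrow> nat \<Rightarrow> real) \<Rightarrow> ('a \<Rightarrow> complex) \<Rightarrow> ('a \<Rightarrow> complex))
     \<Rightarrow> ('a \<Rightarrow> complex) set \<Rightarrow> bool" where
  "submodule p act V \<longleftrightarrow> csubspace V \<and> invariant p act V"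

definition irred :: "nat \<Rightarrow> ((nat \<Rightarrow> nat \<Rightarrow> real) \<Rightarrow> ('a \<Rightarrow> complex) \<Rightarrow> ('a \<Rightarrow> complex))
     \<Rightarrow> ('a \<Rightarrow> complex) set \<Rightarrow> bool" where
  "irred p act V \<longleftrightarrow> submodule p act V \<and> V \<noteq> {\<lambda>_. 0}
     \<and> (\<forall>W. W \<subseteq> V \<and> submodule p act W \<longrightarrow> W = {\<lambda>_. 0} \<or> W = V)"

definition mod_iso :: "nat \<Rightarrow> ((nat \<Rightarrow> nat \<Rightarrow> real) \<Rightarrow> ('a \<Rightarrow> complex) \<Rightarrow> ('a \<Rightarrow> complex))
     \<Rightarrow> ('a \<Rightarrow> complex) set
     \<Rightarrow> ((nat \<Rightarrow> nat \<Rightarrow> real) \<Rightarrow> ('b \<Rightarrow> complex) \<Rightarrow> ('b \<Rightarrow> complex))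
     \<Rightarrow> ('b \<Rightarrow> complex) set \<Rightarrow> bool" where
  "mod_iso p act1 V act2 W \<longleftrightarrow> (\<exists>\<phi>. bij_betw \<phi> V W
     \<and> (\<forall>x\<in>V. \<forall>y\<in>V. \<phi> (\<lambda>i. x i + y i) = (\<lambda>i. \<phi> x i + \<phi> y i))
     \<and> (\<forall>c. \<forall>x\<in>V. \<phi> (\<lambda>i. c * x i) = (\<lambda>i. c * \<phi> x i))
     \<and> (\<forall>A\<in>sp_alg p. \<forall>x\<in>V. \<phi> (act1 A x) = act2 A (\<phi> x)))"

definition isotypic :: "nat \<Rightarrow> tens set \<Rightarrow> cl set \<Rightarrow> tens set" where
  "isotypic p M \<tau> = cspan (\<Union>{V. V \<subseteq> M \<and> submodule p (tact p) V
                                 \<and> mod_iso p (tact p) V (spin_act p) \<tau>})"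

definition nonisotypic :: "nat \<Rightarrow> tens set \<Rightarrow> cl set \<Rightarrow> tens set" where
  "nonisotypic p M \<tau> = cspan (\<Union>{V. V \<subseteq> M \<and> irred p (tact p) V
                                 \<and> \<not> mod_iso p (tact p) V (spin_act p) \<tau>})"

text \<open>Invariant projection of V_c (x) U = (W_i (x) U) + (W_j (x) U) onto the summand of
 W_i (x) U of type tau, along W_j (x) U and the remaining summands of W_i (x) U.\<close>
definition SW_proj :: "nat \<Rightarrow> cl set \<Rightarrow> (nat \<Rightarrow> complex) set \<Rightarrow> (nat \<Rightarrow> complex) set
     \<Rightarrow> cl set \<Rightarrow> tens \<Rightarrow> tens" where
  "SW_proj p U Wi Wj \<tau> t = (THE u. u \<in> isotypic p (tensor p Wi U) \<tau>
     \<and> (\<exists>v\<in>tensor p Wj U. \<exists>w\<in>nonisotypic p (tensor p Wi U) \<tau>. t = (\<lambda>z. u z + v z + w z)))"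

text \<open>Target types: highest weight with s+1 resp. s-1 ones (zero module if out of range).\<close>
definition tau_plus :: "nat \<Rightarrow> nat \<Rightarrow> cl set" where
  "tau_plus p s = cell p (s + 1) (s + 1)"
definition tau_minus :: "nat \<Rightarrow> nat \<Rightarrow> cl set" where
  "tau_minus p s = (if s = 0 then {\<lambda>_. 0} else cell p (s - 1) (s - 1))"

text \<open>Coordinate X_alpha of R^{4p} corresponds to the index b alpha of the finite type 'n.\<close>
definition pd :: "(nat \<Rightarrow> 'n::finite) \<Rightarrow> (real^'n \<Rightarrow> cl) \<Rightarrow> nat \<Rightarrow> real^'n \<Rightarrow> cl" where
  "pd b F a x = (\<lambda>B. vector_derivative (\<lambda>t. F (x + t *\<^sub>R axis (b a) 1) B) (at 0))"

definition grad :: "nat \<Rightarrow> (nat \<Rightarrow> 'n::finite) \<Rightarrow> (real^'n \<Rightarrow> cl) \<Rightarrow> real^'n \<Rightarrow> tens" where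
  "grad p b F x = (\<lambda>(a, B). if a \<in> {1..4*p} then pd b F a x B else 0)"

definition SW :: "nat \<Rightarrow> (nat \<Rightarrow> 'n::finite) \<Rightarrow> nat \<Rightarrow> nat \<Rightarrow> (nat \<Rightarrow> complex) set
     \<Rightarrow> (nat \<Rightarrow> complex) set \<Rightarrow> nat \<Rightarrow> bool \<Rightarrow> (real^'n \<Rightarrow> cl) \<Rightarrow> real^'n \<Rightarrow> tens" where
  "SW p b r s W1 W2 i up F x =
     SW_proj p (cell p r s) (if i = 1 then W1 else W2) (if i = 1 then W2 else W1)
       (if up then tau_plus p s else tau_minus p s) (grad p b F x)"

definition cdifferentiable_on :: "(real^'n::finite \<Rightarrow> cl) \<Rightarrow> (real^'n) set \<Rightarrow> bool" where
  "cdifferentiable_on F \<Omega> \<longleftrightarrow> (\<forall>x\<in>\<Omega>. \<forall>B. (\<lambda>y. F y B) differentiable (at x))"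

definition dirac_op :: "nat \<Rightarrow> (nat \<Rightarrow> cl) \<Rightarrow> (nat \<Rightarrow> 'n::finite) \<Rightarrow> (real^'n \<Rightarrow> cl) \<Rightarrow> real^'n \<Rightarrow> cl" where
  "dirac_op p M b F x = (\<lambda>C. \<Sum>a\<in>{1..4*p}. clmul (4*p) (M a) (pd b F a x) C)"

definition qmonogenic :: "nat \<Rightarrow> (nat \<Rightarrow> 'n::finite) \<Rightarrow> (real^'n \<Rightarrow> cl) \<Rightarrow> (real^'n) set \<Rightarrow> bool" where
  "qmonogenic p b F \<Omega> \<longleftrightarrow> cdifferentiable_on F \<Omega>
     \<and> (\<forall>x\<in>\<Omega>. dirac_op p cle b F x = (\<lambda>_. 0) \<and> dirac_op p IM b F x = (\<lambda>_. 0)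
              \<and> dirac_op p JM b F x = (\<lambda>_. 0) \<and> dirac_op p (KM (4*p)) b F x = (\<lambda>_. 0))"

end

theory Submission
  imports Defs "HOL-Library.Function_Algebras"
begin

text \<open>The symbols of the four Dirac operators are equivariant maps from V tensor U to the spinors;
  U is the cell. The group acts by isometries, so everything is completely reducible, and it
  suffices to see that in each W tensor U the common kernel K of the symbols is the sum of the irreducible
  submodules which have neither of the two types s + 1 and s - 1.

  The Casimir operator of the tensor module equals a constant plus half the sum over the four
  quaternion units of (adjoint symbol) o symbol. Hence K is an eigenspace of it, which shows that K splits
  along V = W1 + W2, and comparison of eigenvalues shows that K contains no submodule of type s + 1 or s - 1.
  Conversely, the Casimir operator of the spin module is that of the commuting su(2) spanned by
  the elements sum of e u(e) with u = I, J, K. The vectors e form doublets for this su(2), so the image of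
  the symbols only involves the two neighbouring Casimir eigenvalues, and the operator P identifies an irreducible
  submodule of the spinors with the primitive cell of the same eigenvalue. The primitive cells
  are irreducible because they contain at most one highest weight vector up to scalars.\<close>

text \<open>Both sides of the equivalence are conditions on the gradient at a single point, so that
  after one analytic remark (derivatives of a cell-valued function stay in the cell) everything is
  linear algebra on tensors. The obstacle is that \<open>W1\<close> and \<open>W2\<close> are
  arbitrary: V_c consists of two copies of one irreducible module, so it has a continuum of
  decompositions and no coordinates are adapted to the given one. Moreover the projections are
  defined through isomorphism types of submodules, without weights. Hence only invariant data can be
  compared, and the Casimir operators supply them. With their sign convention the module with
  \<open>s\<close> ones has eigenvalue \<open>-s(2p+2-s)\<close>, and the common kernel of the
  symbols has that value lowered by \<open>2p+3\<close>; for \<open>s \<ge> 1\<close> this is the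
  value of the Cartan product, with highest weight (2,1,...,1). A second obstacle is that one Dirac
  symbol mixes the degrees \<open>r-1\<close> and \<open>r+1\<close>, while irreducible spinor
  modules are identified degree by degree; the symbols are therefore combined with coefficients
  \<open>\<i>\<close> and \<open>-\<i>\<close>.\<close>

definition cscale :: "complex \<Rightarrow> ('a \<Rightarrow> complex) \<Rightarrow> 'a \<Rightarrow> complex" where
  "cscale c x = (\<lambda>i. c * x i)"

lemma cscale_apply: "cscale c x i = c * x i"
  by (simp add: cscale_def)

lemma sum_fun_apply: "(\<Sum>a\<in>A. f a) x = (\<Sum>a\<in>A. f a x)" for f :: "'b \<Rightarrow> 'a \<Rightarrow> complex"
  by (induction A rule: infinite_finite_induct) auto

text \<open>Induction leaves eta-long goals, in which the pointwise rules would unfold the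
  module operations; hence they are only used on demand.\<close>

declare plus_fun_apply [simp del] zero_fun_apply [simp del] minus_apply [simp del] uminus_apply [simp del]

lemmas pointwise = plus_fun_apply zero_fun_apply minus_apply uminus_apply cscale_apply sum_fun_apply

interpretation cv: vector_space "cscale :: complex \<Rightarrow> ('a \<Rightarrow> complex) \<Rightarrow> 'a \<Rightarrow> complex"
  by unfold_locales (auto simp: pointwise fun_eq_iff algebra_simps)

lemma zero_fun_lambda: "(\<lambda>_. 0) = (0 :: 'a \<Rightarrow> complex)"
  by (simp add: zero_fun_def)

lemma csubspace_eq: "csubspace V \<longleftrightarrow> cv.subspace V"
  unfolding csubspace_def cv.subspace_def
  by (simp add: cscale_def plus_fun_def zero_fun_def)

lemma cspan_eq: "cspan S = cv.span S"
  unfolding cspan_def cv.span_def hull_def by (simp add: csubspace_eq)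

text \<open>All vectors are functions on a possibly infinite index type. Finite dimension is
  expressed by vanishing outside a finite set, and only there is \<open>ip\<close> definite.\<close>

definition supported :: "'a set \<Rightarrow> ('a \<Rightarrow> complex) set" where
  "supported Z = {x. \<forall>z. z \<notin> Z \<longrightarrow> x z = 0}"

lemma subspace_supported: "cv.subspace (supported Z)"
  by (auto simp: cv.subspace_def supported_def pointwise)

section \<open>The Hermitian product and orthogonal complements\<close>

definition ip :: "'a set \<Rightarrow> ('a \<Rightarrow> complex) \<Rightarrow> ('a \<Rightarrow> complex) \<Rightarrow> complex" where
  "ip Z x y = (\<Sum>z\<in>Z. x z * cnj (y z))"

lemma ip_simps [simp]:
  "ip Z 0 y = 0" "ip Z x 0 = 0"
  "ip Z (x + x') y = ip Z x y + ip Z x' y" "ip Z x (y + y') = ip Z x y + ip Z x y'"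
  "ip Z (x - x') y = ip Z x y - ip Z x' y" "ip Z x (y - y') = ip Z x y - ip Z x y'"
  "ip Z (- x) y = - ip Z x y" "ip Z x (- y) = - ip Z x y"
  "ip Z (cscale c x) y = c * ip Z x y" "ip Z x (cscale c y) = cnj c * ip Z x y"
  by (auto simp: ip_def pointwise sum.distrib sum_subtractf sum_negf sum_distrib_left algebra_simps)

lemma ip_sum_left: "ip Z (\<Sum>a\<in>A. f a) y = (\<Sum>a\<in>A. ip Z (f a) y)"
  by (induction A rule: infinite_finite_induct) auto

lemma ip_sum_right: "ip Z x (\<Sum>a\<in>A. f a) = (\<Sum>a\<in>A. ip Z x (f a))"
  by (induction A rule: infinite_finite_induct) auto

lemma ip_commute: "ip Z y x = cnj (ip Z x y)"
  by (simp add: ip_def mult.commute)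

lemma ip_self: "ip Z x x = of_real (\<Sum>z\<in>Z. (cmod (x z))\<^sup>2)"
  unfolding ip_def by (simp add: complex_norm_square[symmetric])

lemma ip_self_nonneg: "0 \<le> Re (ip Z x x)"
  unfolding ip_self by (simp add: sum_nonneg)

lemma ip_self_eq_0: "ip Z x x = 0 \<longleftrightarrow> (\<forall>z\<in>Z. x z = 0)" if "finite Z"
  using that unfolding ip_self
  by (simp add: sum_nonneg_eq_0_iff del: of_real_sum)

lemma ip_self_Re_eq_0: "Re (ip Z x x) = 0 \<longleftrightarrow> (\<forall>z\<in>Z. x z = 0)" if "finite Z"
  using that unfolding ip_self
  by (simp add: sum_nonneg_eq_0_iff del: of_real_sum)

lemma supported_eq_0I:
  assumes "x \<in> supported Z" "finite Z" "ip Z x x = 0"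
  shows "x = 0"
proof
  fix z
  show "x z = 0 z"
    using assms ip_self_eq_0[of Z x] by (cases "z \<in> Z") (auto simp: supported_def pointwise)
qed

text \<open>Gram-Schmidt, one coordinate at a time: \<open>V\<close> is the subspace
  \<open>V'\<close> of vectors vanishing at the new coordinate plus at most one further direction.
  On unrestricted functions the form is only semidefinite, so existence alone is claimed.\<close>

lemma ex_orthogonal_projection:
  assumes "finite Z" "cv.subspace V"
  shows "\<exists>v\<in>V. \<forall>w\<in>V. ip Z (x - v) w = 0"
  using assms
proof (induction Z arbitrary: V x rule: finite_induct)
  case empty
  then show ?case using cv.subspace_0 by (auto simp: ip_def)
next
  case (insert z Z)
  define V' where "V' = {v\<in>V. v z = 0}"
  have sV: "cv.subspace V"
    by (rule insert.prems)
  then have sV': "cv.subspace V'"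
    by (auto simp: V'_def cv.subspace_def pointwise)
  have ipi: "ip (insert z Z) a b = a z * cnj (b z) + ip Z a b" for a b
    using insert.hyps by (simp add: ip_def)
  show ?case
  proof (cases "V' = V")
    case True
    then have 0: "w z = 0" if "w \<in> V" for w
      using that by (auto simp: V'_def)
    obtain v where "v \<in> V" "\<forall>w\<in>V. ip Z (x - v) w = 0"
      using insert.IH[OF sV, of x] by blast
    then show ?thesis
      by (intro bexI[of _ v]) (simp_all add: ipi 0 del: ip_simps)
  next
    case False
    then obtain u where u: "u \<in> V" "u z \<noteq> 0"
      by (auto simp: V'_def)
    obtain v0 where v0: "v0 \<in> V'" "\<forall>w\<in>V'. ip Z (u - v0) w = 0"
      using insert.IH[OF sV', of u] by blast
    \<comment> \<open>Vectors of \<open>V'\<close> vanish at \<open>z\<close>, so subtracting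
      \<open>v0\<close> leaves the value at \<open>z\<close> nonzero, and orthogonality to
      \<open>V'\<close> means the same for \<open>Z\<close> and for
      \<open>insert z Z\<close>.\<close>
    define u' where "u' = u - v0"
    have u': "u' \<in> V" "u' z \<noteq> 0"
      using u v0 sV by (auto simp: u'_def V'_def cv.subspace_diff pointwise)
    have orth: "ip Z u' w = 0" if "w \<in> V'" for w
      using v0 that by (simp add: u'_def)
    let ?ip = "ip (insert z Z)"
    have nz: "?ip u' u' \<noteq> 0"
      using ip_self_eq_0[of "insert z Z" u'] insert.hyps u' by auto
    define c where "c = ?ip x u' / ?ip u' u'"
    obtain v1 where v1: "v1 \<in> V'" "\<forall>w\<in>V'. ip Z (x - cscale c u' - v1) w = 0"
      using insert.IH[OF sV'] by blast
    define v where "v = cscale c u' + v1"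
    have vV: "v \<in> V"
      using u' v1 sV unfolding v_def V'_def
      by (simp add: cv.subspace_add cv.subspace_scale)
    have xv: "x - v = x - cscale c u' - v1"
      by (simp add: v_def)
    have 1: "?ip (x - v) w = 0" if "w \<in> V'" for w
      using v1 that unfolding xv ipi by (simp add: V'_def)
    have "?ip v1 u' = cnj (?ip u' v1)"
      by (rule ip_commute)
    also have "?ip u' v1 = 0"
      using orth[OF v1(1)] v1(1) by (simp add: ipi V'_def)
    finally have "?ip v1 u' = 0" by simp
    then have 2: "?ip (x - v) u' = 0"
      unfolding xv using nz by (simp add: c_def)
    have "?ip (x - v) w = 0" if w: "w \<in> V" for w
    proof -
      \<comment> \<open>This multiple of \<open>u'\<close> cancels the value at \<open>z\<close>,
        which moves \<open>w\<close> into \<open>V'\<close>.\<close>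
      define d where "d = w z / u' z"
      have "w - cscale d u' \<in> V'"
        using w u' sV unfolding V'_def
        by (simp add: cv.subspace_diff cv.subspace_scale d_def pointwise)
      then have "?ip (x - v) (w - cscale d u') = 0" by (rule 1)
      then show ?thesis using 2 by (simp del: ip_simps(5))
    qed
    then show ?thesis using vV by blast
  qed
qed

definition orth :: "'a set \<Rightarrow> ('a \<Rightarrow> complex) set \<Rightarrow> ('a \<Rightarrow> complex) set" where
  "orth Z V = {x. \<forall>w\<in>V. ip Z x w = 0}"

lemma subspace_orth: "cv.subspace (orth Z V)"
  by (auto simp: cv.subspace_def orth_def)

lemma orth_Int:
  assumes "finite Z" "V \<subseteq> supported Z" "x \<in> V" "x \<in> orth Z V"
  shows "x = 0"
  using assms supported_eq_0I[of x Z] by (auto simp: orth_def)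

lemma orth_decomp:
  assumes "finite Z" "cv.subspace V" "cv.subspace M" "V \<subseteq> M" "x \<in> M"
  obtains v w where "v \<in> V" "w \<in> M" "w \<in> orth Z V" "x = v + w"
proof -
  obtain v where v: "v \<in> V" "\<forall>w\<in>V. ip Z (x - v) w = 0"
    using ex_orthogonal_projection[OF assms(1,2)] by blast
  show ?thesis
    by (rule that[of v "x - v"]) (use v assms in \<open>auto simp: orth_def cv.subspace_diff\<close>)
qed

lemma span_orth_span:
  assumes "\<And>v w. v \<in> A \<Longrightarrow> w \<in> B \<Longrightarrow> ip Z v w = 0" "x \<in> cv.span A" "y \<in> cv.span B"
  shows "ip Z x y = 0"
proof -
  have 1: "ip Z v y = 0" if "v \<in> A" for v
  proof -
    have "cv.subspace {y. ip Z v y = 0}" by (auto simp: cv.subspace_def)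
    moreover have "B \<subseteq> {y. ip Z v y = 0}" using assms(1) that by auto
    ultimately show ?thesis using cv.span_minimal assms(3) by blast
  qed
  have "cv.subspace {x. ip Z x y = 0}" by (auto simp: cv.subspace_def)
  moreover have "A \<subseteq> {x. ip Z x y = 0}" using 1 by auto
  ultimately show ?thesis using cv.span_minimal assms(2) by blast
qed

lemma supported_subset_span:
  assumes "finite Z"
  shows "supported Z \<subseteq> cv.span ((\<lambda>z i. if i = z then 1 else 0) ` Z)"
proof
  fix x :: "'a \<Rightarrow> complex" assume "x \<in> supported Z"
  then have "x = (\<Sum>z\<in>Z. cscale (x z) (\<lambda>i. if i = z then 1 else 0))"
    using assms by (auto simp: fun_eq_iff pointwise supported_def if_distrib cong: if_cong)
  also have "\<dots> \<in> cv.span ((\<lambda>z i. if i = z then 1 else 0) ` Z)"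
    by (intro cv.span_sum cv.span_scale cv.span_base) auto
  finally show "x \<in> cv.span ((\<lambda>z i. if i = z then 1 else 0) ` Z)" .
qed

text \<open>The measure for the induction behind complete reducibility. Finite support is essential:
  a dimension is a \<open>card\<close>, which is 0 for infinite bases.\<close>

lemma dim_psubset:
  assumes "finite Z" "cv.subspace V" "cv.subspace W" "V \<subset> W" "W \<subseteq> supported Z"
  shows "cv.dim V < cv.dim W"
proof -
  obtain B where B: "B \<subseteq> V" "cv.independent B" "V \<subseteq> cv.span B"
    by (rule cv.maximal_independent_subset)
  have sB: "cv.span B = V"
    by (rule antisym[OF cv.span_minimal[OF B(1) assms(2)] B(3)])
  obtain C where C: "B \<subseteq> C" "C \<subseteq> W" "cv.independent C" "W \<subseteq> cv.span C"
    by (rule cv.maximal_independent_subset_extend[of B W]) (use B assms(4) in auto)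
  have sC: "cv.span C = W"
    by (rule antisym[OF cv.span_minimal[OF C(2) assms(3)] C(4)])
  have "C \<subseteq> cv.span ((\<lambda>z i. if i = z then 1 else 0) ` Z)"
    using C(2) assms(5) supported_subset_span[OF assms(1)] by blast
  then have "finite C"
    using cv.independent_span_bound[OF _ C(3)] assms(1) by blast
  moreover have "B \<noteq> C" using sB sC assms(4) by auto
  ultimately have "card B < card C"
    using C(1) by (simp add: psubset_card_mono psubsetI)
  moreover have "cv.dim V = card B"
    by (rule cv.dim_eq_card) (use B in \<open>simp_all flip: sB add: cv.span_span\<close>)
  moreover have "cv.dim W = card C"
    by (rule cv.dim_eq_card) (use C in \<open>simp_all flip: sC add: cv.span_span\<close>)
  ultimately show ?thesis by simp
qed

section \<open>Skew-Hermitian modules\<close>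

text \<open>Linearity is relative to \<open>V\<close> because the maps in \<open>mod_iso\<close> are
  arbitrary outside their domain.\<close>

definition linear_on :: "('a \<Rightarrow> complex) set \<Rightarrow> (('a \<Rightarrow> complex) \<Rightarrow> ('b \<Rightarrow> complex)) \<Rightarrow> bool" where
  "linear_on V h \<longleftrightarrow> (\<forall>x\<in>V. \<forall>y\<in>V. h (x + y) = h x + h y) \<and> (\<forall>c. \<forall>x\<in>V. h (cscale c x) = cscale c (h x))"

lemma linear_onD:
  assumes "linear_on V h"
  shows "x \<in> V \<Longrightarrow> y \<in> V \<Longrightarrow> h (x + y) = h x + h y" "x \<in> V \<Longrightarrow> h (cscale c x) = cscale c (h x)"
  using assms by (auto simp: linear_on_def)

lemma linear_on_0: "linear_on V h \<Longrightarrow> cv.subspace V \<Longrightarrow> h 0 = 0"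
  using linear_onD(2)[of V h 0 0] by (simp add: cv.subspace_0)

lemma linear_on_diff:
  assumes "linear_on V h" "cv.subspace V" "x \<in> V" "y \<in> V"
  shows "h (x - y) = h x - h y"
proof -
  have "h (x + cscale (-1) y) = h x + cscale (-1) (h y)"
    using assms linear_onD[OF assms(1)] cv.subspace_scale by metis
  then show ?thesis by simp
qed

lemma linear_on_image_subspace:
  assumes "linear_on V h" "cv.subspace V"
  shows "cv.subspace (h ` V)"
  unfolding cv.subspace_def
proof (intro conjI ballI allI)
  show "0 \<in> h ` V"
    using assms linear_on_0 cv.subspace_0 by (metis imageI)
next
  fix x y assume "x \<in> h ` V" "y \<in> h ` V"
  then obtain a b where "a \<in> V" "b \<in> V" "x = h a" "y = h b" by blast
  then show "x + y \<in> h ` V"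
    using assms linear_onD(1)[of V h a b] cv.subspace_add[of V a b] by (metis imageI)
next
  fix c x assume "x \<in> h ` V"
  then obtain a where "a \<in> V" "x = h a" by blast
  then show "cscale c x \<in> h ` V"
    using assms linear_onD(2)[of V h a c] cv.subspace_scale[of V a c] by (metis imageI)
qed

lemma linear_on_inj:
  assumes "linear_on V h" "cv.subspace V" "\<And>x. x \<in> V \<Longrightarrow> h x = 0 \<Longrightarrow> x = 0"
  shows "inj_on h V"
proof (rule inj_onI)
  fix x y assume "x \<in> V" "y \<in> V" "h x = h y"
  then have "h (x - y) = 0" "x - y \<in> V"
    using assms by (auto simp: linear_on_diff cv.subspace_diff)
  then show "x = y" using assms(3)[of "x - y"] by simp
qed

lemma mod_iso_iff: "mod_iso p act1 V act2 W \<longleftrightarrow> (\<exists>\<phi>. bij_betw \<phi> V W \<and> linear_on V \<phi>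
     \<and> (\<forall>A\<in>sp_alg p. \<forall>x\<in>V. \<phi> (act1 A x) = act2 A (\<phi> x)))"
  unfolding mod_iso_def linear_on_def cscale_def plus_fun_def by auto

lemma mod_iso_trans:
  assumes "mod_iso p a U b V" "mod_iso p b V c W"
  shows "mod_iso p a U c W"
proof -
  obtain \<phi> where \<phi>: "bij_betw \<phi> U V" "linear_on U \<phi>"
      "\<And>A x. A \<in> sp_alg p \<Longrightarrow> x \<in> U \<Longrightarrow> \<phi> (a A x) = b A (\<phi> x)"
    using assms(1) unfolding mod_iso_iff by blast
  obtain \<psi> where \<psi>: "bij_betw \<psi> V W" "linear_on V \<psi>"
      "\<And>A x. A \<in> sp_alg p \<Longrightarrow> x \<in> V \<Longrightarrow> \<psi> (b A x) = c A (\<psi> x)"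
    using assms(2) unfolding mod_iso_iff by blast
  have \<phi>V: "\<phi> x \<in> V" if "x \<in> U" for x
    using \<phi>(1) that by (auto simp: bij_betw_def)
  have "linear_on U (\<psi> \<circ> \<phi>)"
    using \<phi>(2) \<psi>(2) \<phi>V by (simp add: linear_on_def)
  then show ?thesis
    unfolding mod_iso_iff using \<phi> \<psi> \<phi>V bij_betw_trans[OF \<phi>(1) \<psi>(1)]
    by (intro exI[of _ "\<psi> \<circ> \<phi>"]) auto
qed

lemma submoduleD:
  assumes "submodule p act V"
  shows "cv.subspace V" "A \<in> sp_alg p \<Longrightarrow> x \<in> V \<Longrightarrow> act A x \<in> V"
  using assms by (auto simp: submodule_def invariant_def csubspace_eq)

lemma submoduleI:
  assumes "cv.subspace V" "\<And>A x. A \<in> sp_alg p \<Longrightarrow> x \<in> V \<Longrightarrow> act A x \<in> V"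
  shows "submodule p act V"
  using assms by (auto simp: submodule_def invariant_def csubspace_eq)

lemma submodule_Int: "submodule p act V \<Longrightarrow> submodule p act W \<Longrightarrow> submodule p act (V \<inter> W)"
  by (auto simp: submodule_def invariant_def csubspace_eq cv.subspace_inter)

lemma irred_iff: "irred p act V \<longleftrightarrow> submodule p act V \<and> V \<noteq> {0}
     \<and> (\<forall>W. W \<subseteq> V \<and> submodule p act W \<longrightarrow> W = {0} \<or> W = V)"
  unfolding irred_def by (simp add: zero_fun_lambda)

lemma irredD:
  assumes "irred p act V"
  shows "submodule p act V" "V \<noteq> {0}" "W \<subseteq> V \<Longrightarrow> submodule p act W \<Longrightarrow> W = {0} \<or> W = V"
    "cv.subspace V"
  using assms by (auto simp: irred_iff submodule_def csubspace_eq)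

lemma subspace_nonzero: "cv.subspace V \<Longrightarrow> V \<noteq> {0} \<Longrightarrow> \<exists>x\<in>V. x \<noteq> 0"
  using cv.subspace_0 by blast

lemma submodule_image:
  assumes "submodule p act1 V" "linear_on V h"
    and "\<And>A x. A \<in> sp_alg p \<Longrightarrow> x \<in> V \<Longrightarrow> h (act1 A x) = act2 A (h x)"
  shows "submodule p act2 (h ` V)"
proof (rule submoduleI)
  show "cv.subspace (h ` V)"
    using assms linear_on_image_subspace submoduleD(1) by blast
  fix A y assume "A \<in> sp_alg p" "y \<in> h ` V"
  then show "act2 A y \<in> h ` V"
    using assms submoduleD(2)[OF assms(1)] by (auto simp flip: assms(3))
qed

lemma submodule_vimage:
  assumes "submodule p act1 V" "linear_on V h" "submodule p act2 W"
    and "\<And>A x. A \<in> sp_alg p \<Longrightarrow> x \<in> V \<Longrightarrow> h (act1 A x) = act2 A (h x)"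
  shows "submodule p act1 {x\<in>V. h x \<in> W}"
proof (rule submoduleI)
  note sV = submoduleD(1)[OF assms(1)] and sW = submoduleD(1)[OF assms(3)]
  show "cv.subspace {x\<in>V. h x \<in> W}"
    unfolding cv.subspace_def
    using sV sW linear_on_0[OF assms(2) sV] linear_onD[OF assms(2)]
    by (auto simp: cv.subspace_0 cv.subspace_add cv.subspace_scale)
  fix A x assume "A \<in> sp_alg p" "x \<in> {x\<in>V. h x \<in> W}"
  then show "act1 A x \<in> {x\<in>V. h x \<in> W}"
    using assms submoduleD(2)[OF assms(1)] submoduleD(2)[OF assms(3)] by auto
qed

text \<open>Schur's lemma: the kernel is a submodule, hence zero, and submodules of the image pull
  back to submodules of \<open>V\<close>.\<close>

lemma irred_image:
  assumes V: "irred p act1 V" and h: "linear_on V h"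
    and eq: "\<And>A x. A \<in> sp_alg p \<Longrightarrow> x \<in> V \<Longrightarrow> h (act1 A x) = act2 A (h x)"
    and act2_0: "\<And>A. act2 A 0 = 0"
    and x: "x \<in> V" "h x \<noteq> 0"
  shows "mod_iso p act1 V act2 (h ` V)" "irred p act2 (h ` V)"
proof -
  note sub = irredD(1)[OF V]
  note sV = submoduleD(1)[OF sub]
  have z: "submodule p act2 {0}"
    by (rule submoduleI) (auto simp: act2_0)
  have vim: "submodule p act1 {y\<in>V. h y \<in> W}" if "submodule p act2 W" for W
    by (rule submodule_vimage[OF sub h that]) (rule eq)
  have "{y\<in>V. h y \<in> {0}} = {0} \<or> {y\<in>V. h y \<in> {0}} = V"
    by (rule irredD(3)[OF V _ vim[OF z]]) auto
  then have "{y\<in>V. h y \<in> {0}} = {0}"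
    using x by auto
  then have "inj_on h V"
    using linear_on_inj[OF h sV] by blast
  then show "mod_iso p act1 V act2 (h ` V)"
    unfolding mod_iso_iff using h eq by (auto simp: bij_betw_def)
  have hV: "submodule p act2 (h ` V)"
    by (rule submodule_image[OF sub h]) (rule eq)
  show "irred p act2 (h ` V)"
    unfolding irred_iff
  proof (intro conjI allI impI)
    show "h ` V \<noteq> {0}" using x by (metis image_eqI singletonD)
    fix W assume W: "W \<subseteq> h ` V \<and> submodule p act2 W"
    define W' where "W' = {x\<in>V. h x \<in> W}"
    have "h ` W' = W" using W by (auto simp: W'_def)
    moreover have "W' = {0} \<or> W' = V"
      unfolding W'_def by (rule irredD(3)[OF V _ vim]) (use W in auto)
    ultimately show "W = {0} \<or> W = h ` V"
      using linear_on_0[OF h sV] by auto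
  qed (use hV in auto)
qed

text \<open>\<open>isotypic\<close> collects submodules isomorphic to a type without asking for
  irreducibility; this recovers it from the type.\<close>

lemma mod_iso_irred:
  assumes iso: "mod_iso p act1 V act2 T" and V: "submodule p act1 V" and T: "irred p act2 T"
  shows "irred p act1 V"
proof -
  obtain \<phi> where \<phi>: "bij_betw \<phi> V T" "linear_on V \<phi>"
      "\<And>A x. A \<in> sp_alg p \<Longrightarrow> x \<in> V \<Longrightarrow> \<phi> (act1 A x) = act2 A (\<phi> x)"
    using iso unfolding mod_iso_iff by blast
  have inj: "inj_on \<phi> V" and im: "\<phi> ` V = T"
    using \<phi>(1) by (auto simp: bij_betw_def)
  have \<phi>0: "\<phi> 0 = 0" using linear_on_0 \<phi>(2) submoduleD(1)[OF V] by blast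
  show ?thesis
    unfolding irred_iff
  proof (intro conjI allI impI)
    show "V \<noteq> {0}"
    proof
      assume "V = {0}"
      then have "T = {\<phi> 0}" using im by blast
      then show False using \<phi>0 irredD(2)[OF T] by simp
    qed
    fix W assume W: "W \<subseteq> V \<and> submodule p act1 W"
    have lin: "linear_on W \<phi>" using \<phi>(2) W unfolding linear_on_def by blast
    have "submodule p act2 (\<phi> ` W)"
    proof (rule submodule_image)
      show "submodule p act1 W" "linear_on W \<phi>" using W lin by auto
      show "\<phi> (act1 A x) = act2 A (\<phi> x)" if "A \<in> sp_alg p" "x \<in> W" for A x
        using W that by (intro \<phi>(3)) auto
    qed
    moreover have "\<phi> ` W \<subseteq> T"
      using W im by blast
    ultimately have "\<phi> ` W = {0} \<or> \<phi> ` W = T"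
      by (intro irredD(3)[OF T])
    then show "W = {0} \<or> W = V"
    proof
      assume a: "\<phi> ` W = {0}"
      have "w = 0" if "w \<in> W" for w
      proof -
        have "\<phi> w \<in> \<phi> ` W" using that by blast
        then have "\<phi> w = \<phi> 0" using a \<phi>0 by simp
        then show ?thesis
          using inj_onD[OF inj, of w 0] that W cv.subspace_0[OF submoduleD(1)[OF V]] by blast
      qed
      then show ?thesis using W cv.subspace_0[of W] submoduleD(1)[of p act1 W] by blast
    next
      assume "\<phi> ` W = T"
      then have "\<phi> ` W = \<phi> ` V" using im by simp
      then show ?thesis using inj_on_image_eq_iff[OF inj, of W V] W by blast
    qed
  qed (rule V)
qed

text \<open>Unitarity at the level of the Lie algebra: skew operators leave orthogonal complements
  of submodules invariant. Used for the spinors and for the tensors.\<close>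

locale skew_module =
  fixes Z :: "'a set" and p :: nat and act :: "(nat \<Rightarrow> nat \<Rightarrow> real) \<Rightarrow> ('a \<Rightarrow> complex) \<Rightarrow> ('a \<Rightarrow> complex)"
  assumes finZ: "finite Z"
    and act_add: "\<And>A x y. act A (x + y) = act A x + act A y"
    and act_scale: "\<And>A c x. act A (cscale c x) = cscale c (act A x)"
    and act_skew: "\<And>A x y. A \<in> sp_alg p \<Longrightarrow> ip Z (act A x) y = - ip Z x (act A y)"
begin

lemma act_0: "act A 0 = 0"
  using act_scale[of A 0 0] by simp

lemma submodule_span_Union:
  assumes "\<And>V. V \<in> \<V> \<Longrightarrow> submodule p act V"
  shows "submodule p act (cv.span (\<Union>\<V>))"
proof (rule submoduleI)
  fix A x assume A: "A \<in> sp_alg p" and x: "x \<in> cv.span (\<Union>\<V>)"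
  have "cv.subspace {x. act A x \<in> cv.span (\<Union>\<V>)}"
    by (auto simp: cv.subspace_def act_0 act_add act_scale cv.span_zero cv.span_add cv.span_scale)
  moreover have "\<Union>\<V> \<subseteq> {x. act A x \<in> cv.span (\<Union>\<V>)}"
  proof
    fix v assume "v \<in> \<Union>\<V>"
    then obtain V where V: "V \<in> \<V>" "v \<in> V" by blast
    then have "act A v \<in> V"
      using submoduleD(2)[OF assms A] by blast
    then show "v \<in> {x. act A x \<in> cv.span (\<Union>\<V>)}"
      using V(1) by (auto intro!: cv.span_base)
  qed
  ultimately show "act A x \<in> cv.span (\<Union>\<V>)"
    using x cv.span_minimal by blast
qed auto

lemma submodule_orth:
  assumes "submodule p act V"
  shows "submodule p act (orth Z V)"
proof (rule submoduleI)
  fix A x assume "A \<in> sp_alg p" "x \<in> orth Z V"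
  then show "act A x \<in> orth Z V"
    using submoduleD(2)[OF assms] by (auto simp: orth_def act_skew)
qed (rule subspace_orth)

lemma complete_reducibility:
  assumes "submodule p act M" "M \<subseteq> supported Z"
  shows "M \<subseteq> cv.span (\<Union>{V. V \<subseteq> M \<and> irred p act V})"
  using assms
proof (induction "cv.dim M" arbitrary: M rule: less_induct)
  case less
  consider "M = {0}" | "irred p act M"
    | W where "W \<subseteq> M" "submodule p act W" "W \<noteq> {0}" "W \<noteq> M"
    using less.prems unfolding irred_iff by blast
  then show ?case
  proof cases
    case 1
    then show ?thesis using cv.span_zero by auto
  next
    case 2
    have "M \<subseteq> \<Union>{V. V \<subseteq> M \<and> irred p act V}"
      using 2 by blast
    then show ?thesis using cv.span_superset by (rule subset_trans)
  next
    case (3 W)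
    let ?S = "cv.span (\<Union>{V. V \<subseteq> M \<and> irred p act V})"
    define W' where "W' = M \<inter> orth Z W"
    have W': "submodule p act W'" "W' \<subseteq> M"
      unfolding W'_def using submodule_Int[OF less.prems(1) submodule_orth[OF 3(2)]] by auto
    obtain w where w: "w \<in> W" "w \<noteq> 0"
      using subspace_nonzero[OF submoduleD(1)[OF 3(2)] 3(3)] by blast
    have "w \<notin> orth Z W"
      using orth_Int[OF finZ _ w(1)] w(2) 3(1) less.prems(2) by blast
    then have "W' \<noteq> M"
      using w(1) 3(1) unfolding W'_def by blast
    have sub: "N \<subseteq> ?S" if N: "submodule p act N" "N \<subseteq> M" "N \<noteq> M" for N
    proof -
      have "cv.dim N < cv.dim M"
        by (rule dim_psubset[OF finZ submoduleD(1)[OF N(1)] submoduleD(1)[OF less.prems(1)]])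
          (use N less.prems in auto)
      then have "N \<subseteq> cv.span (\<Union>{V. V \<subseteq> N \<and> irred p act V})"
        by (rule less.hyps[OF _ N(1)]) (use N less.prems in blast)
      also have "\<dots> \<subseteq> ?S"
        using N(2) by (intro cv.span_mono) blast
      finally show ?thesis .
    qed
    show ?thesis
    proof
      fix x assume "x \<in> M"
      then obtain v w where "v \<in> W" "w \<in> W'" "x = v + w"
        using orth_decomp[OF finZ submoduleD(1)[OF 3(2)] submoduleD(1)[OF less.prems(1)] 3(1)]
        unfolding W'_def by blast
      moreover from this have "v \<in> ?S" "w \<in> ?S"
        using sub[OF 3(2,1,4)] sub[OF W' \<open>W' \<noteq> M\<close>] by blast+
      ultimately show "x \<in> ?S" by (simp add: cv.span_add)
    qed
  qed
qed

text \<open>The orthogonal projection onto \<open>V\<close> is equivariant because the complement of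
  \<open>V\<close> is a submodule; it does not kill \<open>V'\<close> unless the two are orthogonal,
  so Schur's lemma applies.\<close>

lemma irred_not_orth_iso:
  assumes V: "irred p act V" and V': "irred p act V'" "V' \<subseteq> supported Z" "V \<subseteq> supported Z"
    and x: "x \<in> V" "y \<in> V'" "ip Z x y \<noteq> 0"
  shows "mod_iso p act V' act V"
proof -
  note sV = irredD(4)[OF V] and sV' = irredD(4)[OF V'(1)]
  have "\<exists>h. \<forall>z. h z \<in> V \<and> (\<forall>w\<in>V. ip Z (z - h z) w = 0)"
    using ex_orthogonal_projection[OF finZ sV] by metis
  then obtain h where h: "\<And>z. h z \<in> V" "\<And>z. z - h z \<in> orth Z V"
    unfolding orth_def by blast
  \<comment> \<open>Uniqueness of the projection; linearity and equivariance of the chosen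
    \<open>h\<close> both follow from it.\<close>
  have uniq: "h z = v" if "v \<in> V" "z - v \<in> orth Z V" for z v
  proof -
    have "(z - v) - (z - h z) \<in> orth Z V"
      by (rule cv.subspace_diff[OF subspace_orth that(2) h(2)])
    then have "h z - v \<in> orth Z V" by simp
    moreover have "h z - v \<in> V" using sV h that by (simp add: cv.subspace_diff)
    ultimately show ?thesis using orth_Int[OF finZ V'(3)] by (metis eq_iff_diff_eq_0)
  qed
  have hadd: "h (a + b) = h a + h b" for a b
  proof (rule uniq)
    show "a + b - (h a + h b) \<in> orth Z V"
      using cv.subspace_add[OF subspace_orth h(2)[of a] h(2)[of b]] by (simp add: algebra_simps)
  qed (use h sV in \<open>auto intro: cv.subspace_add\<close>)
  have hsc: "h (cscale c a) = cscale c (h a)" for a c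
  proof (rule uniq)
    show "cscale c a - cscale c (h a) \<in> orth Z V"
      using cv.subspace_scale[OF subspace_orth h(2)[of a], of c]
      by (simp add: cv.scale_right_diff_distrib)
  qed (use h sV in \<open>auto intro: cv.subspace_scale\<close>)
  have lin: "linear_on V' h" by (auto simp: linear_on_def hadd hsc)
  have eq: "h (act A z) = act A (h z)" if A: "A \<in> sp_alg p" for A z
  proof (rule uniq[of "act A (h z)" "act A z"])
    show "act A (h z) \<in> V" using submoduleD(2)[OF irredD(1)[OF V]] A h by blast
    have "act A (z - h z) \<in> orth Z V"
      using submoduleD(2)[OF submodule_orth[OF irredD(1)[OF V]]] A h by blast
    moreover have "act A z = act A (z - h z) + act A (h z)"
      by (simp flip: act_add)
    ultimately show "act A z - act A (h z) \<in> orth Z V" by simp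
  qed
  have hy: "h y \<noteq> 0"
  proof
    assume "h y = 0"
    then have "ip Z y x = 0" using h(2)[of y] x by (auto simp: orth_def)
    then show False using x(3) ip_commute[of Z x y] by simp
  qed
  have iso: "mod_iso p act V' act (h ` V')" and irr: "irred p act (h ` V')"
    by (rule irred_image(1)[OF V'(1) lin _ _ x(2) hy], simp_all add: eq act_0)
      (rule irred_image(2)[OF V'(1) lin _ _ x(2) hy], simp_all add: eq act_0)
  have "h ` V' = V"
    using irredD(3)[OF V _ irredD(1)[OF irr]] irredD(2)[OF irr] h(1) by (metis image_subsetI)
  then show ?thesis using iso by simp
qed

end

section \<open>Isotypic components\<close>

text \<open>Treats the targets with \<open>s + 1\<close> or \<open>s - 1\<close> out of range, which
  are encoded as the zero module.\<close>

lemma mod_iso_zero: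
  fixes V :: "('a \<Rightarrow> complex) set" and act2 :: "_ \<Rightarrow> _ \<Rightarrow> 'b \<Rightarrow> complex"
  assumes "mod_iso p act1 V act2 {0}" "cv.subspace V"
  shows "V = {0}"
proof -
  obtain \<phi> where bij: "bij_betw \<phi> V {0 :: 'b \<Rightarrow> complex}"
    using assms(1) unfolding mod_iso_iff by blast
  have "card V = 1"
    using bij_betw_same_card[OF bij] by simp
  then obtain x where "V = {x}"
    by (rule card_1_singletonE)
  then show ?thesis using cv.subspace_0[OF assms(2)] by simp
qed

locale tensor_skew_module = skew_module Z p "tact p" for Z p
begin

lemma isotypic_eq: "isotypic p M \<tau> = cv.span (\<Union>{V. V \<subseteq> M \<and> submodule p (tact p) V
                                 \<and> mod_iso p (tact p) V (spin_act p) \<tau>})"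
  unfolding isotypic_def cspan_eq by (rule refl)

lemma nonisotypic_eq: "nonisotypic p M \<tau> = cv.span (\<Union>{V. V \<subseteq> M \<and> irred p (tact p) V
                                 \<and> \<not> mod_iso p (tact p) V (spin_act p) \<tau>})"
  unfolding nonisotypic_def cspan_eq by (rule refl)

lemma isotypic_subset: "cv.subspace M \<Longrightarrow> isotypic p M \<tau> \<subseteq> M"
  unfolding isotypic_eq by (rule cv.span_minimal) auto

lemma nonisotypic_subset: "cv.subspace M \<Longrightarrow> nonisotypic p M \<tau> \<subseteq> M"
  unfolding nonisotypic_eq by (rule cv.span_minimal) auto

lemma submodule_nonisotypic: "submodule p (tact p) (nonisotypic p M \<tau>)"
  unfolding nonisotypic_eq by (rule submodule_span_Union) (blast dest: irredD(1))

lemma isotypic_decomp: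
  assumes M: "submodule p (tact p) M" "M \<subseteq> supported Z" and x: "x \<in> M"
  obtains u w where "u \<in> isotypic p M \<tau>" "w \<in> nonisotypic p M \<tau>" "x = u + w"
proof -
  let ?S = "{u + w | u w. u \<in> isotypic p M \<tau> \<and> w \<in> nonisotypic p M \<tau>}"
  have sub: "cv.subspace ?S"
    unfolding isotypic_eq nonisotypic_eq by (intro cv.subspace_sums cv.subspace_span)
  have "\<Union>{V. V \<subseteq> M \<and> irred p (tact p) V} \<subseteq> ?S"
  proof
    fix v assume "v \<in> \<Union>{V. V \<subseteq> M \<and> irred p (tact p) V}"
    then obtain V where V: "V \<subseteq> M" "irred p (tact p) V" "v \<in> V" by blast
    show "v \<in> ?S"
    proof (cases "mod_iso p (tact p) V (spin_act p) \<tau>")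
      case True
      then have "v \<in> isotypic p M \<tau>"
        unfolding isotypic_eq using V irredD(1)[OF V(2)] by (intro cv.span_base) blast
      moreover have "0 \<in> nonisotypic p M \<tau>"
        unfolding nonisotypic_eq by (rule cv.span_zero)
      moreover have "v = v + 0" by simp
      ultimately show ?thesis by blast
    next
      case False
      then have "v \<in> nonisotypic p M \<tau>"
        unfolding nonisotypic_eq using V by (intro cv.span_base) blast
      moreover have "0 \<in> isotypic p M \<tau>"
        unfolding isotypic_eq by (rule cv.span_zero)
      moreover have "v = 0 + v" by simp
      ultimately show ?thesis by blast
    qed
  qed
  then have "cv.span (\<Union>{V. V \<subseteq> M \<and> irred p (tact p) V}) \<subseteq> ?S"
    using sub by (rule cv.span_minimal)
  then have "x \<in> ?S"
    using complete_reducibility[OF M] x by blast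
  then show ?thesis using that by blast
qed

text \<open>Different types are orthogonal. This makes the two parts of \<open>M\<close>
  independent, which is what gives the \<open>THE\<close> in \<open>SW_proj\<close> a unique
  witness.\<close>

lemma isotypic_orth:
  assumes M: "M \<subseteq> supported Z" and \<tau>: "\<tau> = {0} \<or> irred p (spin_act p) \<tau>"
    and u: "u \<in> isotypic p M \<tau>" and w: "w \<in> nonisotypic p M \<tau>"
  shows "ip Z u w = 0"
proof (rule span_orth_span[OF _ u[unfolded isotypic_eq] w[unfolded nonisotypic_eq]])
  fix x y
  assume "x \<in> \<Union>{V. V \<subseteq> M \<and> submodule p (tact p) V \<and> mod_iso p (tact p) V (spin_act p) \<tau>}"
  then obtain V where V: "V \<subseteq> M" "submodule p (tact p) V" "mod_iso p (tact p) V (spin_act p) \<tau>" "x \<in> V"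
    by blast
  assume "y \<in> \<Union>{V. V \<subseteq> M \<and> irred p (tact p) V \<and> \<not> mod_iso p (tact p) V (spin_act p) \<tau>}"
  then obtain V' where V': "V' \<subseteq> M" "irred p (tact p) V'" "\<not> mod_iso p (tact p) V' (spin_act p) \<tau>" "y \<in> V'"
    by blast
  show "ip Z x y = 0"
  proof (cases "\<tau> = {0}")
    case True
    then have "V = {0}"
      using mod_iso_zero[OF V(3)[unfolded True] submoduleD(1)[OF V(2)]] by blast
    then show ?thesis using V(4) by simp
  next
    case False
    then have "irred p (spin_act p) \<tau>" using \<tau> by blast
    then have irr: "irred p (tact p) V" by (rule mod_iso_irred[OF V(3,2)])
    show ?thesis
    proof (rule ccontr)
      assume "ip Z x y \<noteq> 0"
      then have "mod_iso p (tact p) V' (tact p) V"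
        by (rule irred_not_orth_iso[OF irr V'(2) order_trans[OF V'(1) M] order_trans[OF V(1) M] V(4) V'(4)])
      then have "mod_iso p (tact p) V' (spin_act p) \<tau>"
        using V(3) by (rule mod_iso_trans)
      then show False using V'(3) by simp
    qed
  qed
qed

lemma SW_proj_eq:
  assumes Ti: "Ti = tensor p Wi U" "submodule p (tact p) Ti" "Ti \<subseteq> supported Z"
    and Tj: "Tj = tensor p Wj U" "cv.subspace Tj" "Ti \<inter> Tj = {0}"
    and \<tau>: "\<tau> = {0} \<or> irred p (spin_act p) \<tau>"
    and u: "u \<in> isotypic p Ti \<tau>" and w: "w \<in> nonisotypic p Ti \<tau>" and v: "v \<in> Tj"
  shows "SW_proj p U Wi Wj \<tau> (u + w + v) = u"
proof -
  have eq0: "u + w + v = (\<lambda>z. u z + v z + w z)"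
    by (simp add: fun_eq_iff pointwise)
  show ?thesis
    unfolding SW_proj_def
  proof (rule the_equality)
  show "u \<in> isotypic p (tensor p Wi U) \<tau> \<and>
    (\<exists>v'\<in>tensor p Wj U. \<exists>w'\<in>nonisotypic p (tensor p Wi U) \<tau>. u + w + v = (\<lambda>z. u z + v' z + w' z))"
    using u v w eq0 unfolding Ti(1) Tj(1) by (intro conjI bexI)
next
  fix u' assume "u' \<in> isotypic p (tensor p Wi U) \<tau> \<and>
    (\<exists>v'\<in>tensor p Wj U. \<exists>w'\<in>nonisotypic p (tensor p Wi U) \<tau>. u + w + v = (\<lambda>z. u' z + v' z + w' z))"
  then obtain v' w' where *: "u' \<in> isotypic p (tensor p Wi U) \<tau>"
    "w' \<in> nonisotypic p (tensor p Wi U) \<tau>" "v' \<in> tensor p Wj U"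
    and eq: "u + w + v = (\<lambda>z. u' z + v' z + w' z)"
    by (elim conjE bexE) (rule that)
  note u' = *(1)[folded Ti(1)] and w' = *(2)[folded Ti(1)] and v' = *(3)[folded Tj(1)]
  note sTi = submoduleD(1)[OF Ti(2)]
  have "u + w + v = u' + v' + w'" unfolding eq by (simp add: fun_eq_iff pointwise)
  moreover have "(u' - u) + (w' - w) - (v - v') = (u' + v' + w') - (u + w + v)" by simp
  ultimately have eq': "(u' - u) + (w' - w) = v - v'" by simp
  have ui: "u' - u \<in> isotypic p Ti \<tau>"
    using u u' unfolding isotypic_eq by (intro cv.span_diff)
  have wi: "w' - w \<in> nonisotypic p Ti \<tau>"
    using w w' unfolding nonisotypic_eq by (intro cv.span_diff)
  have "v - v' \<in> Tj" using v v' Tj(2) by (simp add: cv.subspace_diff)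
  moreover have "v - v' \<in> Ti"
    unfolding eq'[symmetric] using ui wi isotypic_subset[OF sTi] nonisotypic_subset[OF sTi]
    by (intro cv.subspace_add[OF sTi]) auto
  ultimately have "v - v' = 0" using Tj(3) by blast
  then have "u' - u + (w' - w) = 0" using eq' by (simp only:)
  then have "u' - u = - (w' - w)" by (rule add_eq_0_iff2[THEN iffD1])
  \<comment> \<open>The same vector lies in the isotypic and, up to sign, in the nonisotypic part,
    so it is orthogonal to itself.\<close>
  moreover have "ip Z (u' - u) (w' - w) = 0"
    by (rule isotypic_orth[OF Ti(3) \<tau> ui wi])
  ultimately have "ip Z (u' - u) (u' - u) = 0" by (simp only: ip_simps(8) neg_equal_0_iff_equal)
  moreover have "u' - u \<in> supported Z"
    using isotypic_subset[OF sTi] Ti(3) ui by blast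
  ultimately have "u' - u = 0"
    using supported_eq_0I[OF _ finZ] by blast
  then show "u' = u" by simp
  qed
qed

lemma isotypic_Int:
  assumes "cv.subspace M" "M \<subseteq> supported Z" "\<tau> = {0} \<or> irred p (spin_act p) \<tau>"
    and "x \<in> isotypic p M \<tau>" "x \<in> nonisotypic p M \<tau>"
  shows "x = 0"
proof (rule supported_eq_0I[OF _ finZ])
  show "x \<in> supported Z" using isotypic_subset[OF assms(1)] assms(2,4) by blast
  show "ip Z x x = 0" by (rule isotypic_orth[OF assms(2-5)])
qed

end

section \<open>Linear operators on the Clifford algebra\<close>

text \<open>As a type of its own the linear maps form a ring, so that commutator calculations are
  noncommutative ring algebra for the simplifier.\<close>

typedef op = "{f :: cl \<Rightarrow> cl. (\<forall>x y. f (x + y) = f x + f y) \<and> (\<forall>c x. f (cscale c x) = cscale c (f x))}"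
  morphisms ap Op
  by (rule exI[of _ id]) auto

setup_lifting type_definition_op

lemma ap_add [simp]: "ap T (x + y) = ap T x + ap T y"
  and ap_scale [simp]: "ap T (cscale c x) = cscale c (ap T x)"
  using ap[of T] by auto

lemma ap_0 [simp]: "ap T 0 = 0"
  using ap_scale[of T 0 0] by simp

lemma ap_minus [simp]: "ap T (- x) = - ap T x"
  using ap_scale[of T "-1" x] by simp

lemma ap_diff [simp]: "ap T (x - y) = ap T x - ap T y"
  using ap_add[of T x "- y"] by simp

lemma ap_sum: "ap T (\<Sum>a\<in>A. f a) = (\<Sum>a\<in>A. ap T (f a))"
  by (induction A rule: infinite_finite_induct) auto

lemma op_eqI: "(\<And>x. ap S x = ap T x) \<Longrightarrow> S = T"
  by (metis ap_inject ext)

instantiation op :: ring_1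
begin

lift_definition zero_op :: op is "\<lambda>_. 0" by auto
lift_definition one_op :: op is "\<lambda>x. x" by auto
lift_definition plus_op :: "op \<Rightarrow> op \<Rightarrow> op" is "\<lambda>f g x. f x + g x"
  by (auto simp: cv.scale_right_distrib)
lift_definition minus_op :: "op \<Rightarrow> op \<Rightarrow> op" is "\<lambda>f g x. f x - g x"
  by (auto simp: cv.scale_right_diff_distrib)
lift_definition uminus_op :: "op \<Rightarrow> op" is "\<lambda>f x. - f x"
  by auto
lift_definition times_op :: "op \<Rightarrow> op \<Rightarrow> op" is "\<lambda>f g x. f (g x)"
  by auto

instance
proof
  fix a b c :: op
  show "a + b + c = a + (b + c)" by transfer (simp add: add.assoc)
  show "a + b = b + a" by transfer (simp add: add.commute)
  show "0 + a = a" by transfer simp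
  show "- a + a = 0" by transfer simp
  show "a - b = a + - b" by transfer simp
  show "a * b * c = a * (b * c)" by transfer simp
  show "(a + b) * c = a * c + b * c" by transfer simp
  show "a * (b + c) = a * b + a * c" by transfer simp
  show "1 * a = a" "a * 1 = a" by (transfer; simp)+
  show "(0::op) \<noteq> 1"
  proof
    assume "(0::op) = 1"
    then have "(0::cl) = (\<lambda>_. 1)" by transfer meson
    then show False by (simp add: fun_eq_iff pointwise)
  qed
qed

end

lemma ap_op [simp]:
  "ap 0 x = 0" "ap 1 x = x" "ap (S + T) x = ap S x + ap T x" "ap (S - T) x = ap S x - ap T x"
  "ap (- T) x = - ap T x" "ap (S * T) x = ap S (ap T x)"
  by (transfer; simp)+

lemma ap_op_sum: "ap (\<Sum>a\<in>A. T a) x = (\<Sum>a\<in>A. ap (T a) x)"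
  by (induction A rule: infinite_finite_induct) auto

text \<open>Complex scalars enter the ring as central elements.\<close>

lift_definition sc :: "complex \<Rightarrow> op" is cscale
  by (auto simp: cv.scale_right_distrib mult.commute)

lemma ap_sc [simp]: "ap (sc c) x = cscale c x"
  by transfer simp

lemma sc_simps: "sc 0 = 0" "sc 1 = 1" "sc (a + b) = sc a + sc b" "sc (a - b) = sc a - sc b"
  "sc (- a) = - sc a" "sc (a * b) = sc a * sc b"
  by (auto intro!: op_eqI simp: cv.scale_left_distrib cv.scale_left_diff_distrib)

lemma sc_commute: "T * sc c = sc c * T"
  by (auto intro!: op_eqI)

lemma sc_commute': "T * (sc c * S) = sc c * (T * S)"
  by (auto intro!: op_eqI)

lemma sc_sc: "sc a * (sc b * T) = sc (a * b) * T"
  by (auto intro!: op_eqI)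

lemma sc_of_nat: "sc (of_nat n) = of_nat n"
  by (induction n) (auto simp: sc_simps)

lemma sc_numeral: "sc (numeral n) = numeral n"
  using sc_of_nat[of "numeral n"] by simp

lemma ap_numeral: "ap (numeral n) x = cscale (numeral n) x"
  by (simp flip: sc_numeral)

section \<open>Clifford multiplication\<close>

text \<open>The case \<open>b = a\<close> carries the sign of the square of a generator, so that
  transpositions and squares are counted by one condition.\<close>

definition bsign :: "nat \<Rightarrow> nat \<Rightarrow> complex" where
  "bsign a b = (if b \<le> a then -1 else 1)"

lemma bsign_square [simp]: "bsign a b * bsign a b = 1"
  by (simp add: bsign_def)

text \<open>The sign is a bicharacter of the group of finite sets under symmetric difference,
  which makes the product associative.\<close>

lemma csign_eq_prod:
  assumes "finite A" "finite B"
  shows "csign A B = (\<Prod>a\<in>A. \<Prod>b\<in>B. bsign a b)"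
proof -
  let ?L = "{(a,b). a \<in> A \<and> b \<in> B \<and> b < a}" and ?D = "(\<lambda>a. (a,a)) ` (A \<inter> B)"
  have L: "finite ?L"
    by (rule finite_subset[of _ "A \<times> B"]) (use assms in auto)
  have "card (A \<inter> B) = card ?D"
    by (rule card_image[symmetric]) (auto simp: inj_on_def)
  moreover have "card (?L \<union> ?D) = card ?L + card ?D"
    by (rule card_Un_disjoint) (use L assms in auto)
  moreover have "?L \<union> ?D = (A \<times> B) \<inter> {x. snd x \<le> fst x}"
    by auto
  ultimately have "csign A B = (-1) ^ card ((A \<times> B) \<inter> {x. snd x \<le> fst x})"
    unfolding csign_def by simp
  also have "\<dots> = (\<Prod>x\<in>A \<times> B. if snd x \<le> fst x then -1 else 1)"
    using assms by (simp add: prod.If_cases)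
  also have "\<dots> = (\<Prod>a\<in>A. \<Prod>b\<in>B. bsign a b)"
    by (simp add: prod.cartesian_product bsign_def case_prod_beta)
  finally show ?thesis .
qed

lemma prod_sym_diff:
  fixes f :: "'a \<Rightarrow> complex"
  assumes "finite A" "finite B" "\<And>x. f x * f x = 1"
  shows "prod f (sym_diff A B) = prod f A * prod f B"
proof -
  have "prod f A = prod f (A - B) * prod f (A \<inter> B)"
    using assms by (metis Int_Diff_disjoint Un_Diff_Int finite_Diff finite_Int inf_commute prod.union_disjoint)
  moreover have "prod f B = prod f (B - A) * prod f (A \<inter> B)"
    using assms by (metis Int_Diff_disjoint Un_Diff_Int finite_Diff finite_Int inf_commute prod.union_disjoint)
  moreover have "prod f (sym_diff A B) = prod f (A - B) * prod f (B - A)"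
    by (rule prod.union_disjoint) (use assms in auto)
  moreover have "prod f (A \<inter> B) * prod f (A \<inter> B) = 1"
    using assms by (simp flip: prod.distrib)
  ultimately show ?thesis by simp
qed

lemma csign_sym_diff_left:
  assumes "finite A" "finite A'" "finite B"
  shows "csign (sym_diff A A') B = csign A B * csign A' B"
  using assms by (simp add: csign_eq_prod prod_sym_diff flip: prod.distrib)

lemma csign_sym_diff_right:
  assumes "finite A" "finite B" "finite B'"
  shows "csign A (sym_diff B B') = csign A B * csign A B'"
  using assms by (simp add: csign_eq_prod prod_sym_diff flip: prod.distrib)

text \<open>The product is defined on all functions, so the index set \<open>B\<close> may be
  infinite; only its elements up to \<open>n\<close> can form inversions with \<open>A\<close>,
  which brings back finite sets.\<close>

lemma csign_restrict:
  assumes "A \<subseteq> {1..n}"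
  shows "csign A B = csign A (B \<inter> {..n})"
proof -
  have "{(a,b). a \<in> A \<and> b \<in> B \<and> b < a} = {(a,b). a \<in> A \<and> b \<in> B \<inter> {..n} \<and> b < a}"
    using assms by fastforce
  moreover have "A \<inter> B = A \<inter> (B \<inter> {..n})" using assms by auto
  ultimately show ?thesis unfolding csign_def by simp
qed

text \<open>The 2-cocycle identity behind associativity, a consequence of
  bimultiplicativity.\<close>

lemma csign_cocycle:
  assumes "A \<subseteq> {1..n}" "B \<subseteq> {1..n}"
  shows "csign A B * csign (sym_diff A B) C = csign A (sym_diff B C) * csign B C"
proof -
  have fin: "finite A" "finite B" "finite (C \<inter> {..n})"
    using assms finite_subset by auto
  have AB: "sym_diff A B \<subseteq> {1..n}" using assms by auto
  have "sym_diff B C \<inter> {..n} = sym_diff B (C \<inter> {..n})" using assms by auto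
  then show ?thesis
    using fin csign_restrict[OF assms(1), of "sym_diff B C"] csign_restrict[OF assms(2), of C]
      csign_restrict[OF AB, of C]
    by (simp add: csign_sym_diff_left csign_sym_diff_right)
qed

lemma sum_Pow_sym_diff:
  assumes "B \<subseteq> {1..n::nat}"
  shows "(\<Sum>A\<in>Pow {1..n}. f (sym_diff B A)) = (\<Sum>A\<in>Pow {1..n}. f A)"
  by (rule sum.reindex_bij_witness[of _ "sym_diff B" "sym_diff B"]) (use assms in auto)

lemma sym_diff_cancel: "sym_diff B (sym_diff B A) = A"
  by auto

lemma clmul_assoc: "clmul n (clmul n x y) z = clmul n x (clmul n y z)"
proof
  fix C
  let ?P = "Pow {1..n}"
  have "clmul n (clmul n x y) z C
    = (\<Sum>A\<in>?P. \<Sum>B\<in>?P. x B * y (sym_diff B A) * csign B (sym_diff B A) * z (sym_diff A C) * csign A (sym_diff A C))"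
    by (simp add: clmul_def sum_distrib_right)
  also have "\<dots> = (\<Sum>B\<in>?P. \<Sum>A\<in>?P. x B * y (sym_diff B A) * csign B (sym_diff B A) * z (sym_diff A C) * csign A (sym_diff A C))"
    by (rule sum.swap)
  also have "\<dots> = (\<Sum>B\<in>?P. \<Sum>D\<in>?P. x B * y D * z (sym_diff D (sym_diff B C)) * csign D (sym_diff D (sym_diff B C)) * csign B (sym_diff B C))"
  proof (rule sum.cong[OF refl])
    fix B assume "B \<in> ?P"
    then have B: "B \<subseteq> {1..n}" by simp
    have "(\<Sum>A\<in>?P. x B * y (sym_diff B A) * csign B (sym_diff B A) * z (sym_diff A C) * csign A (sym_diff A C))
      = (\<Sum>A\<in>?P. x B * y (sym_diff B (sym_diff B A)) * csign B (sym_diff B (sym_diff B A))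
          * z (sym_diff (sym_diff B A) C) * csign (sym_diff B A) (sym_diff (sym_diff B A) C))"
      by (rule sum_Pow_sym_diff[OF B, symmetric])
    also have "\<dots> = (\<Sum>D\<in>?P. x B * y D * z (sym_diff D (sym_diff B C)) * csign D (sym_diff D (sym_diff B C)) * csign B (sym_diff B C))"
    proof (rule sum.cong[OF refl])
      fix D assume "D \<in> ?P"
      then have D: "D \<subseteq> {1..n}" by simp
      have 1: "sym_diff (sym_diff B D) C = sym_diff D (sym_diff B C)" by auto
      have 2: "sym_diff D (sym_diff D (sym_diff B C)) = sym_diff B C" by (rule sym_diff_cancel)
      have "csign B D * csign (sym_diff B D) (sym_diff D (sym_diff B C))
        = csign B (sym_diff B C) * csign D (sym_diff D (sym_diff B C))"
        using csign_cocycle[OF B D, of "sym_diff D (sym_diff B C)"] unfolding 2 .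
      then show "x B * y (sym_diff B (sym_diff B D)) * csign B (sym_diff B (sym_diff B D))
          * z (sym_diff (sym_diff B D) C) * csign (sym_diff B D) (sym_diff (sym_diff B D) C)
        = x B * y D * z (sym_diff D (sym_diff B C)) * csign D (sym_diff D (sym_diff B C)) * csign B (sym_diff B C)"
        unfolding sym_diff_cancel 1 by (simp add: mult.assoc mult.left_commute)
    qed
    finally show "(\<Sum>A\<in>?P. x B * y (sym_diff B A) * csign B (sym_diff B A) * z (sym_diff A C) * csign A (sym_diff A C))
      = (\<Sum>D\<in>?P. x B * y D * z (sym_diff D (sym_diff B C)) * csign D (sym_diff D (sym_diff B C)) * csign B (sym_diff B C))" .
  qed
  also have "\<dots> = clmul n x (clmul n y z) C"
    by (simp add: clmul_def sum_distrib_right sum_distrib_left mult.assoc)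
  finally show "clmul n (clmul n x y) z C = clmul n x (clmul n y z) C" .
qed

lift_definition lm :: "nat \<Rightarrow> cl \<Rightarrow> op" is clmul
  by (auto simp: clmul_def fun_eq_iff pointwise algebra_simps sum.distrib sum_distrib_left)

lemma ap_lm: "ap (lm n x) y = clmul n x y"
  by transfer simp

lemma lm_simps:
  "lm n (clmul n x y) = lm n x * lm n y"
  "lm n (cladd x y) = lm n x + lm n y"
  "lm n (clscale c x) = sc c * lm n x"
  by (auto intro!: op_eqI simp: ap_lm clmul_assoc)
     (auto simp: clmul_def cladd_def clscale_def fun_eq_iff pointwise algebra_simps sum.distrib sum_distrib_left)

lemma csign_empty [simp]: "csign {} C = 1"
  by (simp add: csign_def)

lemma lm_clone: "lm n clone = 1"
proof (rule op_eqI)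
  fix y :: cl
  have "clmul n clone y C = y C" for C
  proof -
    have "clmul n clone y C = (\<Sum>A\<in>Pow {1..n}. if A = {} then y C else 0)"
      unfolding clmul_def by (rule sum.cong) (auto simp: clone_def)
    then show ?thesis by simp
  qed
  then show "ap (lm n clone) y = ap 1 y" by (simp add: ap_lm fun_eq_iff)
qed

definition E :: "nat \<Rightarrow> nat \<Rightarrow> op" where
  "E n a = lm n (cle a)"

lemma ap_E:
  assumes "a \<in> {1..n}"
  shows "ap (E n a) y C = y (sym_diff {a} C) * csign {a} (sym_diff {a} C)"
proof -
  have "ap (E n a) y C = (\<Sum>A\<in>Pow {1..n}. if A = {a} then y (sym_diff {a} C) * csign {a} (sym_diff {a} C) else 0)"
    unfolding E_def ap_lm clmul_def by (rule sum.cong) (auto simp: cle_def)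
  then show ?thesis using assms by simp
qed

lemma csign_singletons: "csign {a} {b} = bsign a b"
  by (simp add: csign_eq_prod)

lemma E_mult:
  assumes "a \<in> {1..n}" "b \<in> {1..n}"
  shows "E n a * E n b = lm n (clscale (bsign a b) (\<lambda>C. if C = sym_diff {a} {b} then 1 else 0))"
proof -
  have "clmul n (cle a) (cle b) = clscale (bsign a b) (\<lambda>C. if C = sym_diff {a} {b} then 1 else 0)"
  proof
    fix C
    have "sym_diff {a} C = {b} \<longleftrightarrow> C = sym_diff {a} {b}"
    proof
      assume "sym_diff {a} C = {b}"
      then have "sym_diff {a} (sym_diff {a} C) = sym_diff {a} {b}" by (simp only:)
      then show "C = sym_diff {a} {b}" by (simp only: sym_diff_cancel)
    qed (simp only: sym_diff_cancel)
    then show "clmul n (cle a) (cle b) C = clscale (bsign a b) (\<lambda>C. if C = sym_diff {a} {b} then 1 else 0) C"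
      using ap_E[OF assms(1), of "cle b" C] csign_singletons[of a b]
      by (auto simp: E_def ap_lm cle_def clscale_def)
  qed
  then show ?thesis by (simp add: E_def flip: lm_simps(1))
qed

lemma clifford:
  assumes "a \<in> {1..n}" "b \<in> {1..n}"
  shows "E n a * E n b + E n b * E n a = (if a = b then - 2 else 0)"
proof (cases "a = b")
  case True
  have "E n a * E n a = - 1"
    using E_mult[of a n a] assms unfolding lm_simps by (simp add: bsign_def sc_simps lm_clone flip: clone_def)
  then show ?thesis using True by simp
next
  case False
  have "sym_diff {a} {b} = sym_diff {b} {a}" by auto
  moreover have "bsign b a = - bsign a b" using False by (auto simp: bsign_def)
  ultimately show ?thesis
    using False E_mult[OF assms] E_mult[OF assms(2,1)] by (simp add: lm_simps sc_simps)
qed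

abbreviation Zc :: "nat \<Rightarrow> nat set set" where "Zc n \<equiv> Pow {1..n}"

text \<open>A generator permutes the basis by the involution \<open>sym_diff {a}\<close> up to sign,
  and the signs in the two directions are opposite since the generator squares to -1.\<close>

lemma E_skew:
  assumes "a \<in> {1..n}"
  shows "ip (Zc n) (ap (E n a) x) y = - ip (Zc n) x (ap (E n a) y)"
proof -
  have a: "{a} \<subseteq> {1..n}" using assms by simp
  have "ip (Zc n) (ap (E n a) x) y = (\<Sum>C\<in>Zc n. x (sym_diff {a} C) * csign {a} (sym_diff {a} C) * cnj (y C))"
    by (simp add: ip_def ap_E[OF assms])
  also have "\<dots> = (\<Sum>C\<in>Zc n. x (sym_diff {a} (sym_diff {a} C)) * csign {a} (sym_diff {a} (sym_diff {a} C)) * cnj (y (sym_diff {a} C)))"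
    by (rule sum_Pow_sym_diff[OF a, symmetric])
  also have "\<dots> = (\<Sum>C\<in>Zc n. - (x C * cnj (y (sym_diff {a} C) * csign {a} (sym_diff {a} C))))"
  proof (rule sum.cong[OF refl])
    fix C assume "C \<in> Zc n"
    then have "finite C" using finite_subset by auto
    then have "csign {a} (sym_diff {a} C) = - csign {a} C"
      by (simp add: csign_sym_diff_right csign_singletons bsign_def)
    moreover have "cnj (csign {a} C) = csign {a} C" by (simp add: csign_def)
    ultimately show "x (sym_diff {a} (sym_diff {a} C)) * csign {a} (sym_diff {a} (sym_diff {a} C)) * cnj (y (sym_diff {a} C))
      = - (x C * cnj (y (sym_diff {a} C) * csign {a} (sym_diff {a} C)))"
      unfolding sym_diff_cancel by simp
  qed
  also have "\<dots> = - ip (Zc n) x (ap (E n a) y)"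
    by (simp add: ip_def ap_E[OF assms] sum_negf)
  finally show ?thesis .
qed

lemma clmul_supported:
  assumes "y \<in> supported (Zc n)"
  shows "clmul n x y \<in> supported (Zc n)"
proof -
  have "y (sym_diff A C) = 0" if "A \<subseteq> {1..n}" "\<not> C \<subseteq> {1..n}" for A C
  proof -
    have "\<not> sym_diff A C \<subseteq> {1..n}" using that by blast
    then show ?thesis using assms by (auto simp: supported_def)
  qed
  then show ?thesis by (auto simp: supported_def clmul_def intro!: sum.neutral)
qed

section \<open>The quaternion units\<close>

text \<open>The units 1, I, J, K are numbered 0, 1, 2, 3; unit u sends the basis vector b to
  sg u b times the basis vector pm u b.\<close>

definition pm :: "nat \<Rightarrow> nat \<Rightarrow> nat" where
  "pm u b = (if u = 0 then b
     else if u = 1 then (if odd b then b + 1 else b - 1)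
     else if u = 2 then (if b mod 4 = 1 \<or> b mod 4 = 2 then b + 2 else b - 2)
     else (if b mod 4 = 1 then b + 3 else if b mod 4 = 2 then b + 1
           else if b mod 4 = 3 then b - 1 else b - 3))"

definition sg :: "nat \<Rightarrow> nat \<Rightarrow> real" where
  "sg u b = (if u = 0 then 1
     else if u = 1 then (if odd b then 1 else -1)
     else if u = 2 then (if b mod 4 = 1 \<or> b mod 4 = 0 then 1 else -1)
     else (if b mod 4 = 1 \<or> b mod 4 = 2 then 1 else -1))"

text \<open>\<open>qx\<close> and \<open>qs\<close> are the quaternion multiplication table, split
  into index and sign: \<open>u\<close> after \<open>v\<close> is \<open>qs u v\<close> times unit
  \<open>qx u v\<close>. For distinct imaginary units the indices add up to 6.\<close>

definition qx :: "nat \<Rightarrow> nat \<Rightarrow> nat" where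
  "qx u v = (if u = 0 then v else if v = 0 then u else if u = v then 0 else 6 - u - v)"

definition qs :: "nat \<Rightarrow> nat \<Rightarrow> real" where
  "qs u v = (if u = 0 \<or> v = 0 then 1 else if u = v then -1
     else if (u, v) \<in> {(1,2), (2,3), (3,1)} then 1 else -1)"

lemma less_4_cases: "u < (4::nat) \<longleftrightarrow> u = 0 \<or> u = 1 \<or> u = 2 \<or> u = 3"
  by auto

text \<open>The units act inside the blocks \<open>4*j+1, ..., 4*j+4\<close>, each a copy of the
  quaternions, so identities between them reduce to four indices.\<close>

lemma pm_sg_shift:
  assumes "i \<in> {1,2,3,4}"
  shows "pm u (4 * j + i) = 4 * j + pm u i" "sg u (4 * j + i) = sg u i" "pm u i \<in> {1,2,3,4}"
  using assms by (auto simp: pm_def sg_def)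

lemma mod4_cases:
  assumes "c \<ge> (1::nat)"
  obtains j i where "i \<in> {1,2,3,4}" "c = 4 * j + i"
proof -
  have "c - 1 = 4 * ((c - 1) div 4) + (c - 1) mod 4" by simp
  moreover have "(c - 1) mod 4 < 4" by simp
  ultimately have "c = 4 * ((c - 1) div 4) + ((c - 1) mod 4 + 1)" "(c - 1) mod 4 + 1 \<in> {1,2,3,4}"
    using assms by auto
  then show ?thesis using that by blast
qed

lemma pm_comp:
  assumes "c \<ge> 1" "u < 4" "v < 4"
  shows "pm u (pm v c) = pm (qx u v) c" and "sg v c * sg u (pm v c) = qs u v * sg (qx u v) c"
proof -
  obtain j i where i: "i \<in> {1,2,3,4}" and c: "c = 4 * j + i"
    by (rule mod4_cases[OF assms(1)])
  have "pm u (pm v i) = pm (qx u v) i \<and> sg v i * sg u (pm v i) = qs u v * sg (qx u v) i"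
    using i assms(2,3) unfolding less_4_cases insert_iff empty_iff
    by (elim disjE FalseE; simp add: pm_def sg_def qx_def qs_def)
  then show "pm u (pm v c) = pm (qx u v) c" and "sg v c * sg u (pm v c) = qs u v * sg (qx u v) c"
    unfolding c using pm_sg_shift[OF i] pm_sg_shift[OF pm_sg_shift(3)[OF i]] by simp_all
qed

lemma sum4: "(\<Sum>u<4. f u) = f 0 + f 1 + f 2 + f (3::nat)"
  by (simp add: lessThan_nat_numeral lessThan_Suc add.commute)

declare One_nat_def [simp del]

lemma pm_range:
  assumes "a \<in> {1..4*p}"
  shows "pm u a \<in> {1..4*p}"
proof -
  have "a \<ge> 1" using assms by simp
  then obtain j i where i: "i \<in> {1,2,3,4}" and a: "a = 4 * j + i"
    by (rule mod4_cases)
  have "1 \<le> i" using i by auto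
  have "1 \<le> pm u i \<and> pm u i \<le> 4"
    using pm_sg_shift(3)[OF i, of u] unfolding insert_iff empty_iff by (elim disjE) simp_all
  moreover have "j < p" using assms \<open>1 \<le> i\<close> unfolding a by simp
  ultimately show ?thesis
    unfolding a pm_sg_shift(1)[OF i] atLeastAtMost_iff by linarith
qed

lemma pm_invol:
  assumes "a \<ge> 1" "u < 4"
  shows "pm u (pm u a) = a"
  using pm_comp(1)[OF assms assms(2)] by (simp add: qx_def pm_def)

lemma sg_invol:
  assumes "a \<ge> 1" "u < 4"
  shows "sg u a * sg u (pm u a) = qs u u"
  using pm_comp(2)[OF assms assms(2)] by (simp add: qx_def sg_def)

lemma sg_square [simp]: "sg u a * sg u a = 1"
  by (simp add: sg_def)

lemma qs_square [simp]: "qs u v * qs u v = 1"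
  by (simp add: qs_def)

definition q :: "nat \<Rightarrow> nat \<Rightarrow> nat \<Rightarrow> real" where
  "q u a b = (if a = pm u b then sg u b else 0)"

lemma Imat_q: "Imat a b = q 1 a b"
proof (cases "odd b")
  case True
  then show ?thesis by (simp add: Imat_def q_def IM_def pm_def sg_def cle_def)
next
  case False
  then show ?thesis by (simp add: Imat_def q_def IM_def pm_def sg_def cle_def clscale_def)
qed

lemma Jmat_q: "Jmat a b = q 2 a b"
proof -
  consider "b mod 4 = 1" | "b mod 4 = 2" | "b mod 4 = 3" | "b mod 4 = 0" by linarith
  then show ?thesis
    by cases (simp_all add: Jmat_def q_def JM_def pm_def sg_def cle_def clscale_def)
qed

lemma sum_q:
  assumes "c \<in> {1..4*p}"
  shows "(\<Sum>b\<in>{1..4*p}. f b * q u b c) = f (pm u c) * sg u c"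
proof -
  have "(\<Sum>b\<in>{1..4*p}. f b * q u b c) = (\<Sum>b\<in>{1..4*p}. if b = pm u c then f (pm u c) * sg u c else 0)"
    by (intro sum.cong refl) (simp add: q_def)
  also have "\<dots> = f (pm u c) * sg u c"
    using pm_range[OF assms, of u] by (simp only: sum.delta' sum.delta finite_atLeastAtMost if_True)
  finally show ?thesis .
qed

lemma q_mult:
  assumes "c \<in> {1..4*p}" "u < 4" "v < 4"
  shows "(\<Sum>b\<in>{1..4*p}. q u a b * q v b c) = qs u v * q (qx u v) a c"
proof -
  have c: "c \<ge> 1" using assms by simp
  have "(\<Sum>b\<in>{1..4*p}. q u a b * q v b c) = (if a = pm u (pm v c) then sg v c * sg u (pm v c) else 0)"
    unfolding sum_q[OF assms(1)] by (simp add: q_def)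
  also have "\<dots> = qs u v * q (qx u v) a c"
    unfolding pm_comp[OF c assms(2,3)] by (simp add: q_def)
  finally show ?thesis .
qed

text \<open>A unit is an orthogonal matrix whose square is the scalar \<open>qs u u\<close>, which
  determines its transpose.\<close>

lemma q_transpose:
  assumes "a \<ge> 1" "b \<ge> 1" "u < 4"
  shows "q u b a = qs u u * q u a b"
proof (cases "a = pm u b")
  case True
  then have "b = pm u a" using pm_invol[OF assms(2,3)] by (simp only:)
  have *: "sg u b * sg u a = qs u u"
    using sg_invol[OF assms(2,3)] unfolding True[symmetric] .
  have "sg u a = (sg u b * sg u b) * sg u a" by simp
  also have "\<dots> = sg u b * (sg u b * sg u a)" by (rule mult.assoc)
  also have "\<dots> = qs u u * sg u b" unfolding * by (rule mult.commute)
  finally have "sg u a = qs u u * sg u b" .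
  moreover have "q u b a = sg u a" unfolding q_def using \<open>b = pm u a\<close> by (rule if_P)
  moreover have "q u a b = sg u b" unfolding q_def using True by (rule if_P)
  ultimately show ?thesis by (simp only:)
next
  case False
  then have "b \<noteq> pm u a" using pm_invol[OF assms(1,3)] by auto
  then show ?thesis using False by (simp add: q_def)
qed

lemma q_mult_transpose:
  assumes "a \<in> {1..4*p}" "c \<in> {1..4*p}" "u < 4" "v < 4"
  shows "(\<Sum>b\<in>{1..4*p}. q u a b * q v c b) = qs v v * (qs u v * q (qx u v) a c)"
proof -
  have "(\<Sum>b\<in>{1..4*p}. q u a b * q v c b) = (\<Sum>b\<in>{1..4*p}. qs v v * (q u a b * q v b c))"
  proof (rule sum.cong[OF refl])
    fix b assume "b \<in> {1..4*p}"
    then have "q v c b = qs v v * q v b c" using assms by (intro q_transpose) auto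
    then show "q u a b * q v c b = qs v v * (q u a b * q v b c)" by (simp only: ac_simps)
  qed
  then show ?thesis using q_mult[OF assms(2-4)] by (simp flip: sum_distrib_left)
qed

lemma sp_algD:
  assumes "A \<in> sp_alg p"
  shows "A a b = - A b a" "a \<notin> {1..4*p} \<or> b \<notin> {1..4*p} \<Longrightarrow> A a b = 0"
  using assms unfolding sp_alg_def by blast+

lemma sp_alg_q:
  assumes A: "A \<in> sp_alg p" and ac: "a \<in> {1..4*p}" "c \<in> {1..4*p}" and "u < 4"
  shows "(\<Sum>b\<in>{1..4*p}. A a b * q u b c) = (\<Sum>b\<in>{1..4*p}. q u a b * A b c)"
proof -
  have I: "(\<Sum>b\<in>{1..4*p}. A a b * q 1 b c) = (\<Sum>b\<in>{1..4*p}. q 1 a b * A b c)"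
    if "a \<in> {1..4*p}" "c \<in> {1..4*p}" for a c
    using A that unfolding sp_alg_def Imat_q by blast
  have J: "(\<Sum>b\<in>{1..4*p}. A a b * q 2 b c) = (\<Sum>b\<in>{1..4*p}. q 2 a b * A b c)"
    if "a \<in> {1..4*p}" "c \<in> {1..4*p}" for a c
    using A that unfolding sp_alg_def Jmat_q by blast
  have q0: "q 0 x y * z = (if x = y then z else 0)" "z * q 0 x y = (if x = y then z else 0)" for x y z
    by (simp_all add: q_def pm_def sg_def)
  have q3: "(\<Sum>d\<in>{1..4*p}. q 1 x d * q 2 d y) = q 3 x y" if "y \<in> {1..4*p}" for x y
    using q_mult[OF that, of 1 2 x] by (simp add: qs_def qx_def)
  consider "u = 0" | "u = 1" | "u = 2" | "u = 3" using \<open>u < 4\<close> by linarith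
  then show ?thesis
  proof cases
    case 1
    then show ?thesis using ac by (simp add: q0)
  next
    case 4
    have "(\<Sum>b\<in>{1..4*p}. A a b * q 3 b c) = (\<Sum>b\<in>{1..4*p}. \<Sum>d\<in>{1..4*p}. A a b * q 1 b d * q 2 d c)"
      using ac by (simp add: sum_distrib_left mult.assoc flip: q3)
    also have "\<dots> = (\<Sum>d\<in>{1..4*p}. (\<Sum>b\<in>{1..4*p}. A a b * q 1 b d) * q 2 d c)"
      by (subst sum.swap) (simp add: sum_distrib_right)
    also have "\<dots> = (\<Sum>d\<in>{1..4*p}. (\<Sum>b\<in>{1..4*p}. q 1 a b * A b d) * q 2 d c)"
      using I ac by simp
    also have "\<dots> = (\<Sum>b\<in>{1..4*p}. q 1 a b * (\<Sum>d\<in>{1..4*p}. A b d * q 2 d c))"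
      by (simp add: sum_distrib_right sum_distrib_left mult.assoc) (rule sum.swap)
    also have "\<dots> = (\<Sum>b\<in>{1..4*p}. q 1 a b * (\<Sum>d\<in>{1..4*p}. q 2 b d * A d c))"
      using J ac by simp
    also have "\<dots> = (\<Sum>d\<in>{1..4*p}. (\<Sum>b\<in>{1..4*p}. q 1 a b * q 2 b d) * A d c)"
      by (simp add: sum_distrib_right sum_distrib_left mult.assoc) (rule sum.swap)
    also have "\<dots> = (\<Sum>b\<in>{1..4*p}. q 3 a b * A b c)"
      using q3 by simp
    finally show ?thesis using 4 by simp
  qed (use I J ac in auto)
qed

section \<open>Generators of the Lie algebra\<close>

text \<open>The average of the elementary skew matrix over conjugation by the quaternion units.\<close>

definition Ag :: "nat \<Rightarrow> nat \<Rightarrow> nat \<Rightarrow> nat \<Rightarrow> nat \<Rightarrow> real" where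
  "Ag p a b c d = (if c \<in> {1..4*p} \<and> d \<in> {1..4*p}
     then (\<Sum>u<4. q u c a * q u d b - q u c b * q u d a) / 4 else 0)"

lemma Ag_eq: "c \<in> {1..4*p} \<Longrightarrow> d \<in> {1..4*p} \<Longrightarrow>
    Ag p a b c d = (\<Sum>u<4. q u c a * q u d b - q u c b * q u d a) / 4"
  by (simp add: Ag_def)

lemma Ag_sp_alg:
  assumes ab: "a \<in> {1..4*p}" "b \<in> {1..4*p}"
  shows "Ag p a b \<in> sp_alg p"
proof -
  have comm: "(\<Sum>d\<in>{1..4*p}. Ag p a b c d * q v d e) = (\<Sum>d\<in>{1..4*p}. q v c d * Ag p a b d e)"
    if ce: "c \<in> {1..4*p}" "e \<in> {1..4*p}" and v: "v < 4" for c e v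
  proof -
    have 1: "(\<Sum>d\<in>{1..4*p}. q u d x * q v d e) = qs v v * (qs v u * q (qx v u) e x)"
      if "x \<in> {1..4*p}" "u < 4" for u x
    proof -
      have "(\<Sum>d\<in>{1..4*p}. q u d x * q v d e) = (\<Sum>d\<in>{1..4*p}. qs v v * (q v e d * q u d x))"
      proof (rule sum.cong[OF refl])
        fix d assume "d \<in> {1..4*p}"
        then have "q v d e = qs v v * q v e d" using ce v by (intro q_transpose) auto
        then show "q u d x * q v d e = qs v v * (q v e d * q u d x)" by (simp only: ac_simps)
      qed
      then show ?thesis using q_mult[OF that(1) v that(2)] by (simp flip: sum_distrib_left)
    qed
    have "(\<Sum>d\<in>{1..4*p}. Ag p a b c d * q v d e)
      = (\<Sum>d\<in>{1..4*p}. \<Sum>u<4. (q u c a * (q u d b * q v d e) - q u c b * (q u d a * q v d e)) / 4)"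
      using ce by (simp add: Ag_eq sum_distrib_right sum_divide_distrib) (intro sum.cong refl, simp add: field_simps)
    also have "\<dots> = (\<Sum>u<4. (q u c a * (\<Sum>d\<in>{1..4*p}. q u d b * q v d e) - q u c b * (\<Sum>d\<in>{1..4*p}. q u d a * q v d e)) / 4)"
      by (subst sum.swap) (simp add: sum_distrib_left sum_subtractf flip: sum_divide_distrib)
    also have "\<dots> = (\<Sum>u<4. (q u c a * (qs v v * (qs v u * q (qx v u) e b)) - q u c b * (qs v v * (qs v u * q (qx v u) e a))) / 4)"
      using 1 ab by simp
    \<comment> \<open>Reindexing the sum by multiplication with \<open>v\<close>, which permutes the
      four units up to sign.\<close>
    also have "\<dots> = (\<Sum>u<4. ((qs v u * q (qx v u) c a) * q u e b - (qs v u * q (qx v u) c b) * q u e a) / 4)"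
      using v unfolding sum4 less_4_cases
      by (elim disjE) (simp_all add: qs_def qx_def One_nat_def algebra_simps)
    also have "\<dots> = (\<Sum>u<4. ((\<Sum>d\<in>{1..4*p}. q v c d * q u d a) * q u e b - (\<Sum>d\<in>{1..4*p}. q v c d * q u d b) * q u e a) / 4)"
      using q_mult[OF ab(1) v] q_mult[OF ab(2) v] by simp
    also have "\<dots> = (\<Sum>d\<in>{1..4*p}. \<Sum>u<4. (q v c d * q u d a * q u e b - q v c d * q u d b * q u e a) / 4)"
      by (subst sum.swap) (simp add: sum_distrib_right sum_subtractf flip: sum_divide_distrib)
    also have "\<dots> = (\<Sum>d\<in>{1..4*p}. q v c d * Ag p a b d e)"
      using ce by (simp add: Ag_eq sum_distrib_left sum_divide_distrib) (intro sum.cong refl, simp add: field_simps)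
    finally show ?thesis .
  qed
  have skew: "Ag p a b c d = - Ag p a b d c" for c d
  proof -
    have "(\<Sum>u<4. q u c a * q u d b - q u c b * q u d a) = - (\<Sum>u<4. q u d a * q u c b - q u d b * q u c a)"
      unfolding sum4 by (simp add: algebra_simps)
    then show ?thesis unfolding Ag_def by (simp add: algebra_simps)
  qed
  have zero: "Ag p a b c d = 0" if "c \<notin> {1..4*p} \<or> d \<notin> {1..4*p}" for c d
    using that unfolding Ag_def by auto
  show ?thesis
    unfolding sp_alg_def Imat_q Jmat_q mem_Collect_eq
  proof (intro conjI allI ballI impI)
    fix c d show "Ag p a b c d = - Ag p a b d c" by (rule skew)
  next
    fix c d assume "c \<notin> {1..4*p} \<or> d \<notin> {1..4*p}"
    then show "Ag p a b c d = 0" by (rule zero)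
  next
    fix c e assume "c \<in> {1..4*p}" "e \<in> {1..4*p}"
    then show "(\<Sum>d\<in>{1..4*p}. Ag p a b c d * q 1 d e) = (\<Sum>d\<in>{1..4*p}. q 1 c d * Ag p a b d e)"
      and "(\<Sum>d\<in>{1..4*p}. Ag p a b c d * q 2 d e) = (\<Sum>d\<in>{1..4*p}. q 2 c d * Ag p a b d e)"
      by (rule comm; simp)+
  qed
qed

text \<open>Every row of the multiplication table is a permutation of the units.\<close>

lemma sum_qx: "(\<Sum>u<4. \<Sum>v<4. F (qx u v)) = 4 * (\<Sum>w<4. F w)" for F :: "nat \<Rightarrow> real"
  unfolding sum4 by (simp add: qx_def One_nat_def)

text \<open>Half of \<open>Ag\<close>, as a kernel on pairs of indices, is the orthogonal projection
  onto the Lie algebra, whence the factor 2. The matrices \<open>Ag p a b\<close> thus form a tight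
  frame, which takes the place of an orthonormal basis in the Casimir sums.\<close>

lemma Ag_reproducing:
  assumes "c \<in> {1..4*p}" "d \<in> {1..4*p}" "e \<in> {1..4*p}" "f \<in> {1..4*p}"
  shows "(\<Sum>a\<in>{1..4*p}. \<Sum>b\<in>{1..4*p}. Ag p a b c d * Ag p a b e f) = 2 * Ag p c d e f"
proof -
  let ?N = "{1..4*p}"
  define X where "X u v x y = (\<Sum>a\<in>?N. q u x a * q v y a)" for u v x y
  \<comment> \<open>All signs of the table occur twice and cancel, so only the product unit
    remains.\<close>
  have XX: "X u v x y * X u v x' y' = q (qx u v) x y * q (qx u v) x' y'"
    if "u < 4" "v < 4" "x \<in> ?N" "y \<in> ?N" "x' \<in> ?N" "y' \<in> ?N" for u v x y x' y'
  proof -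
    have "X u v x y * X u v x' y' = (qs v v * qs v v) * ((qs u v * qs u v) * (q (qx u v) x y * q (qx u v) x' y'))"
      unfolding X_def q_mult_transpose[OF that(3,4,1,2)] q_mult_transpose[OF that(5,6,1,2)]
      by (simp only: ac_simps)
    then show ?thesis by simp
  qed
  have prodsum: "(\<Sum>a\<in>?N. \<Sum>b\<in>?N. (f a * g b) * (h a * k b)) = (\<Sum>a\<in>?N. f a * h a) * (\<Sum>b\<in>?N. g b * k b)"
    for f g h k :: "nat \<Rightarrow> real"
    by (simp add: sum_product ac_simps)
  have prodsum': "(\<Sum>a\<in>?N. \<Sum>b\<in>?N. (f b * g a) * (h b * k a)) = (\<Sum>a\<in>?N. f a * h a) * (\<Sum>b\<in>?N. g b * k b)"
    for f g h k :: "nat \<Rightarrow> real"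
    by (subst sum.swap) (rule prodsum)
  have inner: "(\<Sum>a\<in>?N. \<Sum>b\<in>?N. (q u c a * q u d b - q u c b * q u d a) * (q v e a * q v f b - q v e b * q v f a))
     = 2 * (X u v c e * X u v d f - X u v c f * X u v d e)" for u v
  proof -
    have "(\<Sum>a\<in>?N. \<Sum>b\<in>?N. (q u c a * q u d b - q u c b * q u d a) * (q v e a * q v f b - q v e b * q v f a))
      = (\<Sum>a\<in>?N. \<Sum>b\<in>?N. (q u c a * q u d b) * (q v e a * q v f b)) - (\<Sum>a\<in>?N. \<Sum>b\<in>?N. (q u c a * q u d b) * (q v f a * q v e b))
      - (\<Sum>a\<in>?N. \<Sum>b\<in>?N. (q u c b * q u d a) * (q v f b * q v e a)) + (\<Sum>a\<in>?N. \<Sum>b\<in>?N. (q u c b * q u d a) * (q v e b * q v f a))"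
      by (simp add: sum_subtractf sum.distrib algebra_simps)
    then show ?thesis unfolding prodsum prodsum' X_def by simp
  qed
  have "(\<Sum>a\<in>?N. \<Sum>b\<in>?N. Ag p a b c d * Ag p a b e f)
     = (\<Sum>a\<in>?N. \<Sum>b\<in>?N. \<Sum>u<4. \<Sum>v<4. (q u c a * q u d b - q u c b * q u d a) * (q v e a * q v f b - q v e b * q v f a)) / 16"
    using assms by (simp add: Ag_eq sum_product sum_divide_distrib)
  also have "(\<Sum>a\<in>?N. \<Sum>b\<in>?N. \<Sum>u<4. \<Sum>v<4. (q u c a * q u d b - q u c b * q u d a) * (q v e a * q v f b - q v e b * q v f a))
     = (\<Sum>u<4. \<Sum>v<4. \<Sum>a\<in>?N. \<Sum>b\<in>?N. (q u c a * q u d b - q u c b * q u d a) * (q v e a * q v f b - q v e b * q v f a))"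
    by (simp only: sum.swap[of _ ?N "{..<4}"])
  also have "\<dots> = (\<Sum>u<4. \<Sum>v<4. 2 * (X u v c e * X u v d f - X u v c f * X u v d e))"
    by (simp only: inner)
  also have "\<dots> = (\<Sum>u<4. \<Sum>v<4. 2 * (q (qx u v) c e * q (qx u v) d f - q (qx u v) c f * q (qx u v) d e))"
    by (intro sum.cong refl) (use assms XX in simp)
  also have "\<dots> = 8 * (\<Sum>w<4. q w c e * q w d f - q w c f * q w d e)"
    by (subst sum_qx[where F = "\<lambda>w. 2 * (q w c e * q w d f - q w c f * q w d e)"]) (simp add: sum_distrib_left)
  also have "(\<Sum>w<4. q w c e * q w d f - q w c f * q w d e) = (\<Sum>w<4. q w e c * q w f d - q w e d * q w f c)"
  proof (rule sum.cong[OF refl])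
    fix w :: nat assume "w \<in> {..<4}"
    then have w: "w < 4" by simp
    have t: "q w x y * q w x' y' = q w y x * q w y' x'" if "x \<in> ?N" "y \<in> ?N" "x' \<in> ?N" "y' \<in> ?N" for x y x' y'
    proof -
      have "q w x y = qs w w * q w y x" "q w x' y' = qs w w * q w y' x'"
        using that w by (auto intro!: q_transpose)
      then have "q w x y * q w x' y' = (qs w w * qs w w) * (q w y x * q w y' x')"
        by (simp only: ac_simps)
      then show ?thesis by simp
    qed
    show "q w c e * q w d f - q w c f * q w d e = q w e c * q w f d - q w e d * q w f c"
      using t[OF assms(1,3,2,4)] t[OF assms(1,4,2,3)] by simp
  qed
  finally show ?thesis using assms by (simp add: Ag_eq)
qed

text \<open>Only the unit 1 has a trace. Together with \<open>Ag_reproducing\<close> this gives the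
  Casimir value \<open>-(2p+1)\<close> of the vector representation, which equals
  \<open>kap p 1\<close>.\<close>

lemma Ag_trace:
  assumes "c \<in> {1..4*p}" "e \<in> {1..4*p}"
  shows "(\<Sum>d\<in>{1..4*p}. Ag p c d d e) = (if c = e then - (real p + 1/2) else 0)"
proof -
  let ?N = "{1..4*p}"
  have tr: "(\<Sum>d\<in>?N. q u d d) = (if u = 0 then 4 * real p else 0)" if "u < 4" for u
  proof (cases "u = 0")
    case False
    have "q u d d = 0" if "d \<in> ?N" for d
    proof -
      have "d \<ge> 1" using that by simp
      then obtain j i where i: "i \<in> {1,2,3,4}" and d: "d = 4 * j + i"
        by (rule mod4_cases)
      have "pm u i \<noteq> i" using i False \<open>u < 4\<close> by (auto simp: pm_def)
      then show ?thesis unfolding q_def d pm_sg_shift(1)[OF i] by simp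
    qed
    then show ?thesis using False by simp
  qed (simp add: q_def pm_def sg_def)
  have "(\<Sum>d\<in>?N. Ag p c d d e) = (\<Sum>d\<in>?N. \<Sum>u<4. (q u e d * q u d c - q u d d * q u e c) / 4)"
    using assms by (simp add: Ag_eq sum_divide_distrib mult.commute)
  also have "\<dots> = (\<Sum>u<4. ((\<Sum>d\<in>?N. q u e d * q u d c) - (\<Sum>d\<in>?N. q u d d) * q u e c) / 4)"
    by (subst sum.swap) (simp add: sum_subtractf sum_distrib_right flip: sum_divide_distrib)
  also have "\<dots> = (\<Sum>u<4. (qs u u * q 0 e c - (if u = 0 then 4 * real p else 0) * q u e c) / 4)"
    by (intro sum.cong refl) (use assms in \<open>simp add: q_mult tr qx_def\<close>)
  also have "\<dots> = (if c = e then - (real p + 1/2) else 0)"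
    unfolding sum4 by (simp add: qs_def q_def pm_def sg_def field_simps)
  finally show ?thesis .
qed

section \<open>Rotated Clifford vectors, the spin action and the commuting su(2)\<close>

instantiation op :: real_algebra_1
begin

definition scaleR_op :: "real \<Rightarrow> op \<Rightarrow> op" where
  "scaleR_op r T = sc (of_real r) * T"

instance
proof
  fix a b :: real and x y :: op
  show "a *\<^sub>R (x + y) = a *\<^sub>R x + a *\<^sub>R y"
    by (simp add: scaleR_op_def distrib_left)
  show "(a + b) *\<^sub>R x = a *\<^sub>R x + b *\<^sub>R x"
    by (simp add: scaleR_op_def sc_simps distrib_right)
  show "a *\<^sub>R b *\<^sub>R x = (a * b) *\<^sub>R x"
    by (simp add: scaleR_op_def sc_sc)
  show "1 *\<^sub>R x = x"
    by (simp add: scaleR_op_def sc_simps)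
  show "a *\<^sub>R x * y = a *\<^sub>R (x * y)"
    by (simp add: scaleR_op_def mult.assoc)
  show "x * a *\<^sub>R y = a *\<^sub>R (x * y)"
    by (simp add: scaleR_op_def sc_commute')
qed

end

lemma ap_scaleR [simp]: "ap (r *\<^sub>R T) x = cscale (of_real r) (ap T x)"
  by (simp add: scaleR_op_def)

lemma op_ext: "(\<And>x C. ap S x C = ap T x C) \<Longrightarrow> S = T"
  by (rule op_eqI, rule ext)

lemmas op_pointwise = pointwise ap_op ap_op_sum ap_numeral

abbreviation EE :: "nat \<Rightarrow> nat \<Rightarrow> op" where "EE p \<equiv> E (4*p)"

abbreviation NN :: "nat \<Rightarrow> nat set" where "NN p \<equiv> {1..4*p}"

text \<open>The Clifford vector u(e_a) as an operator; these are the coefficients of the four Dirac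
  operators, see \<open>lm_units\<close>.\<close>

definition Ue :: "nat \<Rightarrow> nat \<Rightarrow> nat \<Rightarrow> op" where
  "Ue p u a = sg u a *\<^sub>R EE p (pm u a)"

lemma Ue_0: "Ue p 0 a = EE p a"
  by (simp add: Ue_def sg_def pm_def)

lemma Ue_sum:
  assumes "c \<in> NN p"
  shows "Ue p u c = (\<Sum>a\<in>NN p. q u a c *\<^sub>R EE p a)"
proof -
  have "(\<Sum>a\<in>NN p. q u a c *\<^sub>R EE p a) = (\<Sum>a\<in>NN p. if a = pm u c then Ue p u c else 0)"
    by (intro sum.cong refl) (simp add: q_def Ue_def)
  also have "\<dots> = Ue p u c"
    using pm_range[OF assms, of u] by (simp only: sum.delta' sum.delta finite_atLeastAtMost if_True)
  finally show ?thesis by simp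
qed

lemma pm_eq_iff:
  assumes "a \<ge> 1" "b \<ge> 1" "u < 4"
  shows "pm u a = pm u b \<longleftrightarrow> a = b"
  using pm_invol[OF assms(1,3)] pm_invol[OF assms(2,3)] by metis

lemma Ue_clifford:
  assumes "a \<in> NN p" "b \<in> NN p" "u < 4"
  shows "Ue p u a * Ue p u b + Ue p u b * Ue p u a = (if a = b then - 2 else 0)"
proof -
  have "Ue p u a * Ue p u b + Ue p u b * Ue p u a
      = (sg u a * sg u b) *\<^sub>R (EE p (pm u a) * EE p (pm u b) + EE p (pm u b) * EE p (pm u a))"
    by (simp add: Ue_def scaleR_add_right mult.commute)
  also have "\<dots> = (if a = b then - 2 else 0)"
    unfolding clifford[OF pm_range[OF assms(1)] pm_range[OF assms(2)]]
    using assms pm_eq_iff[of a b u] by simp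
  finally show ?thesis .
qed

lemma E_Ue:
  assumes "a \<in> NN p" "b \<in> NN p"
  shows "EE p a * Ue p u b + Ue p u b * EE p a = (- 2 * q u a b) *\<^sub>R 1"
proof -
  have "EE p a * Ue p u b + Ue p u b * EE p a
      = sg u b *\<^sub>R (EE p a * EE p (pm u b) + EE p (pm u b) * EE p a)"
    by (simp add: Ue_def scaleR_add_right)
  also have "\<dots> = (- 2 * q u a b) *\<^sub>R 1"
    unfolding clifford[OF assms(1) pm_range[OF assms(2)]]
    by (simp add: q_def scaleR_op_def sc_simps sc_numeral sc_commute)
  finally show ?thesis .
qed

definition spo :: "nat \<Rightarrow> (nat \<Rightarrow> nat \<Rightarrow> real) \<Rightarrow> op" where
  "spo p A = (- 1/4) *\<^sub>R (\<Sum>a\<in>NN p. \<Sum>b\<in>NN p. A a b *\<^sub>R (EE p a * EE p b))"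

lemma spin_act_eq: "spin_act p A \<psi> = ap (spo p A) \<psi>"
proof
  fix C
  have "ap (spo p A) \<psi> C = (- 1/4) * (\<Sum>a\<in>NN p. \<Sum>b\<in>NN p. of_real (A a b) * clmul (4*p) (cle a) (clmul (4*p) (cle b) \<psi>) C)"
    unfolding spo_def by (simp add: op_pointwise E_def ap_lm)
  then show "spin_act p A \<psi> C = ap (spo p A) \<psi> C"
    unfolding spin_act_def by (simp add: sum_distrib_left mult.assoc)
qed

text \<open>The defining property of the spin lift: commuting with a vector applies \<open>A\<close>
  to it. It fixes the factor -1/4.\<close>

lemma spo_comm_E:
  assumes skew: "\<And>a b. A a b = - A b a" and c: "c \<in> NN p"
  shows "spo p A * EE p c = EE p c * spo p A + (\<Sum>a\<in>NN p. A a c *\<^sub>R EE p a)"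
proof -
  let ?S = "\<Sum>a\<in>NN p. \<Sum>b\<in>NN p. A a b *\<^sub>R (EE p a * EE p b)"
  have 1: "EE p a * EE p b * EE p c - EE p c * (EE p a * EE p b)
      = (if b = c then (-2) *\<^sub>R EE p a else 0) - (if a = c then (-2) *\<^sub>R EE p b else 0)"
    if "a \<in> NN p" "b \<in> NN p" for a b
  proof -
    have "EE p a * EE p b * EE p c - EE p c * (EE p a * EE p b)
      = EE p a * (EE p b * EE p c + EE p c * EE p b) - (EE p a * EE p c + EE p c * EE p a) * EE p b"
      by (simp add: algebra_simps)
    also have "\<dots> = EE p a * (if b = c then - 2 else 0) - (if a = c then - 2 else 0) * EE p b"
      unfolding clifford[OF that(2) c] clifford[OF that(1) c] ..
    also have "\<dots> = (if b = c then (-2) *\<^sub>R EE p a else 0) - (if a = c then (-2) *\<^sub>R EE p b else 0)"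
      by (auto intro!: op_ext simp: op_pointwise)
    finally show ?thesis .
  qed
  have "?S * EE p c - EE p c * ?S = (\<Sum>a\<in>NN p. \<Sum>b\<in>NN p. A a b *\<^sub>R (EE p a * EE p b * EE p c - EE p c * (EE p a * EE p b)))"
    by (simp add: sum_distrib_left sum_distrib_right sum_subtractf scaleR_diff_right)
  also have "\<dots> = (\<Sum>a\<in>NN p. \<Sum>b\<in>NN p. A a b *\<^sub>R ((if b = c then (-2) *\<^sub>R EE p a else 0) - (if a = c then (-2) *\<^sub>R EE p b else 0)))"
    by (intro sum.cong refl) (simp only: 1)
  also have "\<dots> = (\<Sum>a\<in>NN p. \<Sum>b\<in>NN p. (if b = c then (-2 * A a c) *\<^sub>R EE p a else 0)
      - (if a = c then (-2 * A c b) *\<^sub>R EE p b else 0))"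
    by (intro sum.cong refl) (auto simp: mult.commute)
  also have "\<dots> = (\<Sum>a\<in>NN p. \<Sum>b\<in>NN p. if b = c then (-2 * A a c) *\<^sub>R EE p a else 0)
      - (\<Sum>a\<in>NN p. \<Sum>b\<in>NN p. if a = c then (-2 * A c b) *\<^sub>R EE p b else 0)"
    by (simp only: sum_subtractf)
  also have "(\<Sum>a\<in>NN p. \<Sum>b\<in>NN p. if a = c then (-2 * A c b) *\<^sub>R EE p b else 0)
      = (\<Sum>b\<in>NN p. \<Sum>a\<in>NN p. if a = c then (-2 * A c b) *\<^sub>R EE p b else 0)"
    by (rule sum.swap)
  also have "(\<Sum>a\<in>NN p. \<Sum>b\<in>NN p. if b = c then (-2 * A a c) *\<^sub>R EE p a else 0) - \<dots>
      = (\<Sum>a\<in>NN p. (-2 * A a c) *\<^sub>R EE p a) - (\<Sum>b\<in>NN p. (-2 * A c b) *\<^sub>R EE p b)"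
    using c by simp
  also have "\<dots> = (\<Sum>a\<in>NN p. (-4) *\<^sub>R (A a c *\<^sub>R EE p a))"
    unfolding sum_subtractf[symmetric]
  proof (rule sum.cong[OF refl])
    fix a
    have t: "A c a = - A a c" by (rule skew)
    show "(-2 * A a c) *\<^sub>R EE p a - (-2 * A c a) *\<^sub>R EE p a = (-4) *\<^sub>R (A a c *\<^sub>R EE p a)"
      unfolding t by (rule op_ext) (simp add: op_pointwise)
  qed
  finally have 2: "?S * EE p c - EE p c * ?S = (-4) *\<^sub>R (\<Sum>a\<in>NN p. A a c *\<^sub>R EE p a)"
    by (simp only: scaleR_sum_right)
  have "spo p A * EE p c - EE p c * spo p A = (-1/4) *\<^sub>R (?S * EE p c - EE p c * ?S)"
    unfolding spo_def by (simp add: scaleR_diff_right)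
  also have "\<dots> = (\<Sum>a\<in>NN p. A a c *\<^sub>R EE p a)"
    unfolding 2 by simp
  finally show ?thesis by (simp add: algebra_simps)
qed

lemma spo_comm_Ue:
  assumes A: "A \<in> sp_alg p" and c: "c \<in> NN p" and u: "u < 4"
  shows "spo p A * Ue p u c = Ue p u c * spo p A + (\<Sum>d\<in>NN p. A d c *\<^sub>R Ue p u d)"
proof -
  have "spo p A * Ue p u c = (\<Sum>d\<in>NN p. q u d c *\<^sub>R (spo p A * EE p d))"
    unfolding Ue_sum[OF c] by (simp add: sum_distrib_left)
  also have "\<dots> = (\<Sum>d\<in>NN p. q u d c *\<^sub>R (EE p d * spo p A + (\<Sum>a\<in>NN p. A a d *\<^sub>R EE p a)))"
    by (intro sum.cong refl) (simp only: spo_comm_E[OF sp_algD(1)[OF A]])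
  also have "\<dots> = Ue p u c * spo p A + (\<Sum>d\<in>NN p. \<Sum>a\<in>NN p. (A a d * q u d c) *\<^sub>R EE p a)"
    unfolding Ue_sum[OF c] by (simp add: scaleR_add_right sum.distrib sum_distrib_right scaleR_sum_right mult.commute)
  also have "(\<Sum>d\<in>NN p. \<Sum>a\<in>NN p. (A a d * q u d c) *\<^sub>R EE p a) = (\<Sum>a\<in>NN p. (\<Sum>d\<in>NN p. A a d * q u d c) *\<^sub>R EE p a)"
    by (subst sum.swap) (simp add: scaleR_sum_left)
  also have "\<dots> = (\<Sum>a\<in>NN p. (\<Sum>d\<in>NN p. q u a d * A d c) *\<^sub>R EE p a)"
    by (intro sum.cong refl) (simp only: sp_alg_q[OF A _ c u])
  also have "\<dots> = (\<Sum>d\<in>NN p. A d c *\<^sub>R (\<Sum>a\<in>NN p. q u a d *\<^sub>R EE p a))"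
    by (simp add: scaleR_sum_left scaleR_sum_right mult.commute) (rule sum.swap)
  also have "\<dots> = (\<Sum>d\<in>NN p. A d c *\<^sub>R Ue p u d)"
    by (intro sum.cong refl) (simp only: Ue_sum)
  finally show ?thesis .
qed

definition om :: "nat \<Rightarrow> nat \<Rightarrow> op" where
  "om p u = (\<Sum>a\<in>NN p. EE p a * Ue p u a)"

lemma spo_comm_om:
  assumes A: "A \<in> sp_alg p" and u: "u < 4"
  shows "spo p A * om p u = om p u * spo p A"
proof -
  have 1: "spo p A * (EE p a * Ue p u a) = EE p a * Ue p u a * spo p A
      + ((\<Sum>d\<in>NN p. A d a *\<^sub>R (EE p a * Ue p u d)) + (\<Sum>d\<in>NN p. A d a *\<^sub>R (EE p d * Ue p u a)))"
    if a: "a \<in> NN p" for a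
  proof -
    have "spo p A * (EE p a * Ue p u a) = (spo p A * EE p a) * Ue p u a" by (simp only: mult.assoc)
    also have "\<dots> = EE p a * (spo p A * Ue p u a) + (\<Sum>d\<in>NN p. A d a *\<^sub>R EE p d) * Ue p u a"
      unfolding spo_comm_E[OF sp_algD(1)[OF A] a] by (simp only: distrib_right mult.assoc)
    also have "\<dots> = EE p a * Ue p u a * spo p A
      + (EE p a * (\<Sum>d\<in>NN p. A d a *\<^sub>R Ue p u d) + (\<Sum>d\<in>NN p. A d a *\<^sub>R EE p d) * Ue p u a)"
      unfolding spo_comm_Ue[OF A a u] by (simp only: distrib_left mult.assoc add.assoc)
    finally show ?thesis by (simp add: sum_distrib_left sum_distrib_right)
  qed
  \<comment> \<open>Exchanging the two indices and using skewness of \<open>A\<close>, the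
    variations of the two Clifford factors cancel.\<close>
  have "(\<Sum>a\<in>NN p. \<Sum>d\<in>NN p. A d a *\<^sub>R (EE p d * Ue p u a)) = (\<Sum>a\<in>NN p. \<Sum>d\<in>NN p. A a d *\<^sub>R (EE p a * Ue p u d))"
    by (rule sum.swap)
  also have "\<dots> = - (\<Sum>a\<in>NN p. \<Sum>d\<in>NN p. A d a *\<^sub>R (EE p a * Ue p u d))"
    unfolding sum_negf[symmetric]
  proof (intro sum.cong refl)
    fix a d
    have "A a d = - A d a" by (rule sp_algD(1)[OF A])
    then show "A a d *\<^sub>R (EE p a * Ue p u d) = - (A d a *\<^sub>R (EE p a * Ue p u d))" by simp
  qed
  finally have 2: "(\<Sum>a\<in>NN p. (\<Sum>d\<in>NN p. A d a *\<^sub>R (EE p a * Ue p u d)) + (\<Sum>d\<in>NN p. A d a *\<^sub>R (EE p d * Ue p u a))) = 0"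
    by (simp add: sum.distrib)
  have "spo p A * om p u = (\<Sum>a\<in>NN p. spo p A * (EE p a * Ue p u a))"
    unfolding om_def by (rule sum_distrib_left)
  also have "\<dots> = (\<Sum>a\<in>NN p. EE p a * Ue p u a * spo p A
      + ((\<Sum>d\<in>NN p. A d a *\<^sub>R (EE p a * Ue p u d)) + (\<Sum>d\<in>NN p. A d a *\<^sub>R (EE p d * Ue p u a))))"
    by (intro sum.cong refl) (simp only: 1)
  also have "\<dots> = om p u * spo p A"
    unfolding sum.distrib[of "\<lambda>a. EE p a * Ue p u a * spo p A"] 2 om_def by (simp add: sum_distrib_right)
  finally show ?thesis .
qed

text \<open>Up to a factor, \<open>om p u\<close> is the spin lift of the unit \<open>u\<close>
  itself; each of its two Clifford factors contributes half of the 4.\<close>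

lemma om_E:
  assumes a: "a \<in> NN p" and u: "u \<in> {1,2,3}"
  shows "om p u * EE p a = EE p a * om p u + 4 *\<^sub>R Ue p u a"
proof -
  have 1: "EE p b * Ue p u b * EE p a = EE p a * (EE p b * Ue p u b) + ((if b = a then 2 *\<^sub>R Ue p u a else 0) + 2 *\<^sub>R (q u b a *\<^sub>R EE p b))"
    if b: "b \<in> NN p" for b
  proof -
    have t: "q u a b = - q u b a"
      using q_transpose[of b a u] a b u by (auto simp: qs_def)
    have "EE p b * Ue p u b * EE p a = EE p b * (EE p a * Ue p u b + Ue p u b * EE p a) - (EE p b * EE p a + EE p a * EE p b) * Ue p u b + EE p a * (EE p b * Ue p u b)"
      by (simp add: algebra_simps)
    also have "\<dots> = EE p b * ((- 2 * q u a b) *\<^sub>R 1) - (if b = a then - 2 else 0) * Ue p u b + EE p a * (EE p b * Ue p u b)"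
      unfolding E_Ue[OF a b] clifford[OF b a] ..
    also have "\<dots> = EE p a * (EE p b * Ue p u b) + ((if b = a then 2 *\<^sub>R Ue p u a else 0) + 2 *\<^sub>R (q u b a *\<^sub>R EE p b))"
      unfolding t by (auto intro!: op_ext simp: op_pointwise)
    finally show ?thesis .
  qed
  have "om p u * EE p a = (\<Sum>b\<in>NN p. EE p b * Ue p u b * EE p a)"
    unfolding om_def by (rule sum_distrib_right)
  also have "\<dots> = (\<Sum>b\<in>NN p. EE p a * (EE p b * Ue p u b) + ((if b = a then 2 *\<^sub>R Ue p u a else 0) + 2 *\<^sub>R (q u b a *\<^sub>R EE p b)))"
    by (intro sum.cong refl) (simp only: 1)
  also have "\<dots> = EE p a * om p u + (2 *\<^sub>R Ue p u a + 2 *\<^sub>R (\<Sum>b\<in>NN p. q u b a *\<^sub>R EE p b))"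
    using a unfolding om_def sum.distrib scaleR_sum_right sum_distrib_left by simp
  also have "\<dots> = EE p a * om p u + 4 *\<^sub>R Ue p u a"
    unfolding Ue_sum[OF a, symmetric] by (simp flip: scaleR_add_left)
  finally show ?thesis .
qed

lemma om_Ue:
  assumes a: "a \<in> NN p" and u: "u \<in> {1,2,3}" and v: "v < 4"
  shows "om p u * Ue p v a = Ue p v a * om p u + (4 * qs u v) *\<^sub>R Ue p (qx u v) a"
proof -
  have u4: "u < 4" and a1: "a \<ge> 1" using u a by auto
  have "om p u * Ue p v a = sg v a *\<^sub>R (om p u * EE p (pm v a))"
    by (simp add: Ue_def)
  also have "\<dots> = Ue p v a * om p u + (4 * (sg v a * sg u (pm v a))) *\<^sub>R EE p (pm u (pm v a))"
    unfolding om_E[OF pm_range[OF a] u] by (simp add: Ue_def scaleR_add_right mult.assoc mult.left_commute)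
  also have "\<dots> = Ue p v a * om p u + (4 * qs u v) *\<^sub>R Ue p (qx u v) a"
    unfolding pm_comp[OF a1 u4 v] by (simp add: Ue_def mult.assoc)
  finally show ?thesis .
qed

lemma om_om:
  assumes u: "u \<in> {1,2,3}" and v: "v \<in> {1,2,3}" and uv: "u \<noteq> v"
  shows "om p u * om p v = om p v * om p u + (8 * qs u v) *\<^sub>R om p (qx u v)"
proof -
  have u4: "u < 4" and v4: "v < 4" using u v by auto
  have t: "qs v u = - qs u v" "qx v u = qx u v" "qs u u = -1"
    using u v uv by (auto simp: qs_def qx_def)
  have "om p u * (EE p a * Ue p v a) = EE p a * Ue p v a * om p u + 4 *\<^sub>R (Ue p u a * Ue p v a) + (4 * qs u v) *\<^sub>R (EE p a * Ue p (qx u v) a)"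
    if a: "a \<in> NN p" for a
  proof -
    have "om p u * (EE p a * Ue p v a) = (om p u * EE p a) * Ue p v a" by (simp only: mult.assoc)
    also have "\<dots> = EE p a * (om p u * Ue p v a) + 4 *\<^sub>R (Ue p u a * Ue p v a)"
      unfolding om_E[OF a u] by (simp add: distrib_right mult.assoc)
    finally show ?thesis unfolding om_Ue[OF a u v4] by (simp add: distrib_left mult.assoc add.assoc add.commute add.left_commute)
  qed
  then have "om p u * om p v = om p v * om p u + 4 *\<^sub>R (\<Sum>a\<in>NN p. Ue p u a * Ue p v a) + (4 * qs u v) *\<^sub>R om p (qx u v)"
    unfolding om_def[of p v] om_def[of p "qx u v"]
    by (simp add: sum_distrib_left sum_distrib_right sum.distrib scaleR_sum_right)
  \<comment> \<open>Shifting the index along \<open>u\<close> removes \<open>u\<close> from the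
    first factor at the price of a sign, and composes it with \<open>v\<close> in the
    second.\<close>
  also have "(\<Sum>a\<in>NN p. Ue p u a * Ue p v a) = (\<Sum>a\<in>NN p. Ue p u (pm u a) * Ue p v (pm u a))"
    by (rule sum.reindex_bij_witness[of _ "pm u" "pm u"]) (use pm_range[of _ p u] pm_invol[OF _ u4] in simp_all)
  also have "\<dots> = (\<Sum>a\<in>NN p. qs u v *\<^sub>R (EE p a * Ue p (qx u v) a))"
  proof (intro sum.cong refl)
    fix a assume a: "a \<in> NN p"
    then have a1: "a \<ge> 1" by simp
    have s: "sg u (pm u a) = - sg u a"
    proof -
      have "sg u (pm u a) = (sg u a * sg u a) * sg u (pm u a)" by simp
      also have "\<dots> = sg u a * (sg u a * sg u (pm u a))" by (rule mult.assoc)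
      finally show ?thesis unfolding sg_invol[OF a1 u4] t by simp
    qed
    have "Ue p u (pm u a) * Ue p v (pm u a) = (- (sg u a * sg v (pm u a))) *\<^sub>R (EE p a * EE p (pm v (pm u a)))"
      unfolding Ue_def pm_invol[OF a1 u4] s by simp
    also have "\<dots> = qs u v *\<^sub>R (EE p a * Ue p (qx u v) a)"
      unfolding pm_comp[OF a1 v4 u4] t Ue_def by simp
    finally show "Ue p u (pm u a) * Ue p v (pm u a) = qs u v *\<^sub>R (EE p a * Ue p (qx u v) a)" .
  qed
  also have "\<dots> = qs u v *\<^sub>R om p (qx u v)"
    unfolding om_def by (simp add: scaleR_sum_right)
  finally show ?thesis by (simp add: add.assoc flip: scaleR_add_left)
qed

text \<open>The correction for \<open>c = d\<close> compensates the four squares -1, in agreement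
  with \<open>Ag p c c\<close> being zero.\<close>

lemma spo_Ag:
  assumes "c \<in> NN p" "d \<in> NN p"
  shows "spo p (Ag p c d) = (- 1/8) *\<^sub>R ((\<Sum>u<4. Ue p u c * Ue p u d) + (if c = d then 4 else 0))"
proof -
  have *: "(\<Sum>a\<in>NN p. \<Sum>b\<in>NN p. (q u a x * q u b y) *\<^sub>R (EE p a * EE p b)) = Ue p u x * Ue p u y"
    if "x \<in> NN p" "y \<in> NN p" for u x y
    unfolding Ue_sum[OF that(1)] Ue_sum[OF that(2)] by (simp add: sum_product mult.commute)
  have "(\<Sum>a\<in>NN p. \<Sum>b\<in>NN p. Ag p c d a b *\<^sub>R (EE p a * EE p b))
    = (\<Sum>a\<in>NN p. \<Sum>b\<in>NN p. \<Sum>u<4. (1/4) *\<^sub>R ((q u a c * q u b d) *\<^sub>R (EE p a * EE p b) - (q u a d * q u b c) *\<^sub>R (EE p a * EE p b)))"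
    by (intro sum.cong refl)
      (simp add: Ag_eq scaleR_sum_left sum_divide_distrib scaleR_diff_left scaleR_diff_right diff_divide_distrib)
  also have "\<dots> = (\<Sum>u<4. \<Sum>a\<in>NN p. \<Sum>b\<in>NN p. (1/4) *\<^sub>R ((q u a c * q u b d) *\<^sub>R (EE p a * EE p b) - (q u a d * q u b c) *\<^sub>R (EE p a * EE p b)))"
    by (simp only: sum.swap[of _ "NN p" "{..<4}"])
  also have "\<dots> = (\<Sum>u<4. (1/4) *\<^sub>R (Ue p u c * Ue p u d - Ue p u d * Ue p u c))"
    by (simp only: scaleR_sum_right[symmetric] sum_subtractf * assms)
  also have "\<dots> = (\<Sum>u<4. (1/2) *\<^sub>R (Ue p u c * Ue p u d) + (if c = d then (1/2) *\<^sub>R 1 else 0))"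
  proof (intro sum.cong refl)
    fix u :: nat assume "u \<in> {..<4}"
    then have t: "Ue p u d * Ue p u c = (if c = d then - 2 else 0) - Ue p u c * Ue p u d"
      using Ue_clifford[OF assms, of u] by (simp add: algebra_simps)
    show "(1/4) *\<^sub>R (Ue p u c * Ue p u d - Ue p u d * Ue p u c) = (1/2) *\<^sub>R (Ue p u c * Ue p u d) + (if c = d then (1/2) *\<^sub>R 1 else 0)"
      unfolding t by (rule op_ext) (simp add: op_pointwise algebra_simps)
  qed
  finally have **: "(\<Sum>a\<in>NN p. \<Sum>b\<in>NN p. Ag p c d a b *\<^sub>R (EE p a * EE p b))
    = (\<Sum>u<4. (1/2) *\<^sub>R (Ue p u c * Ue p u d) + (if c = d then (1/2) *\<^sub>R 1 else 0))" .
  show ?thesis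
    unfolding spo_def ** sum4 by (rule op_ext) (simp add: op_pointwise algebra_simps)
qed

section \<open>The Casimir operator\<close>

lemma sum_pairs: "(\<Sum>a\<in>A. \<Sum>b\<in>B. F a b) = (\<Sum>x\<in>A \<times> B. F (fst x) (snd x))"
  by (simp add: sum.cartesian_product case_prod_beta)

lemma spo_Ag_reproducing:
  assumes "c \<in> NN p" "d \<in> NN p"
  shows "(\<Sum>a\<in>NN p. \<Sum>b\<in>NN p. Ag p a b c d *\<^sub>R spo p (Ag p a b)) = 2 *\<^sub>R spo p (Ag p c d)"
proof -
  let ?P = "NN p \<times> NN p"
  define X where "X y = (- 1/4) *\<^sub>R (EE p (fst y) * EE p (snd y))" for y
  have spo: "spo p M = (\<Sum>y\<in>?P. M (fst y) (snd y) *\<^sub>R X y)" for M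
    unfolding spo_def X_def by (simp add: sum.cartesian_product scaleR_sum_right case_prod_beta)
  have "(\<Sum>a\<in>NN p. \<Sum>b\<in>NN p. Ag p a b c d *\<^sub>R spo p (Ag p a b))
    = (\<Sum>x\<in>?P. \<Sum>y\<in>?P. (Ag p (fst x) (snd x) c d * Ag p (fst x) (snd x) (fst y) (snd y)) *\<^sub>R X y)"
    unfolding sum_pairs[where A = "NN p" and B = "NN p"] spo by (simp only: scaleR_sum_right scaleR_scaleR)
  also have "\<dots> = (\<Sum>y\<in>?P. \<Sum>x\<in>?P. (Ag p (fst x) (snd x) c d * Ag p (fst x) (snd x) (fst y) (snd y)) *\<^sub>R X y)"
    by (rule sum.swap)
  also have "\<dots> = (\<Sum>y\<in>?P. (2 * Ag p c d (fst y) (snd y)) *\<^sub>R X y)"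
  proof (rule sum.cong[OF refl])
    fix y assume "y \<in> ?P"
    then have y: "fst y \<in> NN p" "snd y \<in> NN p" by (auto simp: mem_Times_iff)
    have "(\<Sum>x\<in>?P. Ag p (fst x) (snd x) c d * Ag p (fst x) (snd x) (fst y) (snd y)) = 2 * Ag p c d (fst y) (snd y)"
      using Ag_reproducing[OF assms y] unfolding sum_pairs .
    then show "(\<Sum>x\<in>?P. (Ag p (fst x) (snd x) c d * Ag p (fst x) (snd x) (fst y) (snd y)) *\<^sub>R X y) = (2 * Ag p c d (fst y) (snd y)) *\<^sub>R X y"
      by (simp only: scaleR_sum_left[symmetric])
  qed
  also have "\<dots> = 2 *\<^sub>R spo p (Ag p c d)"
    unfolding spo by (simp add: scaleR_sum_right)
  finally show ?thesis .
qed

text \<open>The Casimir element of the spin module, summed over the frame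
  \<open>Ag p a b\<close>.\<close>

definition cas :: "nat \<Rightarrow> op" where
  "cas p = (\<Sum>a\<in>NN p. \<Sum>b\<in>NN p. spo p (Ag p a b) * spo p (Ag p a b))"

definition om2 :: "nat \<Rightarrow> op" where
  "om2 p = om p 1 * om p 1 + om p 2 * om p 2 + om p 3 * om p 3"

lemma E_square:
  assumes "c \<in> NN p"
  shows "EE p c * EE p c = - 1"
proof -
  have "EE p c * EE p c = (1/2) *\<^sub>R (EE p c * EE p c + EE p c * EE p c)"
    by (rule op_ext) (simp add: op_pointwise)
  also have "\<dots> = - 1"
    unfolding clifford[OF assms assms] by (rule op_ext) (simp add: op_pointwise)
  finally show ?thesis .
qed

lemma sum_E_square: "(\<Sum>c\<in>NN p. EE p c * EE p c) = (- 4 * real p) *\<^sub>R 1"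
proof -
  have "(\<Sum>c\<in>NN p. EE p c * EE p c) = (\<Sum>c\<in>NN p. (-1) *\<^sub>R 1)"
    by (intro sum.cong refl) (simp add: E_square)
  also have "\<dots> = (\<Sum>c\<in>NN p. -1) *\<^sub>R 1" by (simp only: scaleR_sum_left)
  finally show ?thesis by simp
qed

lemma om_0: "om p 0 = (- 4 * real p) *\<^sub>R 1"
  unfolding om_def Ue_0 by (rule sum_E_square)

text \<open>Moving the second vector past the third pairs each vector with its own rotation, which
  yields \<open>om p u\<close> twice; the anticommutators leave a constant.\<close>

lemma sum_EEUU:
  assumes u: "u < 4"
  shows "(\<Sum>c\<in>NN p. \<Sum>d\<in>NN p. EE p c * EE p d * (Ue p u c * Ue p u d))
     = - (om p u * om p u) + (8 * real p * qs u u) *\<^sub>R 1"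
proof -
  have 1: "EE p c * EE p d * (Ue p u c * Ue p u d)
      = - ((EE p c * Ue p u c) * (EE p d * Ue p u d)) + (-2) *\<^sub>R (EE p c * (q u d c *\<^sub>R Ue p u d))"
    if "c \<in> NN p" "d \<in> NN p" for c d
  proof -
    have "EE p c * EE p d * (Ue p u c * Ue p u d)
      = EE p c * (EE p d * Ue p u c + Ue p u c * EE p d) * Ue p u d - (EE p c * Ue p u c) * (EE p d * Ue p u d)"
      by (simp add: algebra_simps)
    then show ?thesis unfolding E_Ue[OF that(2,1)] by simp
  qed
  have 2: "(\<Sum>d\<in>NN p. q u d c *\<^sub>R Ue p u d) = qs u u *\<^sub>R EE p c" if c: "c \<in> NN p" for c
  proof -
    have c1: "c \<ge> 1" using c by simp
    have "(\<Sum>d\<in>NN p. q u d c *\<^sub>R Ue p u d) = (\<Sum>d\<in>NN p. if d = pm u c then sg u c *\<^sub>R Ue p u (pm u c) else 0)"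
      by (intro sum.cong refl) (simp add: q_def)
    also have "\<dots> = sg u c *\<^sub>R Ue p u (pm u c)"
      using pm_range[OF c, of u] by (simp only: sum.delta' sum.delta finite_atLeastAtMost if_True)
    also have "\<dots> = (sg u c * sg u (pm u c)) *\<^sub>R EE p (pm u (pm u c))"
      unfolding Ue_def by simp
    finally show ?thesis unfolding sg_invol[OF c1 u] pm_invol[OF c1 u] .
  qed
  have "(\<Sum>c\<in>NN p. \<Sum>d\<in>NN p. EE p c * EE p d * (Ue p u c * Ue p u d))
    = (\<Sum>c\<in>NN p. \<Sum>d\<in>NN p. - ((EE p c * Ue p u c) * (EE p d * Ue p u d)) + (-2) *\<^sub>R (EE p c * (q u d c *\<^sub>R Ue p u d)))"
    by (intro sum.cong refl) (simp only: 1)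
  also have "\<dots> = - (om p u * om p u) + (-2) *\<^sub>R (\<Sum>c\<in>NN p. EE p c * (\<Sum>d\<in>NN p. q u d c *\<^sub>R Ue p u d))"
  proof -
    have "om p u * om p u = (\<Sum>c\<in>NN p. \<Sum>d\<in>NN p. (EE p c * Ue p u c) * (EE p d * Ue p u d))"
      unfolding om_def by (rule sum_product)
    then show ?thesis
      by (simp only: sum_distrib_left scaleR_sum_right sum.distrib sum_negf)
  qed
  also have "(\<Sum>c\<in>NN p. EE p c * (\<Sum>d\<in>NN p. q u d c *\<^sub>R Ue p u d)) = qs u u *\<^sub>R (\<Sum>c\<in>NN p. EE p c * EE p c)"
    unfolding scaleR_sum_right by (intro sum.cong refl) (simp add: 2)
  finally show ?thesis unfolding sum_E_square by simp
qed

text \<open>The quantitative form of the duality between sp(p) and su(2). The frame property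
  collapses the Casimir sum to the sums of \<open>sum_EEUU\<close>, and the unit 1 contributes only
  to the constant because \<open>om p 0\<close> is scalar.\<close>

lemma cas_om2: "cas p = (- 1/16) *\<^sub>R om2 p - (real p * real p + 2 * real p) *\<^sub>R 1"
proof -
  have "spo p (Ag p a b) * spo p (Ag p a b)
    = (\<Sum>y\<in>NN p \<times> NN p. (-1/4) *\<^sub>R (EE p (fst y) * EE p (snd y) * (Ag p a b (fst y) (snd y) *\<^sub>R spo p (Ag p a b))))" for a b
    by (subst spo_def) (simp add: sum.cartesian_product scaleR_sum_right sum_distrib_right case_prod_beta)
  note sq = this
  have "cas p = (\<Sum>x\<in>NN p \<times> NN p. \<Sum>y\<in>NN p \<times> NN p. (-1/4) *\<^sub>R (EE p (fst y) * EE p (snd y) * (Ag p (fst x) (snd x) (fst y) (snd y) *\<^sub>R spo p (Ag p (fst x) (snd x)))))"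
    unfolding cas_def sum_pairs[where A = "NN p" and B = "NN p"] sq ..
  also have "\<dots> = (\<Sum>y\<in>NN p \<times> NN p. \<Sum>x\<in>NN p \<times> NN p. (-1/4) *\<^sub>R (EE p (fst y) * EE p (snd y) * (Ag p (fst x) (snd x) (fst y) (snd y) *\<^sub>R spo p (Ag p (fst x) (snd x)))))"
    by (rule sum.swap)
  also have "\<dots> = (\<Sum>y\<in>NN p \<times> NN p. (-1/4) *\<^sub>R (EE p (fst y) * EE p (snd y) * (2 *\<^sub>R spo p (Ag p (fst y) (snd y)))))"
  proof (rule sum.cong[OF refl])
    fix y assume "y \<in> NN p \<times> NN p"
    then have y: "fst y \<in> NN p" "snd y \<in> NN p" by (auto simp: mem_Times_iff)
    have "(\<Sum>x\<in>NN p \<times> NN p. Ag p (fst x) (snd x) (fst y) (snd y) *\<^sub>R spo p (Ag p (fst x) (snd x))) = 2 *\<^sub>R spo p (Ag p (fst y) (snd y))"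
      using spo_Ag_reproducing[OF y] unfolding sum_pairs .
    then show "(\<Sum>x\<in>NN p \<times> NN p. (-1/4) *\<^sub>R (EE p (fst y) * EE p (snd y) * (Ag p (fst x) (snd x) (fst y) (snd y) *\<^sub>R spo p (Ag p (fst x) (snd x)))))
      = (-1/4) *\<^sub>R (EE p (fst y) * EE p (snd y) * (2 *\<^sub>R spo p (Ag p (fst y) (snd y))))"
      by (simp only: scaleR_sum_right[symmetric] sum_distrib_left[symmetric])
  qed
  also have "\<dots> = (\<Sum>c\<in>NN p. \<Sum>d\<in>NN p. (-1/4) *\<^sub>R (EE p c * EE p d * (2 *\<^sub>R spo p (Ag p c d))))"
    unfolding sum_pairs ..
  also have "\<dots> = (\<Sum>c\<in>NN p. \<Sum>d\<in>NN p. (\<Sum>u<4. (1/16) *\<^sub>R (EE p c * EE p d * (Ue p u c * Ue p u d))) + (if d = c then (1/4) *\<^sub>R (EE p c * EE p c) else 0))"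
    by (intro sum.cong refl) (auto intro!: op_ext simp: spo_Ag sum4 op_pointwise algebra_simps)
  also have "\<dots> = (\<Sum>c\<in>NN p. \<Sum>d\<in>NN p. \<Sum>u<4. (1/16) *\<^sub>R (EE p c * EE p d * (Ue p u c * Ue p u d))) + (\<Sum>c\<in>NN p. (1/4) *\<^sub>R (EE p c * EE p c))"
    by (simp add: sum.distrib)
  also have "(\<Sum>c\<in>NN p. \<Sum>d\<in>NN p. \<Sum>u<4. (1/16) *\<^sub>R (EE p c * EE p d * (Ue p u c * Ue p u d)))
    = (\<Sum>u<4. \<Sum>c\<in>NN p. \<Sum>d\<in>NN p. (1/16) *\<^sub>R (EE p c * EE p d * (Ue p u c * Ue p u d)))"
    by (simp only: sum.swap[of _ "NN p" "{..<4}"])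
  also have "\<dots> = (\<Sum>u<4. (1/16) *\<^sub>R (- (om p u * om p u) + (8 * real p * qs u u) *\<^sub>R 1))"
    by (intro sum.cong refl) (simp only: scaleR_sum_right[symmetric] sum_EEUU lessThan_iff)
  also have "(\<Sum>c\<in>NN p. (1/4) *\<^sub>R (EE p c * EE p c)) = (- real p) *\<^sub>R 1"
    unfolding scaleR_sum_right[symmetric] sum_E_square by simp
  also have "(\<Sum>u<4. (1/16) *\<^sub>R (- (om p u * om p u) + (8 * real p * qs u u) *\<^sub>R 1)) + (- real p) *\<^sub>R 1
    = (- 1/16) *\<^sub>R om2 p - (real p * real p + 2 * real p) *\<^sub>R 1"
    unfolding sum4 om_0 om2_def by (rule op_ext) (simp add: op_pointwise qs_def field_simps)
  finally show ?thesis .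
qed

text \<open>The spinors transform under the commuting su(2) spanned by the three elements om, and
  a vector is a doublet for it. The relation below bounds the Casimir eigenvalues occurring in
  (doublet) tensor (spin j) to those of spin j + 1/2 and j - 1/2.\<close>

lemma om2_double_commutator:
  assumes a: "a \<in> NN p"
  shows "om2 p * om2 p * EE p a + (-2) *\<^sub>R (om2 p * EE p a * om2 p) + EE p a * om2 p * om2 p
    = (-32) *\<^sub>R (om2 p * EE p a + EE p a * om2 p) + 768 *\<^sub>R EE p a"
proof -
  define e where "e v = Ue p v a" for v
  define w where "w u = om p u" for u
  have we: "w u * e v = e v * w u + (4 * qs u v) *\<^sub>R e (qx u v)" if "u \<in> {1,2,3}" "v < 4" for u v
    unfolding w_def e_def by (rule om_Ue[OF a that])
  have ww: "w u * w v = w v * w u + (8 * qs u v) *\<^sub>R w (qx u v)" if "u \<in> {1,2,3}" "v \<in> {1,2,3}" "u \<noteq> v" for u v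
    unfolding w_def by (rule om_om[OF that])
  have tab: "w 1 * e 0 = e 0 * w 1 + 4 *\<^sub>R e 1" "w 1 * e 1 = e 1 * w 1 - 4 *\<^sub>R e 0"
    "w 1 * e 2 = e 2 * w 1 + 4 *\<^sub>R e 3" "w 1 * e 3 = e 3 * w 1 - 4 *\<^sub>R e 2"
    "w 2 * e 0 = e 0 * w 2 + 4 *\<^sub>R e 2" "w 2 * e 1 = e 1 * w 2 - 4 *\<^sub>R e 3"
    "w 2 * e 2 = e 2 * w 2 - 4 *\<^sub>R e 0" "w 2 * e 3 = e 3 * w 2 + 4 *\<^sub>R e 1"
    "w 3 * e 0 = e 0 * w 3 + 4 *\<^sub>R e 3" "w 3 * e 1 = e 1 * w 3 + 4 *\<^sub>R e 2"
    "w 3 * e 2 = e 2 * w 3 - 4 *\<^sub>R e 1" "w 3 * e 3 = e 3 * w 3 - 4 *\<^sub>R e 0"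
    using we[of 1 0] we[of 1 1] we[of 1 2] we[of 1 3] we[of 2 0] we[of 2 1] we[of 2 2] we[of 2 3]
      we[of 3 0] we[of 3 1] we[of 3 2] we[of 3 3] by (simp_all add: qs_def qx_def One_nat_def)
  have wtab: "w 2 * w 1 = w 1 * w 2 - 8 *\<^sub>R w 3" "w 3 * w 1 = w 1 * w 3 + 8 *\<^sub>R w 2" "w 3 * w 2 = w 2 * w 3 - 8 *\<^sub>R w 1"
    using ww[of 2 1] ww[of 3 1] ww[of 3 2] by (simp_all add: qs_def qx_def One_nat_def)
  have assoc: "X * (Y * T) = Z * T" if "X * Y = Z" for X Y Z T :: op
    using that by (simp flip: mult.assoc)
  note tab' = tab[THEN assoc] and wtab' = wtab[THEN assoc]
  define Y where "Y = w 1 * w 1 + w 2 * w 2 + w 3 * w 3"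
  \<comment> \<open>Commuting \<open>Y\<close> with \<open>e 0\<close> produces \<open>Z\<close>,
    and commuting it with \<open>Z\<close> leads back to \<open>e 0\<close> and \<open>Z\<close>,
    with coefficients in \<open>Y\<close> on the right. The claim eliminates \<open>Z\<close> from
    this 2 by 2 system.\<close>
  define Z where "Z = e 1 * w 1 + e 2 * w 2 + e 3 * w 3"
  have Ye: "Y * e 0 = e 0 * Y + 8 *\<^sub>R Z + (-48) *\<^sub>R e 0"
    unfolding Y_def Z_def
    by (rule op_ext) (simp add: tab tab' algebra_simps, simp add: op_pointwise algebra_simps)
  have YZ: "Y * Z = Z * Y + (-8) *\<^sub>R (e 0 * Y) + 16 *\<^sub>R Z"
    unfolding Y_def Z_def
    by (rule op_ext) (simp add: tab tab' wtab wtab' algebra_simps, simp add: op_pointwise algebra_simps)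
  have Ye': "ap Y (ap (e 0) x) = ap (e 0) (ap Y x) + cscale 8 (ap Z x) - cscale 48 (ap (e 0) x)" for x
    using arg_cong[OF Ye, of "\<lambda>T. ap T x"] by simp
  have YZ': "ap Y (ap Z x) = ap Z (ap Y x) - cscale 8 (ap (e 0) (ap Y x)) + cscale 16 (ap Z x)" for x
    using arg_cong[OF YZ, of "\<lambda>T. ap T x"] by simp
  have "Y * Y * e 0 + (-2) *\<^sub>R (Y * e 0 * Y) + e 0 * Y * Y = (-32) *\<^sub>R (Y * e 0 + e 0 * Y) + 768 *\<^sub>R e 0"
    by (rule op_ext) (simp add: Ye' YZ', simp add: op_pointwise algebra_simps)
  then show ?thesis
    unfolding Y_def w_def e_def Ue_0 om2_def .
qed

section \<open>The Witt basis\<close>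

definition F :: "nat \<Rightarrow> nat \<Rightarrow> op" where "F p k = lm (4*p) (fw k)"
definition G :: "nat \<Rightarrow> nat \<Rightarrow> op" where "G p k = lm (4*p) (fwd k)"

lemma F_eq: "F p k = sc (1/2) * (sc \<i> * EE p (2*k) - EE p (2*k-1))"
  unfolding F_def fw_def lm_simps E_def by (rule op_ext) (simp add: op_pointwise)

lemma G_eq: "G p k = sc (1/2) * (EE p (2*k-1) + sc \<i> * EE p (2*k))"
  unfolding G_def fwd_def lm_simps E_def by (rule op_ext) (simp add: op_pointwise)

lemma E_odd: "EE p (2*k-1) = G p k - F p k"
  unfolding F_eq G_eq by (rule op_ext) (simp add: op_pointwise algebra_simps)

lemma E_even: "EE p (2*k) = sc (-\<i>) * (F p k + G p k)"
  unfolding F_eq G_eq by (rule op_ext) (simp add: op_pointwise algebra_simps)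

lemma witt_anticomm:
  assumes "x * x' + x' * x = d" "y * y' + y' * y = d" "x * y' + y' * x = 0" "y * x' + x' * y = 0"
  shows "(sc (1/2) * (sc \<i> * y - x)) * (sc (1/2) * (sc \<i> * y' - x')) + (sc (1/2) * (sc \<i> * y' - x')) * (sc (1/2) * (sc \<i> * y - x)) = 0"
    and "(sc (1/2) * (x + sc \<i> * y)) * (sc (1/2) * (x' + sc \<i> * y')) + (sc (1/2) * (x' + sc \<i> * y')) * (sc (1/2) * (x + sc \<i> * y)) = 0"
    and "(sc (1/2) * (sc \<i> * y - x)) * (sc (1/2) * (x' + sc \<i> * y')) + (sc (1/2) * (x' + sc \<i> * y')) * (sc (1/2) * (sc \<i> * y - x)) = sc (-1/2) * d"
proof -
  have 1: "ap x' (ap x \<psi>) = ap d \<psi> - ap x (ap x' \<psi>)" for \<psi>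
    using arg_cong[OF assms(1), of "\<lambda>T. ap T \<psi>"] by (simp add: algebra_simps)
  have 2: "ap y' (ap y \<psi>) = ap d \<psi> - ap y (ap y' \<psi>)" for \<psi>
    using arg_cong[OF assms(2), of "\<lambda>T. ap T \<psi>"] by (simp add: algebra_simps)
  have 3: "ap y' (ap x \<psi>) = - ap x (ap y' \<psi>)" for \<psi>
    using arg_cong[OF assms(3), of "\<lambda>T. ap T \<psi>"] by (simp add: eq_neg_iff_add_eq_0 add.commute)
  have 4: "ap x' (ap y \<psi>) = - ap y (ap x' \<psi>)" for \<psi>
    using arg_cong[OF assms(4), of "\<lambda>T. ap T \<psi>"] by (simp add: eq_neg_iff_add_eq_0 add.commute)
  show "(sc (1/2) * (sc \<i> * y - x)) * (sc (1/2) * (sc \<i> * y' - x')) + (sc (1/2) * (sc \<i> * y' - x')) * (sc (1/2) * (sc \<i> * y - x)) = 0"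
    and "(sc (1/2) * (x + sc \<i> * y)) * (sc (1/2) * (x' + sc \<i> * y')) + (sc (1/2) * (x' + sc \<i> * y')) * (sc (1/2) * (x + sc \<i> * y)) = 0"
    and "(sc (1/2) * (sc \<i> * y - x)) * (sc (1/2) * (x' + sc \<i> * y')) + (sc (1/2) * (x' + sc \<i> * y')) * (sc (1/2) * (sc \<i> * y - x)) = sc (-1/2) * d"
    by (rule op_ext, simp add: 1 2 3 4, simp add: op_pointwise algebra_simps)+
qed

abbreviation MM :: "nat \<Rightarrow> nat set" where "MM p \<equiv> {1..2*p}"

lemma mode_range: "k \<in> MM p \<Longrightarrow> 2*k-1 \<in> NN p" "k \<in> MM p \<Longrightarrow> 2*k \<in> NN p"
  by auto

text \<open>The canonical anticommutation relations: \<open>F\<close> and \<open>G\<close> are the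
  annihilation and creation operators of \<open>2*p\<close> fermionic modes.\<close>

lemma CAR:
  assumes k: "k \<in> MM p" and l: "l \<in> MM p"
  shows "F p k * F p l + F p l * F p k = 0" "G p k * G p l + G p l * G p k = 0"
    "F p k * G p l + G p l * F p k = (if k = l then 1 else 0)"
proof -
  have eq: "(2*k-1 = 2*l-1) = (k = l)" "(2*k = 2*l) = (k = l)" "2*k-1 \<noteq> 2*l" "2*k \<noteq> 2*l-1"
    using k l by auto presburger+
  note c = clifford[OF mode_range(1)[OF k] mode_range(1)[OF l]] clifford[OF mode_range(2)[OF k] mode_range(2)[OF l]]
    clifford[OF mode_range(1)[OF k] mode_range(2)[OF l]] clifford[OF mode_range(2)[OF k] mode_range(1)[OF l]]
  note w = witt_anticomm[OF c(1)[unfolded eq] c(2)[unfolded eq]]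
  have c34: "EE p (2*k-1) * EE p (2*l) + EE p (2*l) * EE p (2*k-1) = 0"
    "EE p (2*k) * EE p (2*l-1) + EE p (2*l-1) * EE p (2*k) = 0"
    using c(3,4) eq(3,4) by simp_all
  show "F p k * F p l + F p l * F p k = 0" "G p k * G p l + G p l * G p k = 0"
    unfolding F_eq G_eq by (rule w(1)[OF c34] w(2)[OF c34])+
  have "F p k * G p l + G p l * F p k = sc (-1/2) * (if k = l then - 2 else 0)"
    unfolding F_eq G_eq by (rule w(3)[OF c34])
  then show "F p k * G p l + G p l * F p k = (if k = l then 1 else 0)"
    by (auto intro!: op_ext simp: op_pointwise)
qed

lemma CAR_ap:
  assumes k: "k \<in> MM p" and l: "l \<in> MM p"
  shows "ap (F p k) (ap (F p l) x) = - ap (F p l) (ap (F p k) x)"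
    "ap (G p k) (ap (G p l) x) = - ap (G p l) (ap (G p k) x)"
    "ap (F p k) (ap (G p l) x) = (if k = l then x else 0) - ap (G p l) (ap (F p k) x)"
  using CAR[OF k l, THEN arg_cong[where f = "\<lambda>T. ap T x"]]
  by (simp_all add: eq_neg_iff_add_eq_0 eq_diff_eq split: if_splits)

lemma op_self_neg: "(x :: cl) = - x \<Longrightarrow> x = 0"
  by (simp add: fun_eq_iff pointwise eq_neg_iff_add_eq_0)

lemma FF_zero: "k \<in> MM p \<Longrightarrow> ap (F p k) (ap (F p k) x) = 0"
  by (rule op_self_neg[OF CAR_ap(1)])

lemma GG_zero: "k \<in> MM p \<Longrightarrow> ap (G p k) (ap (G p k) x) = 0"
  by (rule op_self_neg[OF CAR_ap(2)])

text \<open>Both generators of a mode are skew, but the factor \<open>\<i>\<close> makes the second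
  term self-adjoint, so only the first changes sign.\<close>

lemma F_adjoint:
  assumes k: "k \<in> MM p"
  shows "ip (Zc (4*p)) (ap (F p k) x) y = ip (Zc (4*p)) x (ap (G p k) y)"
  unfolding F_eq G_eq
  by (simp add: E_skew[OF mode_range(1)[OF k]] E_skew[OF mode_range(2)[OF k]])

lemma G_adjoint:
  assumes k: "k \<in> MM p"
  shows "ip (Zc (4*p)) (ap (G p k) x) y = ip (Zc (4*p)) x (ap (F p k) y)"
  using F_adjoint[OF k, of y x] by (metis ip_commute)

section \<open>The Fock basis of the spinor space\<close>

text \<open>Creation operators along an arbitrary list, applied to the vacuum
  \<open>Iprim p\<close>; lists permit the inductions that move an operator to its place.\<close>

definition gl :: "nat \<Rightarrow> nat list \<Rightarrow> cl" where
  "gl p xs = foldr (\<lambda>k v. ap (G p k) v) xs (Iprim p)"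

lemma gl_simps: "gl p [] = Iprim p" "gl p (k # xs) = ap (G p k) (gl p xs)"
  by (simp_all add: gl_def)

definition bv :: "nat \<Rightarrow> nat set \<Rightarrow> cl" where
  "bv p J = gl p (sorted_list_of_set J)"

lemma bv_eq: "clmul (4*p) (clprod (4*p) (map fwd (sorted_list_of_set J))) (Iprim p) = bv p J"
proof -
  have "clmul (4*p) (clprod (4*p) (map fwd xs)) (Iprim p) = gl p xs" for xs
    by (induction xs) (simp_all add: gl_simps clprod_def clmul_assoc G_def ap_lm, simp add: lm_clone flip: ap_lm)
  then show ?thesis by (simp add: bv_def)
qed

lemma Sdeg_eq: "Sdeg p r = cv.span (bv p ` {J. J \<subseteq> MM p \<and> card J = r})"
  unfolding Sdeg_def cspan_eq bv_eq by (rule arg_cong[where f = cv.span]) auto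

text \<open>\<open>Iprim\<close> is a product of pairs F_k G_k. An annihilation operator passes the
  pairs of other modes unchanged and meets its own, where its square vanishes.\<close>

lemma F_Iprim:
  assumes k: "k \<in> MM p"
  shows "ap (F p k) (Iprim p) = 0"
proof -
  let ?h = "\<lambda>k v. ap (F p k) (ap (G p k) v)"
  have 1: "Iprim p = foldr ?h [1..<2*p+1] clone"
  proof -
    have "clprod (4*p) (map (\<lambda>k. clmul (4*p) (fw k) (fwd k)) xs) = foldr ?h xs clone" for xs
      by (induction xs) (simp_all add: clprod_def clmul_assoc F_def G_def ap_lm)
    then show ?thesis unfolding Iprim_def .
  qed
  have 2: "ap (F p k) (foldr ?h xs v) = 0" if "k \<in> set xs" "set xs \<subseteq> MM p" for xs v
    using that
  proof (induction xs)
    case (Cons l xs)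
    have l: "l \<in> MM p" using Cons.prems by simp
    show ?case
    proof (cases "k = l")
      case True
      then show ?thesis using FF_zero[OF k] by simp
    next
      case False
      then have IH: "ap (F p k) (foldr ?h xs v) = 0" using Cons by auto
      have "ap (F p k) (ap (F p l) (ap (G p l) z)) = ap (F p l) (ap (G p l) (ap (F p k) z))" for z
        using CAR_ap(1)[OF k l, of "ap (G p l) z"] CAR_ap(3)[OF k l, of z] False by simp
      then show ?thesis using IH by simp
    qed
  qed simp
  show ?thesis unfolding 1 by (rule 2) (use k in auto)
qed

lemma G_gl_mem:
  assumes "k \<in> set xs" "set xs \<subseteq> MM p"
  shows "ap (G p k) (gl p xs) = 0"
  using assms
proof (induction xs)
  case (Cons l xs)
  have k: "k \<in> MM p" and l: "l \<in> MM p" using Cons.prems by auto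
  show ?case
  proof (cases "k = l")
    case True
    then show ?thesis using GG_zero[OF k] by (simp add: gl_simps)
  next
    case False
    then have "ap (G p k) (gl p xs) = 0" using Cons by auto
    then show ?thesis using CAR_ap(2)[OF k l, of "gl p xs"] by (simp add: gl_simps)
  qed
qed simp

text \<open>The scalar is a reordering sign; it stays unspecified because only spans of these
  vectors are studied.\<close>

lemma G_gl:
  assumes "k \<in> MM p" "set xs \<subseteq> MM p"
  shows "\<exists>c. ap (G p k) (gl p xs) = cscale c (gl p (insort k xs))"
  using assms(2)
proof (induction xs)
  case Nil
  show ?case by (rule exI[of _ 1]) (simp add: gl_simps)
next
  case (Cons l xs)
  have l: "l \<in> MM p" using Cons.prems by auto
  obtain c where c: "ap (G p k) (gl p xs) = cscale c (gl p (insort k xs))" using Cons by auto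
  show ?case
  proof (cases "k \<le> l")
    case True
    then show ?thesis by (intro exI[of _ 1]) (simp add: gl_simps)
  next
    case False
    then show ?thesis
      using CAR_ap(2)[OF assms(1) l, of "gl p xs"] c by (intro exI[of _ "- c"]) (simp add: gl_simps)
  qed
qed

lemma F_gl_nonmem:
  assumes "k \<in> MM p" "set xs \<subseteq> MM p" "k \<notin> set xs"
  shows "ap (F p k) (gl p xs) = 0"
  using assms(2,3)
proof (induction xs)
  case Nil
  show ?case using F_Iprim[OF assms(1)] by (simp add: gl_simps)
next
  case (Cons l xs)
  have l: "l \<in> MM p" using Cons.prems by auto
  have "ap (F p k) (gl p xs) = 0" using Cons by auto
  then show ?case using CAR_ap(3)[OF assms(1) l, of "gl p xs"] Cons.prems by (simp add: gl_simps)
qed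

lemma F_gl:
  assumes "k \<in> MM p" "set xs \<subseteq> MM p" "distinct xs"
  shows "\<exists>c. ap (F p k) (gl p xs) = cscale c (gl p (remove1 k xs))"
  using assms(2,3)
proof (induction xs)
  case Nil
  show ?case by (rule exI[of _ 0]) (use F_Iprim[OF assms(1)] in \<open>simp add: gl_simps\<close>)
next
  case (Cons l xs)
  have l: "l \<in> MM p" using Cons.prems by auto
  show ?case
  proof (cases "k = l")
    case True
    have "ap (F p k) (gl p xs) = 0" by (rule F_gl_nonmem) (use assms(1) Cons.prems True in auto)
    then show ?thesis
      using CAR_ap(3)[OF assms(1) l, of "gl p xs"] True by (intro exI[of _ 1]) (simp add: gl_simps)
  next
    case False
    obtain c where c: "ap (F p k) (gl p xs) = cscale c (gl p (remove1 k xs))" using Cons by auto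
    then show ?thesis
      using CAR_ap(3)[OF assms(1) l, of "gl p xs"] False by (intro exI[of _ "- c"]) (simp add: gl_simps)
  qed
qed

lemma n_gl:
  assumes "k \<in> MM p" "set xs \<subseteq> MM p" "distinct xs"
  shows "ap (G p k) (ap (F p k) (gl p xs)) = (if k \<in> set xs then gl p xs else 0)"
proof (cases "k \<in> set xs")
  case False
  then show ?thesis using F_gl_nonmem[OF assms(1,2)] by simp
next
  case True
  have "ap (F p k) (ap (G p k) (gl p xs)) = 0" using G_gl_mem[OF True assms(2)] by simp
  then show ?thesis using CAR_ap(3)[OF assms(1,1), of "gl p xs"] True by simp
qed

lemma finite_modes: "J \<subseteq> MM p \<Longrightarrow> finite J"
  by (rule finite_subset) auto

lemma G_bv:
  assumes "k \<in> MM p" "J \<subseteq> MM p"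
  shows "\<exists>c. ap (G p k) (bv p J) = cscale c (bv p (insert k J))" "k \<in> J \<Longrightarrow> ap (G p k) (bv p J) = 0"
proof -
  note fin = finite_modes[OF assms(2)]
  show 0: "k \<in> J \<Longrightarrow> ap (G p k) (bv p J) = 0"
    unfolding bv_def using G_gl_mem[of k "sorted_list_of_set J" p] fin assms by simp
  show "\<exists>c. ap (G p k) (bv p J) = cscale c (bv p (insert k J))"
  proof (cases "k \<in> J")
    case True
    then show ?thesis using 0 by (intro exI[of _ 0]) simp
  next
    case False
    then show ?thesis
      unfolding bv_def using G_gl[OF assms(1), of "sorted_list_of_set J"] fin assms(2) by simp
  qed
qed

lemma F_bv:
  assumes "k \<in> MM p" "J \<subseteq> MM p"
  shows "\<exists>c. ap (F p k) (bv p J) = cscale c (bv p (J - {k}))" "k \<notin> J \<Longrightarrow> ap (F p k) (bv p J) = 0"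
proof -
  note fin = finite_modes[OF assms(2)]
  show "\<exists>c. ap (F p k) (bv p J) = cscale c (bv p (J - {k}))"
    unfolding bv_def using F_gl[OF assms(1), of "sorted_list_of_set J"] fin assms(2)
    by (simp add: sorted_list_of_set_remove)
  show "k \<notin> J \<Longrightarrow> ap (F p k) (bv p J) = 0"
    unfolding bv_def using F_gl_nonmem[OF assms(1), of "sorted_list_of_set J"] fin assms by simp
qed

lemma n_bv:
  assumes "k \<in> MM p" "J \<subseteq> MM p"
  shows "ap (G p k) (ap (F p k) (bv p J)) = (if k \<in> J then bv p J else 0)"
  unfolding bv_def using n_gl[OF assms(1), of "sorted_list_of_set J"] finite_modes[OF assms(2)] assms(2) by simp

lemma span_op_image:
  assumes "x \<in> cv.span (f ` A)" "\<And>a. a \<in> A \<Longrightarrow> ap T (f a) \<in> S" "cv.subspace S"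
  shows "ap T x \<in> S"
proof -
  have "cv.subspace {x. ap T x \<in> S}"
    using assms(3) by (auto simp: cv.subspace_def)
  moreover have "f ` A \<subseteq> {x. ap T x \<in> S}" using assms(2) by auto
  ultimately show ?thesis using cv.span_minimal assms(1) by blast
qed

text \<open>The vectors of the bad eigenlines are removed one at a time by applying
  the operator T - l, which rescales x.\<close>

lemma eigen_filter:
  assumes "finite A" and x: "x \<in> cv.span (f ` A)" and T: "\<And>a. a \<in> A \<Longrightarrow> ap T (f a) = cscale (l a) (f a)"
    and Tx: "ap T x = cscale \<mu> x"
  shows "x \<in> cv.span (f ` {a\<in>A. l a = \<mu>})"
proof -
  have "x \<in> cv.span (f ` (A - B))" if "finite B" "B \<subseteq> {a\<in>A. l a \<noteq> \<mu>}" for B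
    using that
  proof (induction B rule: finite_induct)
    case empty
    then show ?case using x by simp
  next
    case (insert b B)
    have b: "l b \<noteq> \<mu>" using insert.prems by auto
    have "x \<in> cv.span (f ` (A - B))" using insert by auto
    then have "ap (T - sc (l b)) x \<in> cv.span (f ` (A - insert b B))"
    proof (rule span_op_image)
      fix a assume a: "a \<in> A - B"
      have eq: "ap (T - sc (l b)) (f a) = cscale (l a - l b) (f a)"
        using T[of a] a by (simp add: cv.scale_left_diff_distrib)
      show "ap (T - sc (l b)) (f a) \<in> cv.span (f ` (A - insert b B))"
      proof (cases "a = b")
        case True
        then show ?thesis unfolding eq by (simp add: cv.span_zero)
      next
        case False
        then show ?thesis unfolding eq using a by (intro cv.span_scale cv.span_base) auto
      qed
    qed auto
    then have "cscale (\<mu> - l b) x \<in> cv.span (f ` (A - insert b B))"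
      using Tx by (simp add: cv.scale_left_diff_distrib)
    then have "cscale (inverse (\<mu> - l b)) (cscale (\<mu> - l b) x) \<in> cv.span (f ` (A - insert b B))"
      by (rule cv.span_scale)
    then show ?case using b by simp
  qed
  from this[of "{a\<in>A. l a \<noteq> \<mu>}"] have "x \<in> cv.span (f ` (A - {a\<in>A. l a \<noteq> \<mu>}))"
    using assms(1) by simp
  moreover have "A - {a\<in>A. l a \<noteq> \<mu>} = {a\<in>A. l a = \<mu>}" by auto
  ultimately show ?thesis by simp
qed

section \<open>The dual sl(2)\<close>

declare add_2_eq_Suc [simp del] add_2_eq_Suc' [simp del]

text \<open>\<open>P\<close> and \<open>Q\<close> as operators, with blocks counted from 0. With the
  number operator \<open>NO\<close>, shifted by \<open>p\<close>, they span the complexification of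
  the su(2) of the \<open>om p u\<close>, see \<open>om_eq\<close>.\<close>

definition PO :: "nat \<Rightarrow> op" where "PO p = (\<Sum>i<p. F p (2*i+2) * F p (2*i+1))"
definition QO :: "nat \<Rightarrow> op" where "QO p = (\<Sum>i<p. G p (2*i+1) * G p (2*i+2))"
definition NO :: "nat \<Rightarrow> op" where "NO p = (\<Sum>k\<in>MM p. G p k * F p k)"

lemma lm_sum: "lm n (\<lambda>A. \<Sum>j\<in>S. x j A) = (\<Sum>j\<in>S. lm n (x j))"
proof (rule op_ext)
  fix y C
  have "clmul n (\<lambda>A. \<Sum>j\<in>S. x j A) y C = (\<Sum>j\<in>S. clmul n (x j) y C)"
    by (simp add: clmul_def sum_distrib_right) (rule sum.swap)
  then show "ap (lm n (\<lambda>A. \<Sum>j\<in>S. x j A)) y C = ap (\<Sum>j\<in>S. lm n (x j)) y C"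
    by (simp add: op_pointwise ap_lm)
qed

lemma sum_shift1: "(\<Sum>j\<in>{1..p}. f j) = (\<Sum>i<p. f (Suc i))"
  by (rule sum.reindex_bij_witness[of _ Suc "\<lambda>j. j - 1"]) auto

lemma lm_Pop: "clmul (4*p) (Pop p) = ap (PO p)"
  and lm_Qop: "clmul (4*p) (Qop p) = ap (QO p)"
proof -
  have eq: "2 * Suc i = 2*i+2" "2*i+2-1 = 2*i+1" for i by auto
  have P: "lm (4*p) (Pop p) = PO p"
    unfolding Pop_def lm_sum lm_simps PO_def F_def sum_shift1 eq ..
  have Q: "lm (4*p) (Qop p) = QO p"
    unfolding Qop_def lm_sum lm_simps QO_def G_def sum_shift1 eq ..
  show "clmul (4*p) (Pop p) = ap (PO p)" "clmul (4*p) (Qop p) = ap (QO p)"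
    by (rule ext; simp flip: P Q add: ap_lm)+
qed

lemma sum_MM: "(\<Sum>k\<in>MM p. f k) = (\<Sum>i<p. f (2*i+1) + f (2*i+2))" for f :: "nat \<Rightarrow> 'a::comm_monoid_add"
proof (induction p)
  case (Suc p)
  have "MM (Suc p) = insert (2*p+2) (insert (2*p+1) (MM p))" by auto
  then have "(\<Sum>k\<in>MM (Suc p). f k) = f (2*p+2) + (f (2*p+1) + (\<Sum>k\<in>MM p. f k))"
    by simp
  then show ?case using Suc by (simp add: ac_simps)
qed simp

lemma sum_NN: "(\<Sum>a\<in>NN p. f a) = (\<Sum>i<p. f (4*i+1) + f (4*i+2) + f (4*i+3) + f (4*i+4))" for f :: "nat \<Rightarrow> 'a::comm_monoid_add"
proof (induction p)
  case (Suc p)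
  have "NN (Suc p) = insert (4*p+4) (insert (4*p+3) (insert (4*p+2) (insert (4*p+1) (NN p))))" by auto
  then have "(\<Sum>k\<in>NN (Suc p). f k) = f (4*p+4) + (f (4*p+3) + (f (4*p+2) + (f (4*p+1) + (\<Sum>k\<in>NN p. f k))))"
    by simp
  then show ?case using Suc by (simp add: ac_simps)
qed simp

lemma E_block:
  "EE p (4*i+1) = G p (2*i+1) - F p (2*i+1)"
  "EE p (4*i+2) = sc (-\<i>) * (F p (2*i+1) + G p (2*i+1))"
  "EE p (4*i+3) = G p (2*i+2) - F p (2*i+2)"
  "EE p (4*i+4) = sc (-\<i>) * (F p (2*i+2) + G p (2*i+2))"
proof -
  have "4*i+1 = 2*(2*i+1)-1" "4*i+2 = 2*(2*i+1)" "4*i+3 = 2*(2*i+2)-1" "4*i+4 = 2*(2*i+2)" by auto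
  then show "EE p (4*i+1) = G p (2*i+1) - F p (2*i+1)"
    "EE p (4*i+2) = sc (-\<i>) * (F p (2*i+1) + G p (2*i+1))"
    "EE p (4*i+3) = G p (2*i+2) - F p (2*i+2)"
    "EE p (4*i+4) = sc (-\<i>) * (F p (2*i+2) + G p (2*i+2))"
    by (simp_all only: E_odd E_even)
qed

lemma U_block:
  "Ue p u (4*i+1) = sg u 1 *\<^sub>R EE p (4*i + pm u 1)"
  "Ue p u (4*i+2) = sg u 2 *\<^sub>R EE p (4*i + pm u 2)"
  "Ue p u (4*i+3) = sg u 3 *\<^sub>R EE p (4*i + pm u 3)"
  "Ue p u (4*i+4) = sg u 4 *\<^sub>R EE p (4*i + pm u 4)"
  unfolding Ue_def by (simp_all only: pm_sg_shift insert_iff simp_thms)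

lemma pm_sg_values:
  "pm 0 n = n" "sg 0 n = 1"
  "pm 1 1 = 2" "pm 1 2 = 1" "pm 1 3 = 4" "pm 1 4 = 3"
  "pm 2 1 = 3" "pm 2 2 = 4" "pm 2 3 = 1" "pm 2 4 = 2"
  "pm 3 1 = 4" "pm 3 2 = 3" "pm 3 3 = 2" "pm 3 4 = 1"
  "sg 1 1 = 1" "sg 1 2 = -1" "sg 1 3 = 1" "sg 1 4 = -1"
  "sg 2 1 = 1" "sg 2 2 = -1" "sg 2 3 = -1" "sg 2 4 = 1"
  "sg 3 1 = 1" "sg 3 2 = 1" "sg 3 3 = -1" "sg 3 4 = -1"
  by (simp_all add: pm_def sg_def)

lemma modes: "i < p \<Longrightarrow> 2*i+1 \<in> MM p" "i < p \<Longrightarrow> 2*i+2 \<in> MM p"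
  by auto

lemma normal_order:
  assumes i: "i < p"
  shows "ap (F p (2*i+1)) (ap (G p (2*i+1)) x) = x - ap (G p (2*i+1)) (ap (F p (2*i+1)) x)"
    "ap (F p (2*i+2)) (ap (G p (2*i+2)) x) = x - ap (G p (2*i+2)) (ap (F p (2*i+2)) x)"
    "ap (F p (2*i+1)) (ap (G p (2*i+2)) x) = - ap (G p (2*i+2)) (ap (F p (2*i+1)) x)"
    "ap (F p (2*i+2)) (ap (G p (2*i+1)) x) = - ap (G p (2*i+1)) (ap (F p (2*i+2)) x)"
    "ap (F p (2*i+2)) (ap (F p (2*i+1)) x) = - ap (F p (2*i+1)) (ap (F p (2*i+2)) x)"
    "ap (G p (2*i+2)) (ap (G p (2*i+1)) x) = - ap (G p (2*i+1)) (ap (G p (2*i+2)) x)"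
    "ap (F p (2*i+1)) (ap (F p (2*i+1)) x) = 0" "ap (F p (2*i+2)) (ap (F p (2*i+2)) x) = 0"
    "ap (G p (2*i+1)) (ap (G p (2*i+1)) x) = 0" "ap (G p (2*i+2)) (ap (G p (2*i+2)) x) = 0"
  using CAR_ap(3)[OF modes(1)[OF i] modes(1)[OF i]] CAR_ap(3)[OF modes(2)[OF i] modes(2)[OF i]]
    CAR_ap(3)[OF modes(1)[OF i] modes(2)[OF i]] CAR_ap(3)[OF modes(2)[OF i] modes(1)[OF i]]
    CAR_ap(1)[OF modes(2)[OF i] modes(1)[OF i]] CAR_ap(2)[OF modes(2)[OF i] modes(1)[OF i]]
    FF_zero[OF modes(1)[OF i]] FF_zero[OF modes(2)[OF i]] GG_zero[OF modes(1)[OF i]] GG_zero[OF modes(2)[OF i]]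
  by simp_all

text \<open>Both sides are sums over blocks of two modes, so normal ordering in one block suffices.
  The shift of \<open>NO\<close> puts weight zero in the middle degree \<open>p\<close>.\<close>

lemma om_eq:
  "om p 1 = sc (-4 * \<i>) * (NO p - sc (of_nat p))"
  "om p 2 = 4 *\<^sub>R (QO p - PO p)"
  "om p 3 = sc (-4 * \<i>) * (QO p + PO p)"
proof -
  have const: "sc (of_nat p) = (\<Sum>i<p. 1)" by (simp add: sc_of_nat)
  show "om p 1 = sc (-4 * \<i>) * (NO p - sc (of_nat p))"
    unfolding om_def NO_def sum_NN sum_MM const sum_subtractf[symmetric] sum_distrib_left
  proof (rule sum.cong[OF refl])
    fix i assume "i \<in> {..<p}"
    then have i: "i < p" by simp
    show "EE p (4*i+1) * Ue p 1 (4*i+1) + EE p (4*i+2) * Ue p 1 (4*i+2) + EE p (4*i+3) * Ue p 1 (4*i+3) + EE p (4*i+4) * Ue p 1 (4*i+4)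
      = sc (-4 * \<i>) * (G p (2*i+1) * F p (2*i+1) + G p (2*i+2) * F p (2*i+2) - 1)"
      unfolding U_block pm_sg_values E_block
      by (rule op_ext) (simp add: normal_order[OF i] del: One_nat_def, simp add: op_pointwise algebra_simps)
  qed
  show "om p 2 = 4 *\<^sub>R (QO p - PO p)"
    unfolding om_def QO_def PO_def sum_NN sum_subtractf[symmetric] scaleR_sum_right
  proof (rule sum.cong[OF refl])
    fix i assume "i \<in> {..<p}"
    then have i: "i < p" by simp
    show "EE p (4*i+1) * Ue p 2 (4*i+1) + EE p (4*i+2) * Ue p 2 (4*i+2) + EE p (4*i+3) * Ue p 2 (4*i+3) + EE p (4*i+4) * Ue p 2 (4*i+4)
      = 4 *\<^sub>R (G p (2*i+1) * G p (2*i+2) - F p (2*i+2) * F p (2*i+1))"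
      unfolding U_block pm_sg_values E_block
      by (rule op_ext) (simp add: normal_order[OF i], simp add: op_pointwise algebra_simps)
  qed
  show "om p 3 = sc (-4 * \<i>) * (QO p + PO p)"
    unfolding om_def QO_def PO_def sum_NN sum.distrib[symmetric] sum_distrib_left
  proof (rule sum.cong[OF refl])
    fix i assume "i \<in> {..<p}"
    then have i: "i < p" by simp
    show "EE p (4*i+1) * Ue p 3 (4*i+1) + EE p (4*i+2) * Ue p 3 (4*i+2) + EE p (4*i+3) * Ue p 3 (4*i+3) + EE p (4*i+4) * Ue p 3 (4*i+4)
      = sc (-4 * \<i>) * (G p (2*i+1) * G p (2*i+2) + F p (2*i+2) * F p (2*i+1))"
      unfolding U_block pm_sg_values E_block
      by (rule op_ext) (simp add: normal_order[OF i], simp add: op_pointwise algebra_simps)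
  qed
qed

lemma dual_eq:
  "NO p = sc (of_nat p) + sc (\<i>/4) * om p 1"
  "PO p = sc (1/8) * (sc \<i> * om p 3 - om p 2)"
  "QO p = sc (1/8) * (sc \<i> * om p 3 + om p 2)"
  unfolding om_eq by (rule op_ext, simp add: op_pointwise algebra_simps)+

lemma spo_comm_dual:
  assumes A: "A \<in> sp_alg p"
  shows "spo p A * NO p = NO p * spo p A" "spo p A * PO p = PO p * spo p A" "spo p A * QO p = QO p * spo p A"
proof -
  have *: "ap (spo p A) (ap (om p u) x) = ap (om p u) (ap (spo p A) x)" if "u \<in> {1,2,3}" for u x
    using spo_comm_om[OF A, of u, THEN arg_cong[where f = "\<lambda>T. ap T x"]] that by auto
  show "spo p A * NO p = NO p * spo p A" "spo p A * PO p = PO p * spo p A" "spo p A * QO p = QO p * spo p A"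
    unfolding dual_eq by (rule op_ext, simp add: *)+
qed

lemma PQ_commutator: "PO p * QO p - QO p * PO p = sc (of_nat p) - NO p"
proof -
  have "om p 2 * om p 3 = om p 3 * om p 2 + 8 *\<^sub>R om p 1"
    using om_om[of 2 3 p] by (simp add: qs_def qx_def One_nat_def)
  then have *: "ap (om p 2) (ap (om p 3) x) = ap (om p 3) (ap (om p 2) x) + cscale 8 (ap (om p 1) x)" for x
    by (metis ap_op(3,6) ap_scaleR of_real_numeral)
  show ?thesis
    unfolding dual_eq by (rule op_ext) (simp add: *, simp add: op_pointwise field_simps)
qed

lemma PQ_ap: "ap (PO p) (ap (QO p) x) = ap (QO p) (ap (PO p) x) + (cscale (of_nat p) x - ap (NO p) x)"
  using PQ_commutator[of p, THEN arg_cong[where f = "\<lambda>T. ap T x"]] by (simp add: algebra_simps)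

text \<open>Equal to \<open>-s(2p+2-s)\<close>, minus the classical Casimir value of the weight with
  \<open>s\<close> ones. The number \<open>p-s+1\<close> is the dimension of the corresponding
  module of the dual su(2).\<close>

definition kap :: "nat \<Rightarrow> nat \<Rightarrow> complex" where
  "kap p s = (of_nat p - of_nat s + 1)\<^sup>2 - (of_nat p + 1)\<^sup>2"

text \<open>Through \<open>cas_om2\<close> the Casimir value of sp(p) can be read off from an
  extremal vector of the dual sl(2).\<close>

lemma cas_highest:
  assumes "ap (PO p) x = 0" "ap (NO p) x = cscale (of_nat s) x"
  shows "ap (cas p) x = cscale (kap p s) x"
proof -
  have om1: "ap (om p 1) x = cscale (-4 * \<i> * (of_nat s - of_nat p)) x"
    unfolding om_eq using assms(2) by (simp add: cv.scale_left_diff_distrib algebra_simps)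
  have *: "ap (om p 2) (ap (om p 2) x) + ap (om p 3) (ap (om p 3) x) = cscale (-32 * (of_nat p - of_nat s)) x"
    unfolding om_eq
    by (simp add: PQ_ap assms) (rule ext, simp add: op_pointwise algebra_simps)
  have "ap (om2 p) x = cscale (-4 * \<i> * (of_nat s - of_nat p)) (cscale (-4 * \<i> * (of_nat s - of_nat p)) x)
      + (ap (om p 2) (ap (om p 2) x) + ap (om p 3) (ap (om p 3) x))"
    unfolding om2_def by (simp only: ap_op om1 ap_scale add.assoc)
  then have om2x: "ap (om2 p) x = cscale (-16 * (of_nat s - of_nat p)\<^sup>2 - 32 * (of_nat p - of_nat s)) x"
    unfolding * by (simp add: fun_eq_iff pointwise power2_eq_square algebra_simps)
  show ?thesis
    unfolding cas_om2 kap_def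
    by (rule ext) (simp add: om2x, simp add: op_pointwise power2_eq_square field_simps)
qed

lemma cas_comm: "(\<And>A. A \<in> sp_alg p \<Longrightarrow> spo p A * T = T * spo p A) \<Longrightarrow> cas p * T = T * cas p"
proof -
  assume a: "\<And>A. A \<in> sp_alg p \<Longrightarrow> spo p A * T = T * spo p A"
  have "spo p (Ag p a b) * spo p (Ag p a b) * T = T * (spo p (Ag p a b) * spo p (Ag p a b))"
    if "a \<in> NN p" "b \<in> NN p" for a b
    using a[OF Ag_sp_alg[OF that]] by (metis mult.assoc)
  then show ?thesis
    unfolding cas_def sum_distrib_left sum_distrib_right by (intro sum.cong refl)
qed

lemma QO_adjoint: "ip (Zc (4*p)) (ap (QO p) x) y = ip (Zc (4*p)) x (ap (PO p) y)"
  unfolding QO_def PO_def ap_op_sum ip_sum_left ip_sum_right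
  by (intro sum.cong refl) (simp add: G_adjoint[OF modes(1)] G_adjoint[OF modes(2)])

section \<open>Degrees\<close>

lemma subspace_Sdeg: "cv.subspace (Sdeg p r)"
  unfolding Sdeg_eq by simp

lemma bv_Sdeg: "J \<subseteq> MM p \<Longrightarrow> card J = r \<Longrightarrow> bv p J \<in> Sdeg p r"
  unfolding Sdeg_eq by (intro cv.span_base) auto

lemma Sdeg_op:
  assumes "x \<in> Sdeg p r" "cv.subspace S" "\<And>J. J \<subseteq> MM p \<Longrightarrow> card J = r \<Longrightarrow> ap T (bv p J) \<in> S"
  shows "ap T x \<in> S"
  by (rule span_op_image[OF assms(1)[unfolded Sdeg_eq] _ assms(2)]) (use assms(3) in auto)

lemma Sdeg_G:
  assumes x: "x \<in> Sdeg p r" and k: "k \<in> MM p"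
  shows "ap (G p k) x \<in> Sdeg p (r + 1)"
proof (rule Sdeg_op[OF x subspace_Sdeg])
  fix J assume J: "J \<subseteq> MM p" "card J = r"
  obtain c where c: "ap (G p k) (bv p J) = cscale c (bv p (insert k J))"
    using G_bv(1)[OF k J(1)] by blast
  show "ap (G p k) (bv p J) \<in> Sdeg p (r + 1)"
  proof (cases "k \<in> J")
    case True
    then show ?thesis using G_bv(2)[OF k J(1)] by (simp add: cv.subspace_0 subspace_Sdeg)
  next
    case False
    have "bv p (insert k J) \<in> Sdeg p (r + 1)"
      by (rule bv_Sdeg) (use J k False finite_modes[OF J(1)] in auto)
    then show ?thesis unfolding c by (rule cv.subspace_scale[OF subspace_Sdeg])
  qed
qed

text \<open>For \<open>r = 0\<close> the truncated difference is harmless since the image is zero,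
  see \<open>Sdeg_F_0\<close>.\<close>

lemma Sdeg_F:
  assumes x: "x \<in> Sdeg p r" and k: "k \<in> MM p"
  shows "ap (F p k) x \<in> Sdeg p (r - 1)"
proof (rule Sdeg_op[OF x subspace_Sdeg])
  fix J assume J: "J \<subseteq> MM p" "card J = r"
  obtain c where c: "ap (F p k) (bv p J) = cscale c (bv p (J - {k}))"
    using F_bv(1)[OF k J(1)] by blast
  show "ap (F p k) (bv p J) \<in> Sdeg p (r - 1)"
  proof (cases "k \<in> J")
    case False
    then show ?thesis using F_bv(2)[OF k J(1)] by (simp add: cv.subspace_0 subspace_Sdeg)
  next
    case True
    have "bv p (J - {k}) \<in> Sdeg p (r - 1)"
      by (rule bv_Sdeg) (use J True finite_modes[OF J(1)] in auto)
    then show ?thesis unfolding c by (rule cv.subspace_scale[OF subspace_Sdeg])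
  qed
qed

lemma Sdeg_F_0:
  assumes x: "x \<in> Sdeg p 0" and k: "k \<in> MM p"
  shows "ap (F p k) x = 0"
proof -
  have "ap (F p k) x \<in> {0}"
  proof (rule Sdeg_op[OF x])
    fix J assume J: "J \<subseteq> MM p" "card J = 0"
    then have "k \<notin> J" using finite_modes by auto
    then show "ap (F p k) (bv p J) \<in> {0}" using F_bv(2)[OF k J(1)] by simp
  qed (rule cv.subspace_single_0)
  then show ?thesis by simp
qed

lemma Sdeg_Q:
  assumes "x \<in> Sdeg p r"
  shows "ap (QO p) x \<in> Sdeg p (r + 2)"
  unfolding QO_def ap_op_sum
proof (rule cv.subspace_sum[OF subspace_Sdeg])
  fix i assume "i \<in> {..<p}"
  then have i: "i < p" by simp
  have "ap (G p (2*i+1)) (ap (G p (2*i+2)) x) \<in> Sdeg p (r + 1 + 1)"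
    by (intro Sdeg_G assms modes i)
  moreover have "r + 1 + 1 = r + 2" by simp
  ultimately show "ap (G p (2*i+1) * G p (2*i+2)) x \<in> Sdeg p (r + 2)"
    by (simp only: ap_op)
qed

lemma Sdeg_P:
  assumes "x \<in> Sdeg p r"
  shows "ap (PO p) x \<in> Sdeg p (r - 2)"
  unfolding PO_def ap_op_sum
proof (rule cv.subspace_sum[OF subspace_Sdeg])
  fix i assume "i \<in> {..<p}"
  then have i: "i < p" by simp
  have "ap (F p (2*i+2)) (ap (F p (2*i+1)) x) \<in> Sdeg p (r - 1 - 1)"
    by (intro Sdeg_F assms modes i)
  moreover have "r - 1 - 1 = r - 2" by simp
  ultimately show "ap (F p (2*i+2) * F p (2*i+1)) x \<in> Sdeg p (r - 2)"
    by (simp only: ap_op)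
qed

lemma Sdeg_P_0:
  assumes "x \<in> Sdeg p r" "r < 2"
  shows "ap (PO p) x = 0"
  unfolding PO_def ap_op_sum
proof (rule sum.neutral, rule ballI)
  fix i assume "i \<in> {..<p}"
  then have i: "i < p" by simp
  have "r - 1 = 0" using assms(2) by simp
  then have "ap (F p (2*i+1)) x \<in> Sdeg p 0"
    using Sdeg_F[OF assms(1) modes(1)[OF i]] by simp
  then show "ap (F p (2*i+2) * F p (2*i+1)) x = 0"
    using Sdeg_F_0 modes(2)[OF i] by (simp only: ap_op)
qed

lemma NO_bv:
  assumes "J \<subseteq> MM p"
  shows "ap (NO p) (bv p J) = cscale (of_nat (card J)) (bv p J)"
proof -
  have "ap (NO p) (bv p J) = (\<Sum>k\<in>MM p. if k \<in> J then bv p J else 0)"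
    unfolding NO_def ap_op_sum by (intro sum.cong refl) (simp add: n_bv[OF _ assms])
  also have "\<dots> = (\<Sum>k\<in>J. bv p J)"
    by (rule sum.mono_neutral_cong_right) (use assms in auto)
  also have "\<dots> = cscale (of_nat (card J)) (bv p J)"
    by (rule cv.sum_constant_scale)
  finally show ?thesis .
qed

lemma NO_Sdeg:
  assumes "x \<in> Sdeg p r"
  shows "ap (NO p) x = cscale (of_nat r) x"
proof -
  have "ap (NO p - sc (of_nat r)) x \<in> {0}"
    by (rule Sdeg_op[OF assms cv.subspace_single_0]) (simp add: NO_bv)
  then show ?thesis by simp
qed

text \<open>The whole spinor space; single vectors mix degrees, so closure under them is stated
  here.\<close>

definition Sall :: "nat \<Rightarrow> cl set" where "Sall p = cv.span (bv p ` Pow (MM p))"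

lemma subspace_Sall: "cv.subspace (Sall p)"
  unfolding Sall_def by simp

lemma Sdeg_Sall: "Sdeg p r \<subseteq> Sall p"
  unfolding Sdeg_eq Sall_def by (rule cv.span_mono) auto

lemma Sall_F: "x \<in> Sall p \<Longrightarrow> k \<in> MM p \<Longrightarrow> ap (F p k) x \<in> Sall p"
  and Sall_G: "x \<in> Sall p \<Longrightarrow> k \<in> MM p \<Longrightarrow> ap (G p k) x \<in> Sall p"
proof -
  assume x: "x \<in> Sall p" and k: "k \<in> MM p"
  have b: "bv p J \<in> Sall p" if "J \<subseteq> MM p" for J
    unfolding Sall_def using that by (intro cv.span_base) auto
  show "ap (F p k) x \<in> Sall p"
  proof (rule span_op_image[OF x[unfolded Sall_def] _ subspace_Sall])
    fix J assume "J \<in> Pow (MM p)"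
    then have J: "J \<subseteq> MM p" by simp
    obtain c where "ap (F p k) (bv p J) = cscale c (bv p (J - {k}))"
      using F_bv(1)[OF k J] by blast
    then show "ap (F p k) (bv p J) \<in> Sall p"
      using b[of "J - {k}"] J cv.subspace_scale[OF subspace_Sall] by auto
  qed
  show "ap (G p k) x \<in> Sall p"
  proof (rule span_op_image[OF x[unfolded Sall_def] _ subspace_Sall])
    fix J assume "J \<in> Pow (MM p)"
    then have J: "J \<subseteq> MM p" by simp
    obtain c where "ap (G p k) (bv p J) = cscale c (bv p (insert k J))"
      using G_bv(1)[OF k J] by blast
    moreover have "bv p (insert k J) \<in> Sall p" by (rule b) (use J k in auto)
    ultimately show "ap (G p k) (bv p J) \<in> Sall p"
      using cv.subspace_scale[OF subspace_Sall] by simp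
  qed
qed

lemma Sall_E:
  assumes "x \<in> Sall p" "a \<in> NN p"
  shows "ap (EE p a) x \<in> Sall p"
proof (cases "even a")
  case True
  then obtain k where k: "a = 2 * k" by (rule evenE)
  then have "k \<in> MM p" using assms(2) by auto
  then show ?thesis unfolding k E_even ap_op ap_sc
    by (intro cv.subspace_scale cv.subspace_add subspace_Sall Sall_F Sall_G assms(1))
next
  case False
  then obtain j where "a = 2 * j + 1" by (rule oddE)
  then have k: "a = 2 * (j + 1) - 1" "j + 1 \<in> MM p" using assms(2) by auto
  show ?thesis unfolding k(1) E_odd using assms(1) k(2)
    by (auto intro!: cv.subspace_diff subspace_Sall Sall_F Sall_G)
qed

lemma Sall_spo:
  assumes "x \<in> Sall p"
  shows "ap (spo p A) x \<in> Sall p"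
  unfolding spo_def ap_scaleR ap_op_sum ap_op
  by (intro cv.subspace_scale cv.subspace_sum subspace_Sall Sall_E assms)

text \<open>Degrees are eigenspaces of the number operator, so operators on the spinors that commute
  with \<open>NO\<close>, the Lie algebra among them, preserve the degree.\<close>

lemma Sall_NO_Sdeg:
  assumes x: "x \<in> Sall p" and N: "ap (NO p) x = cscale (of_nat r) x"
  shows "x \<in> Sdeg p r"
proof -
  have "x \<in> cv.span (bv p ` {J \<in> Pow (MM p). of_nat (card J) = (of_nat r :: complex)})"
    by (rule eigen_filter[OF _ x[unfolded Sall_def] NO_bv N]) auto
  moreover have "{J \<in> Pow (MM p). of_nat (card J) = (of_nat r :: complex)} = {J. J \<subseteq> MM p \<and> card J = r}"
    by auto
  ultimately show ?thesis unfolding Sdeg_eq by simp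
qed

lemma Sdeg_spo:
  assumes A: "A \<in> sp_alg p" and x: "x \<in> Sdeg p r"
  shows "ap (spo p A) x \<in> Sdeg p r"
proof (rule Sall_NO_Sdeg)
  show "ap (spo p A) x \<in> Sall p" using Sall_spo Sdeg_Sall x by blast
  have "ap (NO p) (ap (spo p A) x) = ap (spo p A) (ap (NO p) x)"
    using spo_comm_dual(1)[OF A, THEN arg_cong[where f = "\<lambda>T. ap T x"]] by simp
  then show "ap (NO p) (ap (spo p A) x) = cscale (of_nat r) (ap (spo p A) x)"
    using NO_Sdeg[OF x] by simp
qed

lemma bv_supported: "bv p J \<in> supported (Zc (4*p))"
proof -
  have 1: "clprod n xs \<in> supported (Zc n)" for n xs
  proof (induction xs)
    case Nil
    then show ?case by (auto simp: clprod_def clone_def supported_def)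
  next
    case (Cons x xs)
    then have "clmul n x (clprod n xs) \<in> supported (Zc n)" by (intro clmul_supported) simp
    then show ?case by (simp add: clprod_def)
  qed
  have "gl p xs \<in> supported (Zc (4*p))" for xs
  proof (induction xs)
    case Nil
    then show ?case unfolding gl_simps Iprim_def by (rule 1)
  next
    case (Cons k xs)
    then show ?case unfolding gl_simps G_def ap_lm by (intro clmul_supported) simp
  qed
  then show ?thesis unfolding bv_def .
qed

lemma Sall_supported: "Sall p \<subseteq> supported (Zc (4*p))"
  unfolding Sall_def by (rule cv.span_minimal[OF _ subspace_supported]) (use bv_supported in auto)

lemma Sdeg_supported: "Sdeg p r \<subseteq> supported (Zc (4*p))"
  using Sdeg_Sall Sall_supported by blast

section \<open>The spin module and the symplectic cells\<close>

lemma spo_skew: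
  assumes A: "A \<in> sp_alg p"
  shows "ip (Zc (4*p)) (ap (spo p A) x) y = - ip (Zc (4*p)) x (ap (spo p A) y)"
proof -
  let ?ip = "ip (Zc (4*p))"
  have "?ip (ap (spo p A) x) y = (-1/4) * (\<Sum>a\<in>NN p. \<Sum>b\<in>NN p. of_real (A a b) * ?ip x (ap (EE p b) (ap (EE p a) y)))"
    unfolding spo_def by (simp add: ap_op_sum ip_sum_left E_skew)
  also have "(\<Sum>a\<in>NN p. \<Sum>b\<in>NN p. of_real (A a b) * ?ip x (ap (EE p b) (ap (EE p a) y)))
    = (\<Sum>b\<in>NN p. \<Sum>a\<in>NN p. of_real (A a b) * ?ip x (ap (EE p b) (ap (EE p a) y)))"
    by (rule sum.swap)
  also have "\<dots> = - (\<Sum>b\<in>NN p. \<Sum>a\<in>NN p. of_real (A b a) * ?ip x (ap (EE p b) (ap (EE p a) y)))"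
    unfolding sum_negf[symmetric]
  proof (intro sum.cong refl)
    fix a b
    have t: "A a b = - A b a" by (rule sp_algD(1)[OF A])
    show "of_real (A a b) * ?ip x (ap (EE p b) (ap (EE p a) y)) = - (of_real (A b a) * ?ip x (ap (EE p b) (ap (EE p a) y)))"
      unfolding t by simp
  qed
  also have "(-1/4) * \<dots> = - ?ip x (ap (spo p A) y)"
    unfolding spo_def by (simp add: ap_op_sum ip_sum_right)
  finally show ?thesis .
qed

lemma skew_module_spin: "skew_module (Zc (4*p)) p (spin_act p)"
  by unfold_locales (simp_all add: spin_act_eq spo_skew)

lemma submodule_Sdeg: "submodule p (spin_act p) (Sdeg p r)"
  by (rule submoduleI) (simp_all add: subspace_Sdeg spin_act_eq Sdeg_spo)

lemma linear_on_ap: "linear_on V (ap T)"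
  by (simp add: linear_on_def)

lemma cell0_eq: "cell0 p s = {x \<in> Sdeg p s. ap (PO p) x = 0}"
  unfolding cell0_def lm_Pop by (simp add: zero_fun_def)

lemma spin_comm:
  assumes "A \<in> sp_alg p"
  shows "ap (PO p) (spin_act p A x) = spin_act p A (ap (PO p) x)"
    "ap (QO p) (spin_act p A x) = spin_act p A (ap (QO p) x)"
  using spo_comm_dual(2,3)[OF assms, THEN arg_cong[where f = "\<lambda>T. ap T x"]] by (simp_all add: spin_act_eq)

lemma submodule_cell0: "submodule p (spin_act p) (cell0 p s)"
proof (rule submoduleI)
  show "cv.subspace (cell0 p s)"
    using subspace_Sdeg[of p s] unfolding cell0_eq cv.subspace_def by auto
  fix A x assume A: "A \<in> sp_alg p" and x: "x \<in> cell0 p s"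
  have "ap (PO p) (spin_act p A x) = spin_act p A (ap (PO p) x)"
    by (rule spin_comm(1)[OF A])
  also have "\<dots> = 0" using x by (simp add: cell0_eq spin_act_eq)
  finally show "spin_act p A x \<in> cell0 p s"
    using submoduleD(2)[OF submodule_Sdeg A] x unfolding cell0_eq by simp
qed

lemma cas_cell0: "x \<in> cell0 p s \<Longrightarrow> ap (cas p) x = cscale (kap p s) x"
  unfolding cell0_eq using cas_highest NO_Sdeg by blast

text \<open>\<open>QO\<close> commutes with the Lie algebra, so the Casimir value of a primitive
  cell persists along its string of cells.\<close>

lemma Q_powers:
  assumes "V = (ap (QO p) ^^ k) ` cell0 p s"
  shows "submodule p (spin_act p) V \<and> V \<subseteq> Sdeg p (s + 2 * k) \<and> (\<forall>x\<in>V. ap (cas p) x = cscale (kap p s) x)"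
  using assms
proof (induction k arbitrary: V)
  case 0
  then show ?case using submodule_cell0 cas_cell0 by (auto simp: cell0_eq)
next
  case (Suc k)
  define W where "W = (ap (QO p) ^^ k) ` cell0 p s"
  have V: "V = ap (QO p) ` W" unfolding Suc.prems W_def by (auto simp: image_image)
  note IH = Suc.IH[OF W_def]
  have "submodule p (spin_act p) V"
    unfolding V by (rule submodule_image[where ?act1.0 = "spin_act p"]) (use IH linear_on_ap spin_comm in auto)
  moreover have "V \<subseteq> Sdeg p (s + 2 * Suc k)"
    unfolding V using IH Sdeg_Q[of _ p "s + 2 * k"] by (auto simp: ac_simps)
  moreover have "ap (cas p) (ap (QO p) x) = ap (QO p) (ap (cas p) x)" for x
    using cas_comm[OF spo_comm_dual(3), THEN arg_cong[where f = "\<lambda>T. ap T x"]] by simp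
  ultimately show ?case unfolding V using IH by auto
qed

lemma cell_props:
  assumes "cell_ok p r s"
  shows "submodule p (spin_act p) (cell p r s)" "cell p r s \<subseteq> Sdeg p r"
    "x \<in> cell p r s \<Longrightarrow> ap (cas p) x = cscale (kap p s) x"
proof -
  have eq: "cell p r s = (ap (QO p) ^^ ((r - s) div 2)) ` cell0 p s"
    unfolding cell_def lm_Qop using assms by simp
  have r: "s + 2 * ((r - s) div 2) = r" using assms by (auto simp: cell_ok_def)
  show "submodule p (spin_act p) (cell p r s)" "cell p r s \<subseteq> Sdeg p r"
    "x \<in> cell p r s \<Longrightarrow> ap (cas p) x = cscale (kap p s) x"
    using Q_powers[OF eq] unfolding r by auto
qed

text \<open>For such \<open>x\<close> the squared norm of \<open>Q x\<close> is \<open>p - d\<close>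
  times that of \<open>x\<close>, so positivity excludes \<open>d > p\<close>.\<close>

lemma ker_P_degree:
  assumes "x \<in> Sdeg p d" "ap (PO p) x = 0" "x \<noteq> 0"
  shows "d \<le> p"
proof (rule ccontr)
  assume "\<not> d \<le> p"
  let ?ip = "ip (Zc (4*p))"
  have "ap (PO p) (ap (QO p) x) = cscale (of_nat p - of_nat d) x"
    unfolding PQ_ap using assms(2) NO_Sdeg[OF assms(1)] by (simp add: cv.scale_left_diff_distrib)
  then have "?ip (ap (QO p) x) (ap (QO p) x) = (of_nat p - of_nat d) * ?ip x x"
    unfolding QO_adjoint by simp
  then have "?ip (ap (QO p) x) (ap (QO p) x) = of_real (real p - real d) * ?ip x x"
    by simp
  then have "Re (?ip (ap (QO p) x) (ap (QO p) x)) = (real p - real d) * Re (?ip x x)"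
    by (simp only: Re_complex_of_real Im_complex_of_real mult_zero_left diff_zero times_complex.sel)
  moreover have "0 \<le> Re (?ip (ap (QO p) x) (ap (QO p) x))" "0 \<le> Re (?ip x x)"
    by (rule ip_self_nonneg)+
  ultimately have "Re (?ip x x) = 0"
    using \<open>\<not> d \<le> p\<close> by (smt (verit) mult_neg_pos not_le of_nat_less_iff)
  then have "\<forall>z\<in>Zc (4*p). x z = 0" by (subst (asm) ip_self_Re_eq_0) auto
  moreover have "x \<in> supported (Zc (4*p))" using Sdeg_supported assms(1) by blast
  ultimately have "x = 0" unfolding supported_def zero_fun_def by (intro ext) auto
  then show False using assms(3) by simp
qed

section \<open>Irreducibility of the primitive cells\<close>

text \<open>By \<open>spo_Ag\<close> these are the generators of the Lie algebra up to a factor and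
  a scalar operator.\<close>

definition TT :: "nat \<Rightarrow> nat \<Rightarrow> nat \<Rightarrow> op" where
  "TT p a b = (\<Sum>u<4. Ue p u a * Ue p u b)"

lemma TT_mem:
  assumes W: "submodule p (spin_act p) W" and x: "x \<in> W" and ab: "a \<in> NN p" "b \<in> NN p"
  shows "ap (TT p a b) x \<in> W"
proof -
  note sW = submoduleD(1)[OF W]
  have "ap (spo p (Ag p a b)) x \<in> W"
    using submoduleD(2)[OF W Ag_sp_alg[OF ab] x] by (simp add: spin_act_eq)
  then have "cscale (-8) (ap (spo p (Ag p a b)) x) - cscale (if a = b then 4 else 0) x \<in> W"
    using x by (intro cv.subspace_diff cv.subspace_scale sW)
  also have "cscale (-8) (ap (spo p (Ag p a b)) x) - cscale (if a = b then 4 else 0) x = ap (TT p a b) x"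
    unfolding spo_Ag[OF ab] TT_def sum4 by (rule ext) (simp add: op_pointwise algebra_simps)
  finally show ?thesis .
qed

text \<open>Modes \<open>2*i+1\<close> and \<open>2*i+2\<close> carry opposite weights. The
  operators are weight vectors of the complexified Lie algebra: one for the difference of the
  weights of \<open>i\<close> and \<open>j\<close>, one for a long root. Submodules being complex
  subspaces, complex combinations of real generators may be used.\<close>

lemma raise_mem:
  assumes W: "submodule p (spin_act p) W" and x: "x \<in> W"
  shows "i < p \<Longrightarrow> j < p \<Longrightarrow> ap (G p (2*i+1) * F p (2*j+1) + F p (2*i+2) * G p (2*j+2)) x \<in> W"
    and "i < p \<Longrightarrow> ap (G p (2*i+1) * F p (2*i+2)) x \<in> W"
proof -
  note sW = submoduleD(1)[OF W]
  have comb: "cscale c1 (ap (TT p a b) x) + cscale c2 (ap (TT p a b') x)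
      + cscale c3 (ap (TT p a' b) x) + cscale c4 (ap (TT p a' b') x) \<in> W"
    if "a \<in> NN p" "a' \<in> NN p" "b \<in> NN p" "b' \<in> NN p" for a a' b b' c1 c2 c3 c4
    by (intro cv.subspace_add cv.subspace_scale sW TT_mem[OF W x] that)
  show "ap (G p (2*i+1) * F p (2*j+1) + F p (2*i+2) * G p (2*j+2)) x \<in> W" if i: "i < p" and j: "j < p"
  proof -
    \<comment> \<open>The coefficients are those of -1/8 times (e_1 + i e_2)(e_1' - i e_2'), with
      the generators of the two blocks. Units 0 and 1 yield the first summand of the target, units 2
      and 3 the second.\<close>
    have "cscale (-1/8) (ap (TT p (4*i+1) (4*j+1)) x) + cscale (\<i>/8) (ap (TT p (4*i+1) (4*j+2)) x)
      + cscale (-\<i>/8) (ap (TT p (4*i+2) (4*j+1)) x) + cscale (-1/8) (ap (TT p (4*i+2) (4*j+2)) x) \<in> W"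
      by (rule comb) (use i j in auto)
    also have "cscale (-1/8) (ap (TT p (4*i+1) (4*j+1)) x) + cscale (\<i>/8) (ap (TT p (4*i+1) (4*j+2)) x)
      + cscale (-\<i>/8) (ap (TT p (4*i+2) (4*j+1)) x) + cscale (-1/8) (ap (TT p (4*i+2) (4*j+2)) x)
      = ap (G p (2*i+1) * F p (2*j+1) + F p (2*i+2) * G p (2*j+2)) x"
      unfolding TT_def sum4 U_block pm_sg_values E_block
      by (rule ext) (simp add: op_pointwise algebra_simps)
    finally show ?thesis .
  qed
  show "ap (G p (2*i+1) * F p (2*i+2)) x \<in> W" if i: "i < p"
  proof -
    have "cscale (-1/16) (ap (TT p (4*i+1) (4*i+3)) x) + cscale (\<i>/16) (ap (TT p (4*i+1) (4*i+4)) x)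
      + cscale (-\<i>/16) (ap (TT p (4*i+2) (4*i+3)) x) + cscale (-1/16) (ap (TT p (4*i+2) (4*i+4)) x) \<in> W"
      by (rule comb) (use i in auto)
    also have "cscale (-1/16) (ap (TT p (4*i+1) (4*i+3)) x) + cscale (\<i>/16) (ap (TT p (4*i+1) (4*i+4)) x)
      + cscale (-\<i>/16) (ap (TT p (4*i+2) (4*i+3)) x) + cscale (-1/16) (ap (TT p (4*i+2) (4*i+4)) x)
      = ap (G p (2*i+1) * F p (2*i+2)) x"
      unfolding TT_def sum4 U_block pm_sg_values E_block
      by (rule ext) (simp add: normal_order[OF i], simp add: op_pointwise algebra_simps)
    finally show ?thesis .
  qed
qed

text \<open>A filtration which the raising operators move strictly upwards; its top nonzero step
  inside a submodule consists of highest weight vectors.\<close>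

definition hgt :: "nat \<Rightarrow> nat \<Rightarrow> nat" where
  "hgt p k = (if odd k then 2 * p - (k - 1) div 2 else k div 2)"

definition Fil :: "nat \<Rightarrow> nat \<Rightarrow> cl set" where
  "Fil p m = cv.span (bv p ` {J. J \<subseteq> MM p \<and> m \<le> sum (hgt p) J})"

text \<open>The heights follow the order of the weights: decreasing along the odd modes, then, all
  smaller, the even modes in reverse order.\<close>

lemma hgt_values: "hgt p (2*i+1) = 2*p - i" "hgt p (2*i+2) = i + 1"
  by (simp_all add: hgt_def)

lemma Fil_GF:
  assumes x: "x \<in> Fil p m" and k: "k \<in> MM p" and l: "l \<in> MM p" and kl: "hgt p l < hgt p k"
  shows "ap (G p k) (ap (F p l) x) \<in> Fil p (Suc m)"
proof -
  have sub: "cv.subspace (Fil p (Suc m))" unfolding Fil_def by simp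
  have "ap (G p k * F p l) x \<in> Fil p (Suc m)"
  proof (rule span_op_image[OF x[unfolded Fil_def] _ sub])
    fix J assume "J \<in> {J. J \<subseteq> MM p \<and> m \<le> sum (hgt p) J}"
    then have J: "J \<subseteq> MM p" and m: "m \<le> sum (hgt p) J" by auto
    note fin = finite_modes[OF J]
    have J': "J - {l} \<subseteq> MM p" using J by auto
    obtain c where c: "ap (F p l) (bv p J) = cscale c (bv p (J - {l}))"
      using F_bv(1)[OF l J] by blast
    obtain d where d: "ap (G p k) (bv p (J - {l})) = cscale d (bv p (insert k (J - {l})))"
      using G_bv(1)[OF k J'] by blast
    show "ap (G p k * F p l) (bv p J) \<in> Fil p (Suc m)"
    proof (cases "l \<in> J \<and> k \<notin> J - {l}")
      case True
      have "sum (hgt p) J = hgt p l + sum (hgt p) (J - {l})"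
        using True fin by (simp add: sum.remove)
      moreover have "sum (hgt p) (insert k (J - {l})) = hgt p k + sum (hgt p) (J - {l})"
        using True fin by (subst sum.insert) auto
      ultimately have "Suc m \<le> sum (hgt p) (insert k (J - {l}))"
        using m kl by linarith
      then have "bv p (insert k (J - {l})) \<in> Fil p (Suc m)"
        unfolding Fil_def using J' k by (intro cv.span_base imageI) auto
      then show ?thesis
        using c d by (simp add: cv.subspace_scale[OF sub])
    next
      case False
      have "ap (G p k * F p l) (bv p J) = 0"
      proof (cases "l \<in> J")
        case True
        then have "ap (G p k) (bv p (J - {l})) = 0" using False G_bv(2)[OF k J'] by blast
        then show ?thesis by (simp only: ap_op c ap_scale cv.scale_zero_right)
      next
        case False
        then have "ap (F p l) (bv p J) = 0" by (rule F_bv(2)[OF l J])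
        then show ?thesis by (simp only: ap_op ap_0)
      qed
      then show ?thesis by (simp add: cv.subspace_0[OF sub])
    qed
  qed
  then show ?thesis by simp
qed

lemma Fil_top: "Fil p (Suc (sum (hgt p) (MM p))) = {0}"
proof -
  have "\<not> Suc (sum (hgt p) (MM p)) \<le> sum (hgt p) J" if "J \<subseteq> MM p" for J
    using sum_mono2[OF _ that, of "hgt p"] by (simp add: not_less_eq_eq[symmetric])
  then have "{J. J \<subseteq> MM p \<and> Suc (sum (hgt p) (MM p)) \<le> sum (hgt p) J} = {}" by blast
  then show ?thesis unfolding Fil_def by (simp only: image_empty cv.span_empty)
qed

text \<open>Annihilation by the operators of \<open>raise_mem\<close> for positive roots, with the
  second summand anticommuted to the other side. In this form it exchanges odd for even
  modes.\<close>

definition highest :: "nat \<Rightarrow> cl \<Rightarrow> bool" where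
  "highest p x \<longleftrightarrow> (\<forall>i<p. \<forall>j<p. i < j \<longrightarrow> ap (G p (2*i+1)) (ap (F p (2*j+1)) x) = ap (G p (2*j+2)) (ap (F p (2*i+2)) x))
     \<and> (\<forall>i<p. ap (G p (2*i+1)) (ap (F p (2*i+2)) x) = 0)"

lemma ex_highest:
  assumes W: "submodule p (spin_act p) W" "W \<subseteq> Sall p" "W \<noteq> {0}"
  shows "\<exists>x\<in>W. x \<noteq> 0 \<and> highest p x"
proof -
  let ?P = "\<lambda>m. \<exists>x\<in>W. x \<noteq> 0 \<and> x \<in> Fil p m"
  have "Fil p 0 = Sall p" unfolding Fil_def Sall_def by (simp add: Pow_def)
  then have "?P 0"
    using subspace_nonzero[OF submoduleD(1)[OF W(1)] W(3)] W(2) by auto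
  moreover have "\<not> ?P (Suc (sum (hgt p) (MM p)))"
    unfolding Fil_top by auto
  ultimately have "\<not> (\<forall>m. ?P m \<longrightarrow> ?P (Suc m))"
    using nat_induct[of ?P "Suc (sum (hgt p) (MM p))"] by blast
  then obtain m where m: "?P m" "\<not> ?P (Suc m)" by blast
  then obtain x where x: "x \<in> W" "x \<noteq> 0" "x \<in> Fil p m" by blast
  have sub: "cv.subspace (Fil p (Suc m))" unfolding Fil_def by simp
  have "highest p x"
    unfolding highest_def
  proof (intro conjI allI impI)
    fix i j assume ij: "i < p" "j < p" "i < j"
    have ne: "2*i+2 \<noteq> 2*j+2" using ij by simp
    have eq: "ap (G p (2*i+1) * F p (2*j+1) + F p (2*i+2) * G p (2*j+2)) x
       = ap (G p (2*i+1)) (ap (F p (2*j+1)) x) - ap (G p (2*j+2)) (ap (F p (2*i+2)) x)"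
      using CAR_ap(3)[OF modes(2)[OF ij(1)] modes(2)[OF ij(2)], of x] ij(3) by simp
    have "ap (G p (2*i+1)) (ap (F p (2*j+1)) x) \<in> Fil p (Suc m)"
      by (rule Fil_GF[OF x(3) modes(1)[OF ij(1)] modes(1)[OF ij(2)]])
        (unfold hgt_values, use ij in linarith)
    moreover have "ap (G p (2*j+2)) (ap (F p (2*i+2)) x) \<in> Fil p (Suc m)"
      by (rule Fil_GF[OF x(3) modes(2)[OF ij(2)] modes(2)[OF ij(1)]])
        (unfold hgt_values, use ij in linarith)
    ultimately have "ap (G p (2*i+1) * F p (2*j+1) + F p (2*i+2) * G p (2*j+2)) x \<in> Fil p (Suc m)"
      unfolding eq by (rule cv.subspace_diff[OF sub])
    moreover have "ap (G p (2*i+1) * F p (2*j+1) + F p (2*i+2) * G p (2*j+2)) x \<in> W"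
      by (rule raise_mem(1)[OF W(1) x(1) ij(1,2)])
    ultimately have "ap (G p (2*i+1) * F p (2*j+1) + F p (2*i+2) * G p (2*j+2)) x = 0"
      using m(2) by blast
    then show "ap (G p (2*i+1)) (ap (F p (2*j+1)) x) = ap (G p (2*j+2)) (ap (F p (2*i+2)) x)"
      unfolding eq by simp
  next
    fix i assume i: "i < p"
    have "ap (G p (2*i+1)) (ap (F p (2*i+2)) x) \<in> Fil p (Suc m)"
      by (rule Fil_GF[OF x(3) modes(1)[OF i] modes(2)[OF i]])
        (unfold hgt_values, use i in linarith)
    moreover have "ap (G p (2*i+1)) (ap (F p (2*i+2)) x) \<in> W"
      using raise_mem(2)[OF W(1) x(1) i] by simp
    ultimately show "ap (G p (2*i+1)) (ap (F p (2*i+2)) x) = 0"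
      using m(2) by blast
  qed
  then show ?thesis using x by blast
qed

section \<open>The product Q P on highest weight vectors and uniqueness of the highest
  weight\<close>

definition nn :: "nat \<Rightarrow> nat \<Rightarrow> op" where "nn p k = G p k * F p k"

text \<open>The (i, j) term of \<open>QO p * PO p\<close> in terms of number operators, valid on
  highest weight vectors; \<open>dc\<close> is its eigenvalue on a Fock vector.\<close>

definition dd :: "nat \<Rightarrow> nat \<Rightarrow> nat \<Rightarrow> op" where
  "dd p i j = (if i < j then nn p (2*i+2) - nn p (2*i+2) * nn p (2*j+2)
     else if j < i then nn p (2*i+1) - nn p (2*i+1) * nn p (2*j+1)
     else nn p (2*i+1) * nn p (2*i+2))"

definition dc :: "nat set \<Rightarrow> nat \<Rightarrow> nat \<Rightarrow> nat" where
  "dc J i j = (if i < j then of_bool (2*i+2 \<in> J \<and> 2*j+2 \<notin> J)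
     else if j < i then of_bool (2*i+1 \<in> J \<and> 2*j+1 \<notin> J)
     else of_bool (2*i+1 \<in> J \<and> 2*i+2 \<in> J))"

lemma CAR_swap:
  assumes "k \<in> MM p" "l \<in> MM p" "k \<noteq> l"
  shows "ap (G p k) (ap (F p l) (ap (G p l) (ap (F p k) x))) = ap (nn p k - nn p k * nn p l) x"
proof -
  have "ap (F p k) (ap (G p l) (ap (F p l) x)) = ap (G p l) (ap (F p l) (ap (F p k) x))"
    using CAR_ap(3)[OF assms(1,2), of "ap (F p l) x"] CAR_ap(1)[OF assms(1,2), of x] assms(3) by simp
  then show ?thesis
    using CAR_ap(3)[OF assms(2,2), of "ap (F p k) x"] by (simp add: nn_def)
qed

text \<open>For \<open>i < j\<close> the highest weight relation trades the odd pair of operators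
  for the even one, for \<open>j < i\<close> conversely. Every mode that is annihilated is then
  created again, which leaves number operators.\<close>

lemma highest_QP:
  assumes x: "highest p x" and i: "i < p" and j: "j < p"
  shows "ap (G p (2*i+1)) (ap (G p (2*i+2)) (ap (F p (2*j+2)) (ap (F p (2*j+1)) x))) = ap (dd p i j) x"
proof -
  note mo = modes(1)[OF i] modes(2)[OF i] modes(1)[OF j] modes(2)[OF j]
  consider "i < j" | "j < i" | "i = j" by linarith
  then show ?thesis
  proof cases
    case 1
    have h: "ap (G p (2*i+1)) (ap (F p (2*j+1)) x) = ap (G p (2*j+2)) (ap (F p (2*i+2)) x)"
      using x i j 1 unfolding highest_def by blast
    have ne: "2*j+2 \<noteq> 2*i+1" by presburger
    have "ap (G p (2*i+1)) (ap (G p (2*i+2)) (ap (F p (2*j+2)) (ap (F p (2*j+1)) x)))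
      = - ap (G p (2*i+2)) (ap (G p (2*i+1)) (ap (F p (2*j+2)) (ap (F p (2*j+1)) x)))"
      by (rule CAR_ap(2)[OF mo(1,2)])
    also have "ap (G p (2*i+1)) (ap (F p (2*j+2)) (ap (F p (2*j+1)) x))
      = - ap (F p (2*j+2)) (ap (G p (2*i+1)) (ap (F p (2*j+1)) x))"
      using CAR_ap(3)[OF mo(4,1), of "ap (F p (2*j+1)) x"] ne by simp
    finally show ?thesis
      using CAR_swap[OF mo(2,4), of x] 1 unfolding h dd_def by simp
  next
    case 2
    have h: "ap (G p (2*j+1)) (ap (F p (2*i+1)) x) = ap (G p (2*i+2)) (ap (F p (2*j+2)) x)"
      using x i j 2 unfolding highest_def by blast
    have ne: "2*j+1 \<noteq> 2*i+2" by presburger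
    have "ap (F p (2*j+2)) (ap (F p (2*j+1)) x) = - ap (F p (2*j+1)) (ap (F p (2*j+2)) x)"
      by (rule CAR_ap(1)[OF mo(4,3)])
    moreover have "ap (G p (2*i+2)) (ap (F p (2*j+1)) (ap (F p (2*j+2)) x))
      = - ap (F p (2*j+1)) (ap (G p (2*i+2)) (ap (F p (2*j+2)) x))"
      using CAR_ap(3)[OF mo(3,2), of "ap (F p (2*j+2)) x"] ne by simp
    ultimately have "ap (G p (2*i+1)) (ap (G p (2*i+2)) (ap (F p (2*j+2)) (ap (F p (2*j+1)) x)))
      = ap (G p (2*i+1)) (ap (F p (2*j+1)) (ap (G p (2*i+2)) (ap (F p (2*j+2)) x)))"
      by simp
    also have "\<dots> = ap (dd p i j) x"
      using CAR_swap[OF mo(1,3), of x] 2 unfolding h[symmetric] dd_def by simp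
    finally show ?thesis .
  next
    case 3
    have ne: "2*i+1 \<noteq> 2*i+2" by presburger
    have "ap (F p (2*i+2)) (ap (F p (2*i+1)) x) = - ap (F p (2*i+1)) (ap (F p (2*i+2)) x)"
      by (rule CAR_ap(1)[OF mo(2,1)])
    moreover have "ap (G p (2*i+2)) (ap (F p (2*i+1)) (ap (F p (2*i+2)) x))
      = - ap (F p (2*i+1)) (ap (G p (2*i+2)) (ap (F p (2*i+2)) x))"
      using CAR_ap(3)[OF mo(1,2), of "ap (F p (2*i+2)) x"] ne by simp
    ultimately show ?thesis using 3 by (simp add: dd_def nn_def)
  qed
qed

lemma nn_bv: "k \<in> MM p \<Longrightarrow> J \<subseteq> MM p \<Longrightarrow> ap (nn p k) (bv p J) = (if k \<in> J then bv p J else 0)"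
  unfolding nn_def by (simp add: n_bv)

lemma dd_bv:
  assumes i: "i < p" and j: "j < p" and J: "J \<subseteq> MM p"
  shows "ap (dd p i j) (bv p J) = cscale (of_nat (dc J i j)) (bv p J)"
  using nn_bv[OF modes(1)[OF i] J] nn_bv[OF modes(2)[OF i] J] nn_bv[OF modes(1)[OF j] J] nn_bv[OF modes(2)[OF j] J]
  by (auto simp: dd_def dc_def)

text \<open>The eigenvalue of the operator \<open>T\<close> of \<open>highest_span\<close>; the
  second sum encodes the long roots. Being a sum of natural numbers, it vanishes only if each term
  does.\<close>

definition defect :: "nat \<Rightarrow> nat set \<Rightarrow> nat" where
  "defect p J = (\<Sum>i<p. \<Sum>j<p. dc J i j) + (\<Sum>i<p. of_bool (2*i+2 \<in> J \<and> 2*i+1 \<notin> J))"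

text \<open>On a highest weight vector the terms of Q P become commuting projections, all diagonal
  in the Fock basis; so a primitive highest weight vector only involves basis vectors without defect.\<close>

lemma highest_span:
  assumes x: "x \<in> cell0 p s" and hw: "highest p x"
  shows "x \<in> cv.span (bv p ` {J. J \<subseteq> MM p \<and> card J = s \<and> defect p J = 0})"
proof -
  define T where "T = (\<Sum>i<p. \<Sum>j<p. dd p i j) + (\<Sum>i<p. nn p (2*i+2) - nn p (2*i+2) * nn p (2*i+1))"
  have "ap (\<Sum>i<p. \<Sum>j<p. dd p i j) x = (\<Sum>i<p. \<Sum>j<p. ap (G p (2*i+1)) (ap (G p (2*i+2)) (ap (F p (2*j+2)) (ap (F p (2*j+1)) x))))"
    unfolding ap_op_sum by (intro sum.cong refl) (simp add: highest_QP[OF hw])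
  also have "\<dots> = ap (QO p) (ap (PO p) x)"
    unfolding QO_def PO_def by (simp add: ap_op_sum ap_sum) (rule sum.swap)
  also have "\<dots> = 0" using x by (simp add: cell0_eq)
  finally have 1: "ap (\<Sum>i<p. \<Sum>j<p. dd p i j) x = 0" .
  have 2: "ap (nn p (2*i+2) - nn p (2*i+2) * nn p (2*i+1)) x = 0" if i: "i < p" for i
  proof -
    have "2*i+2 \<noteq> 2*i+1" by presburger
    moreover have "ap (G p (2*i+1)) (ap (F p (2*i+2)) x) = 0" using hw i unfolding highest_def by blast
    ultimately show ?thesis using CAR_swap[OF modes(2)[OF i] modes(1)[OF i], of x] by simp
  qed
  have Tx: "ap T x = cscale 0 x"
    unfolding T_def using 1 2 by (simp add: ap_op_sum del: ap_op(4))
  have Tb: "ap T (bv p J) = cscale (of_nat (defect p J)) (bv p J)" if "J \<in> {J. J \<subseteq> MM p \<and> card J = s}" for J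
  proof -
    have J: "J \<subseteq> MM p" using that by simp
    have a: "ap (nn p (2*i+2) - nn p (2*i+2) * nn p (2*i+1)) (bv p J)
      = cscale (of_nat (of_bool (2*i+2 \<in> J \<and> 2*i+1 \<notin> J))) (bv p J)" if i: "i < p" for i
      using nn_bv[OF modes(1)[OF i] J] nn_bv[OF modes(2)[OF i] J] by auto
    have "ap T (bv p J) = (\<Sum>i<p. \<Sum>j<p. cscale (of_nat (dc J i j)) (bv p J))
      + (\<Sum>i<p. cscale (of_nat (of_bool (2*i+2 \<in> J \<and> 2*i+1 \<notin> J))) (bv p J))"
      unfolding T_def ap_op(3) ap_op_sum
      by (intro arg_cong2[where f = "(+)"] sum.cong refl) (simp_all add: dd_bv[OF _ _ J] a del: ap_op(4))
    then show ?thesis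
      unfolding defect_def by (simp only: cv.scale_sum_left[symmetric] of_nat_add of_nat_sum cv.scale_left_distrib)
  qed
  have fin: "finite {J. J \<subseteq> MM p \<and> card J = s}"
    by (rule finite_subset[of _ "Pow (MM p)"]) auto
  have "x \<in> cv.span (bv p ` {J. J \<subseteq> MM p \<and> card J = s})"
    using x unfolding cell0_eq Sdeg_eq by blast
  from eigen_filter[OF fin this Tb Tx]
  have "x \<in> cv.span (bv p ` {J \<in> {J. J \<subseteq> MM p \<and> card J = s}. of_nat (defect p J) = (0::complex)})" by blast
  moreover have "{J \<in> {J. J \<subseteq> MM p \<and> card J = s}. of_nat (defect p J) = (0::complex)} = {J. J \<subseteq> MM p \<and> card J = s \<and> defect p J = 0}"
    by auto
  ultimately show ?thesis by simp
qed

text \<open>Without defect there are no even modes, and the odd ones form an initial segment; hence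
  \<open>J\<close> is {1, 3, ..., 2k-1} with \<open>k = card J\<close>.\<close>

lemma defect_unique:
  assumes J: "J \<subseteq> MM p" "defect p J = 0" and K: "K \<subseteq> MM p" "defect p K = 0" and card: "card J = card K"
  shows "J = K"
proof -
  have props: "\<And>i. i < p \<Longrightarrow> 2*i+2 \<notin> L" "\<And>i j. i < p \<Longrightarrow> j < i \<Longrightarrow> 2*i+1 \<in> L \<Longrightarrow> 2*j+1 \<in> L"
    if "defect p L = 0" for L
  proof -
    have z: "dc L i j = 0" if "i < p" "j < p" for i j
      using \<open>defect p L = 0\<close> that by (simp add: defect_def)
    have z': "\<not> (2*i+2 \<in> L \<and> 2*i+1 \<notin> L)" if "i < p" for i
      using \<open>defect p L = 0\<close> that by (auto simp: defect_def)
    show "2*i+2 \<notin> L" if "i < p" for i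
      using z[OF that that] z'[OF that] by (auto simp: dc_def)
    show "2*j+1 \<in> L" if "i < p" "j < i" "2*i+1 \<in> L" for i j
    proof -
      have "j < p" using that by simp
      then show ?thesis using z[OF that(1), of j] that by (auto simp: dc_def split: if_splits)
    qed
  qed
  have form: "\<exists>i<p. k = 2*i+1" if "L \<subseteq> MM p" "defect p L = 0" "k \<in> L" for L k
  proof (cases "even k")
    case True
    have k: "1 \<le> k" "k \<le> 2*p" using that by auto
    obtain l where "k = 2 * l" using True by (rule evenE)
    then have "k = 2*(l-1)+2" "l-1 < p" using k by auto
    then show ?thesis using props(1)[OF that(2)] that(3) by blast
  next
    case False
    then obtain i where "k = 2*i+1" by (rule oddE)
    moreover have "k \<le> 2*p" using that by auto
    ultimately show ?thesis by (intro exI[of _ i]) auto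
  qed
  have "J \<subseteq> K \<or> K \<subseteq> J"
  proof (rule ccontr)
    assume "\<not> (J \<subseteq> K \<or> K \<subseteq> J)"
    then obtain x y where xy: "x \<in> J" "x \<notin> K" "y \<in> K" "y \<notin> J" by blast
    obtain i where i: "i < p" "x = 2*i+1" using form[OF J xy(1)] by blast
    obtain j where j: "j < p" "y = 2*j+1" using form[OF K xy(3)] by blast
    have "i < j \<or> j < i \<or> i = j" by linarith
    then show False
      using props(2)[OF J(2) i(1), of j] props(2)[OF K(2) j(1), of i] xy i j by auto
  qed
  then show ?thesis
    using card card_subset_eq finite_modes[OF J(1)] finite_modes[OF K(1)] by metis
qed

text \<open>A proper nonzero submodule and its orthogonal complement would both contain the only
  possible highest weight line. The zero alternative covers degrees without primitive
  vectors.\<close>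

lemma cell0_irred: "cell0 p s = {0} \<or> irred p (spin_act p) (cell0 p s)"
proof (rule disjCI)
  assume "\<not> irred p (spin_act p) (cell0 p s)"
  show "cell0 p s = {0}"
  proof (rule ccontr)
    assume nz: "cell0 p s \<noteq> {0}"
    interpret sm: skew_module "Zc (4*p)" p "spin_act p" by (rule skew_module_spin)
    have "\<not> (\<forall>W. W \<subseteq> cell0 p s \<and> submodule p (spin_act p) W \<longrightarrow> W = {0} \<or> W = cell0 p s)"
      using \<open>\<not> irred p (spin_act p) (cell0 p s)\<close> nz submodule_cell0[of p s] unfolding irred_iff by simp
    then obtain W where W: "W \<subseteq> cell0 p s" "submodule p (spin_act p) W" "W \<noteq> {0}" "W \<noteq> cell0 p s"
      by blast
    have cS: "cell0 p s \<subseteq> Sall p" using Sdeg_Sall unfolding cell0_eq by blast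
    have cZ: "cell0 p s \<subseteq> supported (Zc (4*p))" using cS Sall_supported by blast
    define W' where "W' = cell0 p s \<inter> orth (Zc (4*p)) W"
    have W': "submodule p (spin_act p) W'"
      unfolding W'_def by (rule submodule_Int[OF submodule_cell0 sm.submodule_orth[OF W(2)]])
    have "W' \<noteq> {0}"
    proof
      assume z: "W' = {0}"
      have "x \<in> W" if x: "x \<in> cell0 p s" for x
      proof -
        obtain v w where vw: "v \<in> W" "w \<in> cell0 p s" "w \<in> orth (Zc (4*p)) W" "x = v + w"
          by (rule orth_decomp[OF sm.finZ submoduleD(1)[OF W(2)] submoduleD(1)[OF submodule_cell0] W(1) x])
        have "w \<in> W'" unfolding W'_def using vw(2,3) by (rule IntI)
        then have "w = 0" unfolding z by simp
        then show ?thesis using vw(1) unfolding vw(4) by simp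
      qed
      then show False using W(1,4) by blast
    qed
    have "W \<subseteq> Sall p" using W(1) cS by (rule subset_trans)
    then obtain x where x: "x \<in> W" "x \<noteq> 0" "highest p x"
      using ex_highest[OF W(2) _ W(3)] by blast
    have "W' \<subseteq> Sall p" using cS unfolding W'_def by blast
    then obtain y where y: "y \<in> W'" "y \<noteq> 0" "highest p y"
      using ex_highest[OF W' _ \<open>W' \<noteq> {0}\<close>] by blast
    let ?S = "{J. J \<subseteq> MM p \<and> card J = s \<and> defect p J = 0}"
    have "x \<in> cell0 p s" using x(1) W(1) by blast
    then have xs: "x \<in> cv.span (bv p ` ?S)" using x(3) by (rule highest_span)
    have "y \<in> cell0 p s" using y(1) unfolding W'_def by blast
    then have ys: "y \<in> cv.span (bv p ` ?S)" using y(3) by (rule highest_span)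
    have "?S \<noteq> {}"
    proof
      assume "?S = {}"
      then have "x \<in> cv.span (bv p ` {})" using xs by (simp only:)
      then show False using x(2) by simp
    qed
    then obtain J where J: "J \<in> ?S" by blast
    have "?S = {J}"
    proof (rule equalityI)
      show "?S \<subseteq> {J}"
      proof
        fix K assume "K \<in> ?S"
        then have "K = J" using J by (intro defect_unique[of K p J]) simp_all
        then show "K \<in> {J}" by simp
      qed
      show "{J} \<subseteq> ?S" using J by simp
    qed
    then have im: "bv p ` ?S = {bv p J}" by (simp only: image_insert image_empty)
    have xs': "x \<in> cv.span {bv p J}" and ys': "y \<in> cv.span {bv p J}"
      using xs ys unfolding im .
    obtain c where c: "x = cscale c (bv p J)" using xs' unfolding cv.span_singleton by blast
    obtain d where d: "y = cscale d (bv p J)" using ys' unfolding cv.span_singleton by blast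
    have d0: "d \<noteq> 0"
    proof
      assume "d = 0"
      then have "y = 0" unfolding d by simp
      then show False using y(2) by blast
    qed
    have "x = cscale (c / d) y" unfolding c d using d0 by simp
    moreover have "cscale (c / d) y \<in> W'" by (rule cv.subspace_scale[OF submoduleD(1)[OF W'] y(1)])
    ultimately have "x \<in> orth (Zc (4*p)) W" unfolding W'_def by blast
    moreover have "W \<subseteq> supported (Zc (4*p))" using W(1) cZ by (rule subset_trans)
    ultimately show False using orth_Int[OF sm.finZ _ x(1)] x(2) by blast
  qed
qed

section \<open>Tensors with the vector representation\<close>

abbreviation Zt :: "nat \<Rightarrow> (nat \<times> nat set) set" where "Zt p \<equiv> NN p \<times> Zc (4*p)"

definition sl :: "tens \<Rightarrow> nat \<Rightarrow> cl" where "sl t a = (\<lambda>C. t (a, C))"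

lemma sl_simps [simp]: "sl 0 a = 0" "sl (s + t) a = sl s a + sl t a" "sl (s - t) a = sl s a - sl t a"
  "sl (cscale c t) a = cscale c (sl t a)"
  by (simp_all add: sl_def fun_eq_iff pointwise)

lemma sl_sum: "sl (\<Sum>i\<in>I. t i) a = (\<Sum>i\<in>I. sl (t i) a)"
  by (simp add: sl_def fun_eq_iff pointwise)

lemma tens_eqI:
  assumes "\<And>a. sl s a = sl t a"
  shows "s = t"
proof
  fix z show "s z = t z"
    using fun_cong[OF assms[of "fst z"], of "snd z"] by (simp add: sl_def)
qed

lemma sl_tact: "sl (tact p A t) a = (\<Sum>b\<in>NN p. cscale (of_real (A a b)) (sl t b)) + ap (spo p A) (sl t a)"
  by (rule ext) (simp add: sl_def tact_def pointwise flip: spin_act_eq)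

lemma ip_slices: "ip (Zt p) s t = (\<Sum>a\<in>NN p. ip (Zc (4*p)) (sl s a) (sl t a))"
  unfolding ip_def sl_def by (simp add: sum.cartesian_product case_prod_beta)

lemma tact_skew:
  assumes A: "A \<in> sp_alg p"
  shows "ip (Zt p) (tact p A s) t = - ip (Zt p) s (tact p A t)"
proof -
  let ?ip = "ip (Zc (4*p))"
  have "(\<Sum>a\<in>NN p. \<Sum>b\<in>NN p. of_real (A a b) * ?ip (sl s b) (sl t a))
    = (\<Sum>b\<in>NN p. \<Sum>a\<in>NN p. of_real (A a b) * ?ip (sl s b) (sl t a))"
    by (rule sum.swap)
  also have "\<dots> = - (\<Sum>b\<in>NN p. \<Sum>a\<in>NN p. of_real (A b a) * ?ip (sl s b) (sl t a))"
    unfolding sum_negf[symmetric]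
  proof (intro sum.cong refl)
    fix a b
    have t: "A a b = - A b a" by (rule sp_algD(1)[OF A])
    show "of_real (A a b) * ?ip (sl s b) (sl t a) = - (of_real (A b a) * ?ip (sl s b) (sl t a))"
      unfolding t by simp
  qed
  finally show ?thesis
    unfolding ip_slices sl_tact
    by (simp add: ip_sum_left ip_sum_right sum.distrib sum_subtractf spo_skew[OF A] sum_negf)
qed

lemma tensor_module: "tensor_skew_module (Zt p) p"
proof
  show "finite (Zt p)" by auto
  show "tact p A (x + y) = tact p A x + tact p A y" for A x y
    by (rule tens_eqI) (simp add: sl_tact cv.scale_right_distrib sum.distrib algebra_simps)
  show "tact p A (cscale c x) = cscale c (tact p A x)" for A c x
    by (rule tens_eqI) (simp add: sl_tact cv.scale_right_distrib cv.scale_sum_right mult.commute)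
  show "ip (Zt p) (tact p A x) y = - ip (Zt p) x (tact p A y)" if "A \<in> sp_alg p" for A x y
    using that by (rule tact_skew)
qed

definition tp :: "(nat \<Rightarrow> complex) \<Rightarrow> cl \<Rightarrow> tens" where "tp w u = (\<lambda>(a, B). w a * u B)"

lemma sl_tp [simp]: "sl (tp w u) a = cscale (w a) u"
  by (simp add: sl_def tp_def fun_eq_iff pointwise)

lemma tensor_eq: "tensor p W U = cv.span {tp w u | w u. w \<in> W \<and> u \<in> U}"
  unfolding tensor_def cspan_eq tp_def ..

lemma subspace_tensor: "cv.subspace (tensor p W U)"
  unfolding tensor_eq by simp

lemma tensor_induct:
  assumes "t \<in> tensor p W U" "cv.subspace S" "\<And>w u. w \<in> W \<Longrightarrow> u \<in> U \<Longrightarrow> tp w u \<in> S"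
  shows "t \<in> S"
proof -
  have "{tp w u | w u. w \<in> W \<and> u \<in> U} \<subseteq> S" using assms(3) by blast
  then show ?thesis using cv.span_minimal[OF _ assms(2)] assms(1) unfolding tensor_eq by blast
qed

lemma tensor_slice:
  assumes "t \<in> tensor p W U" "cv.subspace U"
  shows "sl t a \<in> U"
proof -
  have "t \<in> {t. sl t a \<in> U}"
    by (rule tensor_induct[OF assms(1)])
      (use assms(2) in \<open>auto simp: cv.subspace_def\<close>)
  then show ?thesis by simp
qed

lemma tensor_column:
  assumes "t \<in> tensor p W U" "cv.subspace W"
  shows "(\<lambda>a. t (a, B)) \<in> W"
proof -
  have "t \<in> {t. (\<lambda>a. t (a, B)) \<in> W}"
  proof (rule tensor_induct[OF assms(1)])
    have "(\<lambda>a. (s + t) (a, B)) = (\<lambda>a. s (a, B)) + (\<lambda>a. t (a, B))"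
      "(\<lambda>a. (cscale c t) (a, B)) = cscale c (\<lambda>a. t (a, B))" "(\<lambda>a. (0::tens) (a, B)) = 0" for s t :: tens and c
      by (simp_all add: fun_eq_iff pointwise)
    then show "cv.subspace {t. (\<lambda>a. t (a, B)) \<in> W}"
      using assms(2) by (simp add: cv.subspace_def)
    fix w and u :: cl assume "w \<in> W"
    moreover have "(\<lambda>a. tp w u (a, B)) = cscale (u B) w"
      by (simp add: tp_def fun_eq_iff pointwise)
    ultimately show "tp w u \<in> {t. (\<lambda>a. t (a, B)) \<in> W}"
      using assms(2) by (simp add: cv.subspace_scale)
  qed
  then show ?thesis by simp
qed

lemma tensor_supported:
  assumes "W \<subseteq> Vc p" "U \<subseteq> supported (Zc (4*p))"
  shows "tensor p W U \<subseteq> supported (Zt p)"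
proof
  fix t assume "t \<in> tensor p W U"
  then show "t \<in> supported (Zt p)"
  proof (rule tensor_induct[OF _ subspace_supported])
    fix w u assume "w \<in> W" "u \<in> U"
    then have "w \<in> Vc p" "u \<in> supported (Zc (4*p))" using assms by auto
    then show "tp w u \<in> supported (Zt p)" unfolding Vc_def supported_def tp_def by auto
  qed
qed

lemma submodule_tensor:
  assumes W: "submodule p (vact p) W" and U: "submodule p (spin_act p) U"
  shows "submodule p (tact p) (tensor p W U)"
proof (rule submoduleI[OF subspace_tensor])
  interpret tensor_skew_module "Zt p" p by (rule tensor_module)
  fix A t assume A: "A \<in> sp_alg p" and t: "t \<in> tensor p W U"
  have "t \<in> {t. tact p A t \<in> tensor p W U}"
  proof (rule tensor_induct[OF t])
    show "cv.subspace {t. tact p A t \<in> tensor p W U}"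
      using subspace_tensor[of p W U] by (simp add: cv.subspace_def act_0 act_add act_scale)
    fix w u assume wu: "w \<in> W" "u \<in> U"
    have "tact p A (tp w u) = tp (vact p A w) u + tp w (spin_act p A u)"
      by (rule tens_eqI) (simp add: sl_tact spin_act_eq vact_def cv.scale_sum_left)
    moreover have "tp (vact p A w) u \<in> tensor p W U" "tp w (spin_act p A u) \<in> tensor p W U"
      using submoduleD(2)[OF W A wu(1)] submoduleD(2)[OF U A wu(2)] wu
      unfolding tensor_eq by (auto intro!: cv.span_base)
    ultimately show "tp w u \<in> {t. tact p A t \<in> tensor p W U}"
      using cv.subspace_add[OF subspace_tensor] by simp
  qed
  then show "tact p A t \<in> tensor p W U" by simp
qed

lemma tensor_Int:
  assumes "cv.subspace W1" "cv.subspace W2" "W1 \<inter> W2 = {0}"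
  shows "tensor p W1 U \<inter> tensor p W2 U = {0}"
proof -
  have "t = 0" if "t \<in> tensor p W1 U" "t \<in> tensor p W2 U" for t
  proof
    fix z :: "nat \<times> nat set"
    have "(\<lambda>a. t (a, snd z)) \<in> W1 \<inter> W2"
      using tensor_column that assms(1,2) by blast
    then have "(\<lambda>a. t (a, snd z)) = 0" unfolding assms(3) by simp
    from fun_cong[OF this, of "fst z"] show "t z = 0 z" by (simp add: pointwise)
  qed
  then show ?thesis using cv.subspace_0[OF subspace_tensor] by blast
qed

lemma tensor_sum_decomp:
  assumes W: "{(\<lambda>a. w1 a + w2 a) | w1 w2. w1 \<in> W1 \<and> w2 \<in> W2} = Vc p"
    and t: "\<And>a. a \<in> NN p \<Longrightarrow> sl t a \<in> U" "\<And>a. a \<notin> NN p \<Longrightarrow> sl t a = 0"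
  obtains t1 t2 where "t1 \<in> tensor p W1 U" "t2 \<in> tensor p W2 U" "t = t1 + t2"
proof -
  have sums: "\<exists>w1 w2. w1 \<in> W1 \<and> w2 \<in> W2 \<and> (\<lambda>i. if i = a then 1 else 0) = w1 + w2" if "a \<in> NN p" for a
  proof -
    have "(\<lambda>i. if i = a then 1 else 0) \<in> Vc p" using that by (auto simp: Vc_def)
    then show ?thesis unfolding W[symmetric] plus_fun_def by blast
  qed
  then obtain w1 w2 where w: "\<And>a. a \<in> NN p \<Longrightarrow> w1 a \<in> W1" "\<And>a. a \<in> NN p \<Longrightarrow> w2 a \<in> W2"
    "\<And>a. a \<in> NN p \<Longrightarrow> (\<lambda>i. if i = a then 1 else 0) = w1 a + w2 a" by metis
  have "t = (\<Sum>a\<in>NN p. tp (\<lambda>i. if i = a then 1 else 0) (sl t a))"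
  proof (rule tens_eqI)
    fix c
    have "sl (\<Sum>a\<in>NN p. tp (\<lambda>i. if i = a then 1 else 0) (sl t a)) c = (\<Sum>a\<in>NN p. if a = c then sl t c else 0)"
      unfolding sl_sum by (intro sum.cong refl) auto
    also have "\<dots> = sl t c" using t(2)[of c] by (simp add: sum.delta')
    finally show "sl t c = sl (\<Sum>a\<in>NN p. tp (\<lambda>i. if i = a then 1 else 0) (sl t a)) c" by simp
  qed
  also have "\<dots> = (\<Sum>a\<in>NN p. tp (w1 a) (sl t a) + tp (w2 a) (sl t a))"
  proof (intro sum.cong refl)
    fix a assume "a \<in> NN p"
    show "tp (\<lambda>i. if i = a then 1 else 0) (sl t a) = tp (w1 a) (sl t a) + tp (w2 a) (sl t a)"
      unfolding w(3)[OF \<open>a \<in> NN p\<close>] by (rule tens_eqI) (simp add: pointwise cv.scale_left_distrib)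
  qed
  also have "\<dots> = (\<Sum>a\<in>NN p. tp (w1 a) (sl t a)) + (\<Sum>a\<in>NN p. tp (w2 a) (sl t a))"
    by (rule sum.distrib)
  finally have "t = (\<Sum>a\<in>NN p. tp (w1 a) (sl t a)) + (\<Sum>a\<in>NN p. tp (w2 a) (sl t a))" .
  moreover have "(\<Sum>a\<in>NN p. tp (w1 a) (sl t a)) \<in> tensor p W1 U"
  proof (rule cv.subspace_sum[OF subspace_tensor])
    fix a assume "a \<in> NN p"
    then show "tp (w1 a) (sl t a) \<in> tensor p W1 U"
      unfolding tensor_eq using w(1) t(1) by (intro cv.span_base) blast
  qed
  moreover have "(\<Sum>a\<in>NN p. tp (w2 a) (sl t a)) \<in> tensor p W2 U"
  proof (rule cv.subspace_sum[OF subspace_tensor])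
    fix a assume "a \<in> NN p"
    then show "tp (w2 a) (sl t a) \<in> tensor p W2 U"
      unfolding tensor_eq using w(2) t(1) by (intro cv.span_base) blast
  qed
  ultimately show ?thesis using that by blast
qed

section \<open>The Dirac symbols\<close>

text \<open>The symbol of the Dirac operator of unit \<open>u\<close>, that is, Clifford contraction
  with the rotated vectors; see \<open>dirac_mu\<close>.\<close>

definition mu :: "nat \<Rightarrow> nat \<Rightarrow> tens \<Rightarrow> cl" where
  "mu p u t = (\<Sum>c\<in>NN p. ap (Ue p u c) (sl t c))"

lemma mu_simps [simp]: "mu p u 0 = 0" "mu p u (s + t) = mu p u s + mu p u t" "mu p u (cscale c t) = cscale c (mu p u t)"
  by (simp_all add: mu_def sum.distrib cv.scale_sum_right)

lemma mu_tact:
  assumes A: "A \<in> sp_alg p" and u: "u < 4"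
  shows "mu p u (tact p A t) = spin_act p A (mu p u t)"
proof -
  have "ap (spo p A) (ap (Ue p u c) x) = ap (Ue p u c) (ap (spo p A) x) + (\<Sum>d\<in>NN p. cscale (of_real (A d c)) (ap (Ue p u d) x))"
    if "c \<in> NN p" for c x
    using spo_comm_Ue[OF A that u, THEN arg_cong[where f = "\<lambda>T. ap T x"]] by (simp add: ap_op_sum)
  then have "spin_act p A (mu p u t) = (\<Sum>c\<in>NN p. ap (Ue p u c) (ap (spo p A) (sl t c)))
      + (\<Sum>c\<in>NN p. \<Sum>d\<in>NN p. cscale (of_real (A d c)) (ap (Ue p u d) (sl t c)))"
    unfolding spin_act_eq mu_def by (simp add: ap_sum sum.distrib)
  also have "(\<Sum>c\<in>NN p. \<Sum>d\<in>NN p. cscale (of_real (A d c)) (ap (Ue p u d) (sl t c)))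
    = (\<Sum>d\<in>NN p. \<Sum>c\<in>NN p. cscale (of_real (A d c)) (ap (Ue p u d) (sl t c)))"
    by (rule sum.swap)
  finally show ?thesis
    unfolding mu_def sl_tact by (simp add: ap_sum sum.distrib add.commute)
qed

section \<open>The Casimir operator of the tensor module and the symbols\<close>

definition casT :: "nat \<Rightarrow> tens \<Rightarrow> tens" where
  "casT p t = (\<Sum>a\<in>NN p. \<Sum>b\<in>NN p. tact p (Ag p a b) (tact p (Ag p a b) t))"

lemma sum_rotate: "(\<Sum>a\<in>A. \<Sum>b\<in>B. \<Sum>d\<in>D. h a b d) = (\<Sum>d\<in>D. \<Sum>a\<in>A. \<Sum>b\<in>B. h a b d)"
proof -
  have "(\<Sum>a\<in>A. \<Sum>b\<in>B. \<Sum>d\<in>D. h a b d) = (\<Sum>a\<in>A. \<Sum>d\<in>D. \<Sum>b\<in>B. h a b d)"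
    by (rule sum.cong[OF refl], rule sum.swap)
  also have "\<dots> = (\<Sum>d\<in>D. \<Sum>a\<in>A. \<Sum>b\<in>B. h a b d)" by (rule sum.swap)
  finally show ?thesis .
qed

text \<open>The square of a sum action: Casimir of the vectors, Casimir of the spinors and twice the
  mixed term. The first gives \<open>-(2p+1)\<close>; by the frame property and
  \<open>spo_Ag\<close> the mixed term gives the symbols with factor 4 * (-1/8) and another -2, so
  the constant is \<open>-(2p+3)\<close>.\<close>

lemma sl_casT:
  assumes c: "c \<in> NN p"
  shows "sl (casT p t) c = cscale (- (2 * of_nat p + 3)) (sl t c) + ap (cas p) (sl t c)
    - cscale (1/2) (\<Sum>u<4. ap (Ue p u c) (mu p u t))"
proof -
  let ?N = "NN p"
  have one: "sl (tact p A (tact p A t)) c = (\<Sum>d\<in>?N. \<Sum>e\<in>?N. cscale (of_real (A c d * A d e)) (sl t e))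
      + (\<Sum>d\<in>?N. cscale 2 (cscale (of_real (A c d)) (ap (spo p A) (sl t d)))) + ap (spo p A * spo p A) (sl t c)" for A
    unfolding sl_tact
    by (rule ext) (simp add: ap_sum, simp add: op_pointwise sum.distrib sum_distrib_left algebra_simps)
  have "sl (casT p t) c = (\<Sum>a\<in>?N. \<Sum>b\<in>?N. \<Sum>d\<in>?N. \<Sum>e\<in>?N. cscale (of_real (Ag p a b c d * Ag p a b d e)) (sl t e))
      + (\<Sum>a\<in>?N. \<Sum>b\<in>?N. \<Sum>d\<in>?N. cscale 2 (ap (Ag p a b c d *\<^sub>R spo p (Ag p a b)) (sl t d)))
      + ap (cas p) (sl t c)"
    unfolding casT_def sl_sum one cas_def ap_op_sum sum.distrib by simp
  also have "(\<Sum>a\<in>?N. \<Sum>b\<in>?N. \<Sum>d\<in>?N. \<Sum>e\<in>?N. cscale (of_real (Ag p a b c d * Ag p a b d e)) (sl t e))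
    = (\<Sum>e\<in>?N. \<Sum>d\<in>?N. \<Sum>a\<in>?N. \<Sum>b\<in>?N. cscale (of_real (Ag p a b c d * Ag p a b d e)) (sl t e))"
  proof -
    have "(\<Sum>a\<in>?N. \<Sum>b\<in>?N. \<Sum>d\<in>?N. \<Sum>e\<in>?N. h a b d e) = (\<Sum>e\<in>?N. \<Sum>d\<in>?N. \<Sum>a\<in>?N. \<Sum>b\<in>?N. h a b d e)" for h :: "nat \<Rightarrow> nat \<Rightarrow> nat \<Rightarrow> nat \<Rightarrow> cl"
    proof -
      have "(\<Sum>a\<in>?N. \<Sum>b\<in>?N. \<Sum>d\<in>?N. \<Sum>e\<in>?N. h a b d e) = (\<Sum>d\<in>?N. \<Sum>a\<in>?N. \<Sum>b\<in>?N. \<Sum>e\<in>?N. h a b d e)"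
        by (rule sum_rotate)
      also have "\<dots> = (\<Sum>d\<in>?N. \<Sum>e\<in>?N. \<Sum>a\<in>?N. \<Sum>b\<in>?N. h a b d e)"
        by (rule sum.cong[OF refl], rule sum_rotate)
      also have "\<dots> = (\<Sum>e\<in>?N. \<Sum>d\<in>?N. \<Sum>a\<in>?N. \<Sum>b\<in>?N. h a b d e)" by (rule sum.swap)
      finally show ?thesis .
    qed
    then show ?thesis .
  qed
  also have "\<dots> = (\<Sum>e\<in>?N. cscale (of_real (2 * (\<Sum>d\<in>?N. Ag p c d d e))) (sl t e))"
  proof (rule sum.cong[OF refl])
    fix e assume e: "e \<in> ?N"
    have "(\<Sum>d\<in>?N. \<Sum>a\<in>?N. \<Sum>b\<in>?N. cscale (of_real (Ag p a b c d * Ag p a b d e)) (sl t e))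
      = cscale (of_real (\<Sum>d\<in>?N. \<Sum>a\<in>?N. \<Sum>b\<in>?N. Ag p a b c d * Ag p a b d e)) (sl t e)"
      by (simp only: of_real_sum cv.scale_sum_left)
    also have "(\<Sum>d\<in>?N. \<Sum>a\<in>?N. \<Sum>b\<in>?N. Ag p a b c d * Ag p a b d e) = (\<Sum>d\<in>?N. 2 * Ag p c d d e)"
      by (intro sum.cong refl) (simp only: Ag_reproducing[OF c _ _ e])
    finally show "(\<Sum>d\<in>?N. \<Sum>a\<in>?N. \<Sum>b\<in>?N. cscale (of_real (Ag p a b c d * Ag p a b d e)) (sl t e))
      = cscale (of_real (2 * (\<Sum>d\<in>?N. Ag p c d d e))) (sl t e)"
      by (simp only: sum_distrib_left)
  qed
  also have "\<dots> = (\<Sum>e\<in>?N. if e = c then cscale (- (2 * of_nat p + 1)) (sl t c) else 0)"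
  proof (rule sum.cong[OF refl])
    fix e assume e: "e \<in> ?N"
    have eq: "complex_of_real (2 * (\<Sum>d\<in>?N. Ag p c d d e)) = (if e = c then - (2 * of_nat p + 1) else 0)"
      unfolding Ag_trace[OF c e] by simp
    show "cscale (of_real (2 * (\<Sum>d\<in>?N. Ag p c d d e))) (sl t e) = (if e = c then cscale (- (2 * of_nat p + 1)) (sl t c) else 0)"
      unfolding eq by (cases "e = c") simp_all
  qed
  also have "\<dots> = cscale (- (2 * of_nat p + 1)) (sl t c)" using c by simp
  also have "(\<Sum>a\<in>?N. \<Sum>b\<in>?N. \<Sum>d\<in>?N. cscale 2 (ap (Ag p a b c d *\<^sub>R spo p (Ag p a b)) (sl t d)))
    = (\<Sum>d\<in>?N. cscale 2 (ap (\<Sum>a\<in>?N. \<Sum>b\<in>?N. Ag p a b c d *\<^sub>R spo p (Ag p a b)) (sl t d)))"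
  proof -
    show ?thesis unfolding ap_op_sum cv.scale_sum_right by (rule sum_rotate)
  qed
  also have "\<dots> = (\<Sum>d\<in>?N. cscale 4 (ap (spo p (Ag p c d)) (sl t d)))"
    by (intro sum.cong refl) (simp add: spo_Ag_reproducing[OF c])
  also have "\<dots> = (\<Sum>d\<in>?N. (\<Sum>u<4. cscale (-1/2) (ap (Ue p u c) (ap (Ue p u d) (sl t d)))) + (if c = d then cscale (-2) (sl t c) else 0))"
  proof (rule sum.cong[OF refl])
    fix d assume d: "d \<in> ?N"
    show "cscale 4 (ap (spo p (Ag p c d)) (sl t d))
      = (\<Sum>u<4. cscale (-1/2) (ap (Ue p u c) (ap (Ue p u d) (sl t d)))) + (if c = d then cscale (-2) (sl t c) else 0)"
      unfolding spo_Ag[OF c d] sum4 by (rule ext) (simp add: op_pointwise algebra_simps)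
  qed
  also have "\<dots> = (\<Sum>d\<in>?N. \<Sum>u<4. cscale (-1/2) (ap (Ue p u c) (ap (Ue p u d) (sl t d)))) + cscale (-2) (sl t c)"
    unfolding sum.distrib using c by simp
  also have "(\<Sum>d\<in>?N. \<Sum>u<4. cscale (-1/2) (ap (Ue p u c) (ap (Ue p u d) (sl t d))))
    = (\<Sum>u<4. cscale (-1/2) (ap (Ue p u c) (mu p u t)))"
    unfolding mu_def ap_sum cv.scale_sum_right by (rule sum.swap)
  finally show ?thesis
    unfolding sum4 by (simp only:) (rule ext, simp add: op_pointwise algebra_simps)
qed

lemma Ue_skew:
  assumes "c \<in> NN p"
  shows "ip (Zc (4*p)) (ap (Ue p u c) x) y = - ip (Zc (4*p)) x (ap (Ue p u c) y)"
  unfolding Ue_def by (simp add: E_skew[OF pm_range[OF assms]])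

text \<open>Since vectors act skewly, the left side is a sum of squared norms up to sign; this turns
  the eigenvalue equation into the vanishing of every symbol.\<close>

lemma symbol_norm:
  "(\<Sum>c\<in>NN p. ip (Zc (4*p)) (\<Sum>u<4. ap (Ue p u c) (mu p u t)) (sl t c)) = - (\<Sum>u<4. ip (Zc (4*p)) (mu p u t) (mu p u t))"
proof -
  have "(\<Sum>c\<in>NN p. ip (Zc (4*p)) (\<Sum>u<4. ap (Ue p u c) (mu p u t)) (sl t c))
    = (\<Sum>c\<in>NN p. \<Sum>u<4. - ip (Zc (4*p)) (mu p u t) (ap (Ue p u c) (sl t c)))"
    unfolding ip_sum_left by (intro sum.cong refl) (simp only: Ue_skew)
  also have "\<dots> = (\<Sum>u<4. \<Sum>c\<in>NN p. - ip (Zc (4*p)) (mu p u t) (ap (Ue p u c) (sl t c)))"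
    by (rule sum.swap)
  also have "\<dots> = (\<Sum>u<4. - ip (Zc (4*p)) (mu p u t) (mu p u t))"
    by (simp only: sum_negf ip_sum_right[symmetric] mu_def[symmetric])
  finally show ?thesis by (simp only: sum_negf)
qed

text \<open>On tensors over an eigenspace of the Casimir operator of the spin module, the common
  kernel of the four Dirac symbols is an eigenspace of the Casimir operator of the tensor module.\<close>

lemma symbols_casimir:
  assumes t: "t \<in> supported (Zt p)" and Sall: "\<And>a. a \<in> NN p \<Longrightarrow> sl t a \<in> Sall p"
    and cas: "\<And>a. a \<in> NN p \<Longrightarrow> ap (cas p) (sl t a) = cscale \<kappa> (sl t a)"
  shows "(\<forall>u<4. mu p u t = 0) \<longleftrightarrow> (\<forall>c\<in>NN p. sl (casT p t) c = cscale (\<kappa> - (2 * of_nat p + 3)) (sl t c))"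
proof -
  have S: "sl (casT p t) c = cscale (\<kappa> - (2 * of_nat p + 3)) (sl t c) - cscale (1/2) (\<Sum>u<4. ap (Ue p u c) (mu p u t))"
    if c: "c \<in> NN p" for c
    unfolding sl_casT[OF c] cas[OF c] by (rule ext) (simp add: op_pointwise algebra_simps)
  show ?thesis
  proof
    assume "\<forall>u<4. mu p u t = 0"
    then have "(\<Sum>u<4. ap (Ue p u c) (mu p u t)) = 0" for c by simp
    then show "\<forall>c\<in>NN p. sl (casT p t) c = cscale (\<kappa> - (2 * of_nat p + 3)) (sl t c)"
      using S by simp
  next
    assume eq: "\<forall>c\<in>NN p. sl (casT p t) c = cscale (\<kappa> - (2 * of_nat p + 3)) (sl t c)"
    have "(\<Sum>u<4. ap (Ue p u c) (mu p u t)) = 0" if c: "c \<in> NN p" for c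
    proof -
      have "cscale (1/2) (\<Sum>u<4. ap (Ue p u c) (mu p u t)) = 0"
        using S[OF c] eq c by (simp add: eq_diff_eq)
      then have "cscale 2 (cscale (1/2) (\<Sum>u<4. ap (Ue p u c) (mu p u t))) = 0" by (simp only: cv.scale_zero_right)
      then show ?thesis by simp
    qed
    then have "(\<Sum>c\<in>NN p. ip (Zc (4*p)) (\<Sum>u<4. ap (Ue p u c) (mu p u t)) (sl t c)) = 0"
      by (intro sum.neutral ballI) simp
    then have "(\<Sum>u<4. ip (Zc (4*p)) (mu p u t) (mu p u t)) = 0"
      unfolding symbol_norm by (simp only: neg_equal_0_iff_equal)
    then have "(\<Sum>u<4. Re (ip (Zc (4*p)) (mu p u t) (mu p u t))) = 0"
      by (simp only: Re_sum[symmetric] zero_complex.sel)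
    then have z: "Re (ip (Zc (4*p)) (mu p u t) (mu p u t)) = 0" if "u < 4" for u
      using that by (subst (asm) sum_nonneg_eq_0_iff) (auto simp: ip_self_nonneg)
    show "\<forall>u<4. mu p u t = 0"
    proof (intro allI impI)
      fix u :: nat assume u: "u < 4"
      have "mu p u t \<in> Sall p"
        unfolding mu_def Ue_def ap_scaleR
        by (intro cv.subspace_sum cv.subspace_scale subspace_Sall Sall_E Sall pm_range)
      then have supp: "mu p u t \<in> supported (Zc (4*p))" using Sall_supported by blast
      have "ip (Zc (4*p)) (mu p u t) (mu p u t) = 0"
        using z[OF u] ip_self_Re_eq_0[of "Zc (4*p)" "mu p u t"] ip_self_eq_0[of "Zc (4*p)" "mu p u t"] by simp
      then show "mu p u t = 0" using supported_eq_0I[OF supp] by simp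
    qed
  qed
qed

section \<open>Identification of the image of the symbols\<close>

lemma om2_cas: "om2 p = (-16) *\<^sub>R cas p - (16 * (real p * real p + 2 * real p)) *\<^sub>R 1"
  unfolding cas_om2 by (rule op_ext) (simp add: op_pointwise algebra_simps)

text \<open>The quadratic relation satisfied by om2 on the image of a doublet over its y-eigenspace.\<close>

definition RO :: "nat \<Rightarrow> complex \<Rightarrow> op" where
  "RO p y = om2 p * om2 p + sc (32 - 2 * y) * om2 p + sc (y * y + 32 * y - 768)"

text \<open>\<open>om2_double_commutator\<close> applied to \<open>x\<close>, where every
  \<open>om2 p\<close> to the right of the vector becomes \<open>y\<close>.\<close>

lemma RO_E:
  assumes "a \<in> NN p" "ap (om2 p) x = cscale y x"
  shows "ap (RO p y) (ap (EE p a) x) = 0"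
proof -
  have "ap (om2 p) (ap (om2 p) (ap (EE p a) x)) + cscale (-2) (cscale y (ap (om2 p) (ap (EE p a) x)))
      + cscale y (cscale y (ap (EE p a) x))
    = cscale (-32) (ap (om2 p) (ap (EE p a) x) + cscale y (ap (EE p a) x)) + cscale 768 (ap (EE p a) x)"
    using om2_double_commutator[OF assms(1), THEN arg_cong[where f = "\<lambda>T. ap T x"]] assms(2) by simp
  from fun_cong[OF this] show ?thesis
    unfolding RO_def by (intro ext) (simp add: op_pointwise algebra_simps)
qed

lemma RO_PO: "ap (RO p y) (ap (PO p) x) = ap (PO p) (ap (RO p y) x)"
proof -
  have c: "ap (cas p) (ap (PO p) z) = ap (PO p) (ap (cas p) z)" for z
    using cas_comm[OF spo_comm_dual(2), THEN arg_cong[where f = "\<lambda>T. ap T z"]] by simp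
  have "ap (om2 p) (ap (PO p) z) = ap (PO p) (ap (om2 p) z)" for z
    unfolding om2_cas by (simp add: c)
  then show ?thesis unfolding RO_def by simp
qed

text \<open>For spin j = (p-s)/2 this is -64 j(j+1), the su(2) Casimir in the normalisation of the
  \<open>om p u\<close>. It is an image of an integer, so that roots can be determined over the
  integers.\<close>

definition yval :: "nat \<Rightarrow> nat \<Rightarrow> complex" where
  "yval p s = of_int (16 - 16 * (int p - int s + 1)\<^sup>2)"

lemma om2_yval:
  assumes "ap (cas p) x = cscale (kap p s) x"
  shows "ap (om2 p) x = cscale (yval p s) x"
  unfolding om2_cas
  by (rule ext) (simp add: assms, simp add: op_pointwise kap_def yval_def power2_eq_square algebra_simps)

text \<open>In the dimensions \<open>a\<close>, \<open>b\<close> of the su(2) modules the quadratic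
  factors as 256 ((a-b)^2 - 1)((a+b)^2 - 1). Since \<open>a + b \<ge> 2\<close> only the first
  factor can vanish: the Clebsch-Gordan rule for a doublet.\<close>

lemma RO_root:
  assumes "x \<in> cell0 p d" "x \<noteq> 0" "ap (RO p (yval p s)) x = 0" "d \<le> p" "s \<le> p"
  shows "d = s + 1 \<or> s = d + 1"
proof -
  define a b where "a = int p - int s + 1" and "b = int p - int d + 1"
  have ab: "a \<ge> 1" "b \<ge> 1" using assms by (auto simp: a_def b_def)
  have om: "ap (om2 p) x = cscale (yval p d) x" by (rule om2_yval[OF cas_cell0[OF assms(1)]])
  define c where "c = yval p d * yval p d + (32 - 2 * yval p s) * yval p d + (yval p s * yval p s + 32 * yval p s - 768)"
  have "cscale c x = ap (RO p (yval p s)) x"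
    unfolding RO_def c_def by (rule ext) (simp add: om, simp add: op_pointwise algebra_simps)
  then have "cscale c x = 0" unfolding assms(3) .
  then have "c = 0" using assms(2) by simp
  moreover have "c = of_int (256 * (((a - b)\<^sup>2 - 1) * ((a + b)\<^sup>2 - 1)))"
    unfolding c_def yval_def a_def[symmetric] b_def[symmetric] by (simp add: power2_eq_square algebra_simps)
  ultimately have "((a - b)\<^sup>2 - 1) * ((a + b)\<^sup>2 - 1) = 0"
    by (simp only: of_int_eq_0_iff mult_eq_0_iff) simp
  moreover have "(a + b)\<^sup>2 \<noteq> 1" using ab by (auto simp: power2_eq_1_iff)
  ultimately have "(a - b)\<^sup>2 = 1" by simp
  then have "a - b = 1 \<or> a - b = -1" by (simp only: power2_eq_1_iff)
  then show ?thesis unfolding a_def b_def by auto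
qed

lemma mod_iso_refl: "mod_iso p act V act V"
  unfolding mod_iso_iff by (intro exI[of _ "\<lambda>x. x"]) (auto simp: bij_betw_def linear_on_def)

text \<open>Either \<open>P\<close> kills \<open>L\<close>, which then is the whole primitive cell
  of its degree, or it maps \<open>L\<close> isomorphically two degrees down. As \<open>RO\<close>
  commutes with \<open>P\<close>, its relation survives the descent and later determines
  \<open>e\<close>.\<close>

lemma irred_type:
  assumes "irred p (spin_act p) L" "L \<subseteq> Sdeg p d" "\<And>x. x \<in> L \<Longrightarrow> ap (RO p y) x = 0"
  shows "\<exists>e\<le>p. mod_iso p (spin_act p) L (spin_act p) (cell0 p e) \<and> (\<exists>x\<in>cell0 p e. x \<noteq> 0 \<and> ap (RO p y) x = 0)"
  using assms
proof (induction d arbitrary: L rule: less_induct)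
  case (less d)
  note L = less.prems(1)
  show ?case
  proof (cases "\<forall>x\<in>L. ap (PO p) x = 0")
    case True
    obtain x where x: "x \<in> L" "x \<noteq> 0" using subspace_nonzero[OF irredD(4)[OF L] irredD(2)[OF L]] by blast
    have sub: "L \<subseteq> cell0 p d" using True less.prems(2) unfolding cell0_eq by blast
    then have "cell0 p d \<noteq> {0}" using x by blast
    then have "irred p (spin_act p) (cell0 p d)" using cell0_irred by blast
    then have eq: "L = cell0 p d" using irredD(3)[OF _ sub irredD(1)[OF L]] irredD(2)[OF L] by blast
    have "d \<le> p" using ker_P_degree[of x p d] x less.prems(2) True by blast
    then show ?thesis
      using x less.prems(3)[OF x(1)] mod_iso_refl[of p "spin_act p" L] unfolding eq by blast
  next
    case False
    then obtain x where x: "x \<in> L" "ap (PO p) x \<noteq> 0" by blast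
    have d: "2 \<le> d" using Sdeg_P_0[of x p d] x less.prems(2) by fastforce
    have act0: "spin_act p A 0 = 0" for A by (simp add: spin_act_eq)
    note im = irred_image[where ?act2.0 = "spin_act p", OF L linear_on_ap[of L "PO p"] spin_comm(1) act0 x]
    have "ap (PO p) ` L \<subseteq> Sdeg p (d - 2)" using Sdeg_P less.prems(2) by blast
    moreover have "ap (RO p y) z = 0" if "z \<in> ap (PO p) ` L" for z
      using that less.prems(3) by (auto simp: RO_PO)
    ultimately have "\<exists>e\<le>p. mod_iso p (spin_act p) (ap (PO p) ` L) (spin_act p) (cell0 p e) \<and> (\<exists>x\<in>cell0 p e. x \<noteq> 0 \<and> ap (RO p y) x = 0)"
      using d by (intro less.IH[OF _ im(2)]) auto
    then show ?thesis using mod_iso_trans[OF im(1)] by blast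
  qed
qed

lemma symbol_annihilation:
  assumes "i < p"
  shows
    "ap (Ue p 0 (4*i+1)) x - cscale \<i> (ap (Ue p 1 (4*i+1)) x) = cscale (-2) (ap (F p (2*i+1)) x)"
    "ap (Ue p 0 (4*i+2)) x - cscale \<i> (ap (Ue p 1 (4*i+2)) x) = cscale (-2*\<i>) (ap (F p (2*i+1)) x)"
    "ap (Ue p 0 (4*i+3)) x - cscale \<i> (ap (Ue p 1 (4*i+3)) x) = cscale (-2) (ap (F p (2*i+2)) x)"
    "ap (Ue p 0 (4*i+4)) x - cscale \<i> (ap (Ue p 1 (4*i+4)) x) = cscale (-2*\<i>) (ap (F p (2*i+2)) x)"
    "ap (Ue p 2 (4*i+1)) x - cscale \<i> (ap (Ue p 3 (4*i+1)) x) = cscale (-2) (ap (F p (2*i+2)) x)"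
    "ap (Ue p 2 (4*i+2)) x - cscale \<i> (ap (Ue p 3 (4*i+2)) x) = cscale (2*\<i>) (ap (F p (2*i+2)) x)"
    "ap (Ue p 2 (4*i+3)) x - cscale \<i> (ap (Ue p 3 (4*i+3)) x) = cscale 2 (ap (F p (2*i+1)) x)"
    "ap (Ue p 2 (4*i+4)) x - cscale \<i> (ap (Ue p 3 (4*i+4)) x) = cscale (-2*\<i>) (ap (F p (2*i+1)) x)"
  unfolding U_block pm_sg_values E_block by (rule ext, simp add: op_pointwise algebra_simps)+

lemma symbol_creation:
  assumes "i < p"
  shows
    "ap (Ue p 0 (4*i+1)) x + cscale \<i> (ap (Ue p 1 (4*i+1)) x) = cscale 2 (ap (G p (2*i+1)) x)"
    "ap (Ue p 0 (4*i+2)) x + cscale \<i> (ap (Ue p 1 (4*i+2)) x) = cscale (-2*\<i>) (ap (G p (2*i+1)) x)"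
    "ap (Ue p 0 (4*i+3)) x + cscale \<i> (ap (Ue p 1 (4*i+3)) x) = cscale 2 (ap (G p (2*i+2)) x)"
    "ap (Ue p 0 (4*i+4)) x + cscale \<i> (ap (Ue p 1 (4*i+4)) x) = cscale (-2*\<i>) (ap (G p (2*i+2)) x)"
    "ap (Ue p 2 (4*i+1)) x + cscale \<i> (ap (Ue p 3 (4*i+1)) x) = cscale 2 (ap (G p (2*i+2)) x)"
    "ap (Ue p 2 (4*i+2)) x + cscale \<i> (ap (Ue p 3 (4*i+2)) x) = cscale (2*\<i>) (ap (G p (2*i+2)) x)"
    "ap (Ue p 2 (4*i+3)) x + cscale \<i> (ap (Ue p 3 (4*i+3)) x) = cscale (-2) (ap (G p (2*i+1)) x)"
    "ap (Ue p 2 (4*i+4)) x + cscale \<i> (ap (Ue p 3 (4*i+4)) x) = cscale (-2*\<i>) (ap (G p (2*i+1)) x)"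
  unfolding U_block pm_sg_values E_block by (rule ext, simp add: op_pointwise algebra_simps)+

text \<open>For \<open>u\<close> equal to 0 or 2 and \<open>\<epsilon>\<close> equal to
  \<open>-\<i>\<close> this contains only annihilation operators, for \<open>\<epsilon>\<close>
  equal to \<open>\<i>\<close> only creation operators. Homogeneous tensors thus have homogeneous
  images, as \<open>irred_type\<close> requires.\<close>

definition sm :: "nat \<Rightarrow> nat \<Rightarrow> complex \<Rightarrow> tens \<Rightarrow> cl" where
  "sm p u \<epsilon> t = mu p u t + cscale \<epsilon> (mu p (u + 1) t)"

lemma sm_eq: "sm p u \<epsilon> t = (\<Sum>i<p. \<Sum>k\<in>{1,2,3,4}. ap (Ue p u (4*i+k)) (sl t (4*i+k)) + cscale \<epsilon> (ap (Ue p (u+1) (4*i+k)) (sl t (4*i+k))))"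
  unfolding sm_def mu_def sum_NN by (simp add: sum.distrib cv.scale_sum_right cv.scale_right_distrib add.assoc)

lemma block_range: "i < p \<Longrightarrow> k \<in> {1,2,3,4} \<Longrightarrow> 4*i+k \<in> NN p"
  by auto

lemma sm_degree:
  assumes u: "u \<in> {0, 2}" and \<epsilon>: "\<epsilon> = - \<i> \<or> \<epsilon> = \<i>"
  shows "\<exists>d. \<forall>t. (\<forall>a\<in>NN p. sl t a \<in> Sdeg p r) \<longrightarrow> sm p u \<epsilon> t \<in> Sdeg p d"
proof -
  have low: "sm p u (- \<i>) t \<in> Sdeg p (r - 1)" if t: "\<forall>a\<in>NN p. sl t a \<in> Sdeg p r" for t
    unfolding sm_eq
  proof (intro cv.subspace_sum[OF subspace_Sdeg])
    fix i k :: nat assume "i \<in> {..<p}" and k: "k \<in> {1,2,3,4}"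
    then have i: "i < p" by simp
    have F: "cscale z (ap (F p l) (sl t (4*i+k))) \<in> Sdeg p (r - 1)" if "l \<in> MM p" for z l
      using t block_range[OF i k] that by (intro cv.subspace_scale[OF subspace_Sdeg] Sdeg_F) blast+
    have "ap (Ue p u (4*i+k)) (sl t (4*i+k)) - cscale \<i> (ap (Ue p (u+1) (4*i+k)) (sl t (4*i+k))) \<in> Sdeg p (r - 1)"
      using u k F[OF modes(1)[OF i]] F[OF modes(2)[OF i]]
      by (auto simp: symbol_annihilation[OF i] simp del: cv.scale_minus_left)
    then show "ap (Ue p u (4*i+k)) (sl t (4*i+k)) + cscale (- \<i>) (ap (Ue p (u+1) (4*i+k)) (sl t (4*i+k))) \<in> Sdeg p (r - 1)"
      by simp
  qed
  have up: "sm p u \<i> t \<in> Sdeg p (r + 1)" if t: "\<forall>a\<in>NN p. sl t a \<in> Sdeg p r" for t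
    unfolding sm_eq
  proof (intro cv.subspace_sum[OF subspace_Sdeg])
    fix i k :: nat assume "i \<in> {..<p}" and k: "k \<in> {1,2,3,4}"
    then have i: "i < p" by simp
    have G: "cscale z (ap (G p l) (sl t (4*i+k))) \<in> Sdeg p (r + 1)" if "l \<in> MM p" for z l
      using t block_range[OF i k] that by (intro cv.subspace_scale[OF subspace_Sdeg] Sdeg_G) blast+
    show "ap (Ue p u (4*i+k)) (sl t (4*i+k)) + cscale \<i> (ap (Ue p (u+1) (4*i+k)) (sl t (4*i+k))) \<in> Sdeg p (r + 1)"
      using u k G[OF modes(1)[OF i]] G[OF modes(2)[OF i]]
      by (auto simp: symbol_creation[OF i] simp del: cv.scale_minus_left)
  qed
  from \<epsilon> show ?thesis
  proof
    assume "\<epsilon> = - \<i>"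
    then show ?thesis using low by blast
  next
    assume "\<epsilon> = \<i>"
    then show ?thesis using up by blast
  qed
qed

lemma RO_mu:
  assumes "\<And>a. a \<in> NN p \<Longrightarrow> ap (om2 p) (sl t a) = cscale y (sl t a)"
  shows "ap (RO p y) (mu p u t) = 0"
proof -
  have "ap (RO p y) (ap (Ue p u a) (sl t a)) = 0" if a: "a \<in> NN p" for a
    unfolding Ue_def ap_scaleR ap_scale using RO_E[OF pm_range[OF a] assms[OF a]] by simp
  then show ?thesis unfolding mu_def ap_sum by (intro sum.neutral) blast
qed

section \<open>The common kernel of the symbols\<close>

lemma tau_cases:
  assumes "\<tau> \<in> {tau_plus p s, tau_minus p s}" "s \<le> p"
  shows "\<tau> = {0} \<or> (\<exists>e\<le>p. \<tau> = cell0 p e \<and> (e = s + 1 \<or> s = e + 1))"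
proof -
  have cell: "cell p e e = cell0 p e" if "e \<le> p" for e
    using that by (simp add: cell_def cell_ok_def)
  have plus: "tau_plus p s = {0} \<or> (\<exists>e\<le>p. tau_plus p s = cell0 p e \<and> e = s + 1)"
  proof (cases "s + 1 \<le> p")
    case True
    then show ?thesis unfolding tau_plus_def using cell by blast
  next
    case False
    then have "tau_plus p s = {0}" by (simp add: tau_plus_def cell_def cell_ok_def zero_fun_lambda)
    then show ?thesis ..
  qed
  have minus: "tau_minus p s = {0} \<or> (\<exists>e\<le>p. tau_minus p s = cell0 p e \<and> s = e + 1)"
  proof (cases s)
    case 0
    then show ?thesis by (simp add: tau_minus_def zero_fun_lambda)
  next
    case (Suc e)
    have "tau_minus p s = cell p e e" unfolding tau_minus_def Suc by simp
    moreover have e: "e \<le> p" "s = e + 1" using assms(2) Suc by simp_all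
    ultimately have "tau_minus p s = cell0 p e" using cell by simp
    then show ?thesis using e by blast
  qed
  from assms(1) have "\<tau> = tau_plus p s \<or> \<tau> = tau_minus p s" by simp
  then show ?thesis
  proof
    assume \<tau>: "\<tau> = tau_plus p s"
    show ?thesis unfolding \<tau> using plus by blast
  next
    assume \<tau>: "\<tau> = tau_minus p s"
    show ?thesis unfolding \<tau> using minus by blast
  qed
qed

lemma tau_attained:
  assumes "e \<le> p" "e = s + 1 \<or> s = e + 1"
  shows "cell0 p e \<in> {tau_plus p s, tau_minus p s}"
proof -
  have cell: "cell p e e = cell0 p e"
    using assms(1) by (simp add: cell_def cell_ok_def)
  from assms(2) have "cell0 p e = tau_plus p s \<or> cell0 p e = tau_minus p s"
  proof
    assume s: "e = s + 1"
    show ?thesis unfolding tau_plus_def s[symmetric] cell by simp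
  next
    assume s: "s = e + 1"
    show ?thesis unfolding tau_minus_def s using cell by simp
  qed
  then show ?thesis by simp
qed

lemma tau_irred:
  assumes "\<tau> \<in> {tau_plus p s, tau_minus p s}" "s \<le> p"
  shows "\<tau> = {0} \<or> irred p (spin_act p) \<tau>"
proof -
  have "\<forall>e. cell0 p e = {0} \<or> irred p (spin_act p) (cell0 p e)" using cell0_irred by blast
  with tau_cases[OF assms] show ?thesis by (elim disjE exE conjE) simp_all
qed

lemma linear_on_sum:
  assumes "linear_on V h" "cv.subspace V" "\<And>i. i \<in> I \<Longrightarrow> x i \<in> V"
  shows "h (\<Sum>i\<in>I. x i) = (\<Sum>i\<in>I. h (x i))"
  using assms(3)
proof (induction I rule: infinite_finite_induct)
  case (insert i I)
  have "(\<Sum>i\<in>I. x i) \<in> V" by (rule cv.subspace_sum[OF assms(2)]) (use insert.prems in auto)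
  then have "h (x i + (\<Sum>i\<in>I. x i)) = h (x i) + h (\<Sum>i\<in>I. x i)"
    using insert.prems by (intro linear_onD(1)[OF assms(1)]) auto
  then show ?case using insert by simp
qed (use linear_on_0[OF assms(1,2)] in simp_all)

lemma casT_iso:
  assumes V: "submodule p (tact p) V" and \<phi>: "linear_on V \<phi>"
    "\<And>A x. A \<in> sp_alg p \<Longrightarrow> x \<in> V \<Longrightarrow> \<phi> (tact p A x) = spin_act p A (\<phi> x)" and x: "x \<in> V"
  shows "\<phi> (casT p x) = ap (cas p) (\<phi> x)"
proof -
  note sV = submoduleD(1)[OF V]
  have m: "tact p (Ag p a b) y \<in> V" if "a \<in> NN p" "b \<in> NN p" "y \<in> V" for a b y
    by (rule submoduleD(2)[OF V Ag_sp_alg[OF that(1,2)] that(3)])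
  have "\<phi> (casT p x) = (\<Sum>a\<in>NN p. \<phi> (\<Sum>b\<in>NN p. tact p (Ag p a b) (tact p (Ag p a b) x)))"
    unfolding casT_def by (rule linear_on_sum[OF \<phi>(1) sV]) (intro cv.subspace_sum[OF sV] m x)
  also have "\<dots> = (\<Sum>a\<in>NN p. \<Sum>b\<in>NN p. \<phi> (tact p (Ag p a b) (tact p (Ag p a b) x)))"
    by (intro sum.cong refl linear_on_sum[OF \<phi>(1) sV] m x)
  also have "\<dots> = (\<Sum>a\<in>NN p. \<Sum>b\<in>NN p. ap (spo p (Ag p a b)) (ap (spo p (Ag p a b)) (\<phi> x)))"
    by (intro sum.cong refl) (simp only: \<phi>(2) Ag_sp_alg m x spin_act_eq)
  finally show ?thesis unfolding cas_def ap_op_sum by simp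
qed

text \<open>The difference \<open>kap p s - kap p e\<close> is \<open>2(p-s)+1\<close> for
  \<open>e = s + 1\<close> and \<open>-2(p-s)-3\<close> for \<open>s = e + 1\<close>; both lie below
  \<open>2p+3\<close>.\<close>

lemma kap_distinct:
  assumes "s \<le> p" "e = s + 1 \<or> s = e + 1" "e \<le> p"
  shows "kap p s - (2 * of_nat p + 3) \<noteq> kap p e"
proof
  assume eq: "kap p s - (2 * of_nat p + 3) = kap p e"
  define D where "D = (int p - int s + 1)\<^sup>2 - (2 * int p + 3) - (int p - int e + 1)\<^sup>2"
  have "of_int D = kap p s - (2 * of_nat p + 3) - kap p e"
    unfolding D_def kap_def by simp
  then have "D = 0" unfolding eq by simp
  then show False using assms unfolding D_def by (auto simp: power2_eq_square algebra_simps)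
qed

lemma kernel_char:
  assumes ok: "cell_ok p r s" and W: "submodule p (vact p) W" "W \<subseteq> Vc p"
    and T: "T = tensor p W (cell p r s)" and x: "x \<in> T"
  shows "(\<forall>u<4. mu p u x = 0) \<longleftrightarrow> x \<in> nonisotypic p T (tau_plus p s) \<and> x \<in> nonisotypic p T (tau_minus p s)"
proof -
  interpret tensor_skew_module "Zt p" p by (rule tensor_module)
  note U = cell_props[OF ok]
  have sp: "s \<le> p" using ok by (simp add: cell_ok_def)
  have sT: "submodule p (tact p) T" unfolding T by (rule submodule_tensor[OF W(1) U(1)])
  have TZ: "T \<subseteq> supported (Zt p)"
    unfolding T by (rule tensor_supported[OF W(2)]) (use U(2) Sdeg_supported in blast)
  have slU: "sl t a \<in> cell p r s" if "t \<in> T" for t a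
    using tensor_slice[OF that[unfolded T] submoduleD(1)[OF U(1)]] .
  have cas: "ap (cas p) (sl t a) = cscale (kap p s) (sl t a)" if "t \<in> T" for t a
    by (rule U(3)[OF slU[OF that]])
  have ssT: "cv.subspace T" by (rule submoduleD(1)[OF sT])
  define K where "K = {t\<in>T. \<forall>u<4. mu p u t = 0}"
  have sK: "submodule p (tact p) K"
  proof (rule submoduleI)
    show "cv.subspace K" using ssT unfolding K_def cv.subspace_def by auto
    fix A t assume A: "A \<in> sp_alg p" and t: "t \<in> K"
    then have "tact p A t \<in> T" using submoduleD(2)[OF sT] unfolding K_def by blast
    moreover have "\<forall>u<4. mu p u (tact p A t) = 0"
      using t mu_tact[OF A] unfolding K_def by (simp add: spin_act_eq)
    ultimately show "tact p A t \<in> K" unfolding K_def by blast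
  qed
  have KT: "K \<subseteq> T" unfolding K_def by blast
  have K_casT: "casT p t = cscale (kap p s - (2 * of_nat p + 3)) t" if t: "t \<in> K" for t
  proof (rule tens_eqI)
    fix c
    have tT: "t \<in> T" using t KT by blast
    show "sl (casT p t) c = sl (cscale (kap p s - (2 * of_nat p + 3)) t) c"
    proof (cases "c \<in> NN p")
      case True
      have S0: "(\<Sum>u<4. ap (Ue p u c) (mu p u t)) = 0" using t unfolding K_def by simp
      show ?thesis
        unfolding sl_casT[OF True] cas[OF tT] S0 sl_simps
        by (rule ext) (simp add: op_pointwise algebra_simps)
    next
      case False
      \<comment> \<open>\<open>sl_casT\<close> only concerns indices in range; elsewhere both sides
        vanish by the support of \<open>T\<close>.\<close>
      have z: "sl t' c = 0" if "t' \<in> T" for t'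
        using TZ that False by (auto simp: supported_def sl_def fun_eq_iff pointwise)
      have "casT p t \<in> T"
        unfolding casT_def using submoduleD(2)[OF sT] Ag_sp_alg tT
        by (intro cv.subspace_sum[OF ssT]) blast
      then show ?thesis using z z[OF tT] by simp
    qed
  qed
  have K_noniso: "K \<subseteq> nonisotypic p T \<tau>" if \<tau>: "\<tau> \<in> {tau_plus p s, tau_minus p s}" for \<tau>
  proof -
    have "\<not> mod_iso p (tact p) V (spin_act p) \<tau>" if V: "V \<subseteq> K" "irred p (tact p) V" for V
    proof
      assume iso: "mod_iso p (tact p) V (spin_act p) \<tau>"
      have "\<tau> \<noteq> {0}"
      proof
        assume "\<tau> = {0}"
        then have "V = {0}" using mod_iso_zero[OF iso[unfolded \<open>\<tau> = {0}\<close>] irredD(4)[OF V(2)]] by blast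
        then show False using irredD(2)[OF V(2)] by blast
      qed
      then obtain e where e: "e \<le> p" "\<tau> = cell0 p e" "e = s + 1 \<or> s = e + 1"
        using tau_cases[OF \<tau> sp] by blast
      obtain \<phi> where \<phi>: "bij_betw \<phi> V \<tau>" "linear_on V \<phi>" "\<And>A x. A \<in> sp_alg p \<Longrightarrow> x \<in> V \<Longrightarrow> \<phi> (tact p A x) = spin_act p A (\<phi> x)"
        using iso unfolding mod_iso_iff by blast
      obtain v where v: "v \<in> V" "v \<noteq> 0"
        using subspace_nonzero[OF irredD(4)[OF V(2)] irredD(2)[OF V(2)]] by blast
      have "\<phi> v \<in> cell0 p e" using \<phi>(1) v(1) e(2) by (auto simp: bij_betw_def)
      then have "cscale (kap p e) (\<phi> v) = ap (cas p) (\<phi> v)" by (simp only: cas_cell0)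
      also have "\<dots> = \<phi> (casT p v)" by (rule casT_iso[OF irredD(1)[OF V(2)] \<phi>(2,3) v(1), symmetric])
      also have "\<dots> = cscale (kap p s - (2 * of_nat p + 3)) (\<phi> v)"
        using K_casT[of v] V(1) v(1) linear_onD(2)[OF \<phi>(2) v(1)] by auto
      finally have "cscale (kap p e) (\<phi> v) = cscale (kap p s - (2 * of_nat p + 3)) (\<phi> v)" .
      then have "cscale (kap p e - (kap p s - (2 * of_nat p + 3))) (\<phi> v) = 0"
        unfolding cv.scale_left_diff_distrib[of "kap p e"] by simp
      then have "\<phi> v = 0" using kap_distinct[OF sp e(3,1)] by (simp only: cv.scale_eq_0_iff right_minus_eq) simp
      moreover have "\<phi> 0 = 0" by (rule linear_on_0[OF \<phi>(2) irredD(4)[OF V(2)]])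
      ultimately have "\<phi> v = \<phi> 0" by simp
      then have "v = 0"
        by (rule inj_onD[OF bij_betw_imp_inj_on[OF \<phi>(1)] _ v(1) cv.subspace_0[OF irredD(4)[OF V(2)]]])
      then show False using v(2) by simp
    qed
    then have "\<Union>{V. V \<subseteq> K \<and> irred p (tact p) V} \<subseteq> \<Union>{V. V \<subseteq> T \<and> irred p (tact p) V \<and> \<not> mod_iso p (tact p) V (spin_act p) \<tau>}"
      using KT by blast
    then have "cv.span (\<Union>{V. V \<subseteq> K \<and> irred p (tact p) V}) \<subseteq> nonisotypic p T \<tau>"
      unfolding nonisotypic_eq by (rule cv.span_mono)
    then show ?thesis using complete_reducibility[OF sK order_trans[OF KT TZ]] by blast
  qed
  \<comment> \<open>An intersection of two spans of irreducibles; as a submodule it is spanned by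
    its own irreducibles, so these can be tested one by one.\<close>
  define N where "N = nonisotypic p T (tau_plus p s) \<inter> nonisotypic p T (tau_minus p s)"
  have sN: "submodule p (tact p) N"
    unfolding N_def by (intro submodule_Int submodule_nonisotypic)
  have NT: "N \<subseteq> T" unfolding N_def using nonisotypic_subset[OF ssT] by blast
  have V_K: "V \<subseteq> {t. \<forall>u<4. mu p u t = 0}" if V: "V \<subseteq> N" "irred p (tact p) V" for V
  proof -
    have VT: "V \<subseteq> T" using V(1) NT by blast
    have not_iso: "\<not> mod_iso p (tact p) V (spin_act p) \<tau>" if \<tau>: "\<tau> \<in> {tau_plus p s, tau_minus p s}" for \<tau>
    proof
      assume iso: "mod_iso p (tact p) V (spin_act p) \<tau>"
      obtain v where v: "v \<in> V" "v \<noteq> 0"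
        using subspace_nonzero[OF irredD(4)[OF V(2)] irredD(2)[OF V(2)]] by blast
      have "v \<in> isotypic p T \<tau>"
        unfolding isotypic_eq using VT iso irredD(1)[OF V(2)] v(1) by (intro cv.span_base) blast
      moreover have "v \<in> nonisotypic p T \<tau>" using V(1) v(1) \<tau> unfolding N_def by blast
      ultimately have "v = 0" by (rule isotypic_Int[OF ssT TZ tau_irred[OF \<tau> sp]])
      then show False using v(2) by simp
    qed
    have sm0: "sm p u \<epsilon> t = 0" if u: "u \<in> {0, 2}" and \<epsilon>: "\<epsilon> = - \<i> \<or> \<epsilon> = \<i>" and t: "t \<in> V" for u \<epsilon> t
    \<comment> \<open>A nonzero image would be an irreducible spinor module isomorphic to
      \<open>V\<close>, and the quadratic relation leaves it only the two excluded types.\<close>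
    proof (rule ccontr)
      assume nz: "sm p u \<epsilon> t \<noteq> 0"
      have u4: "u < 4" "u + 1 < 4" using u by auto
      have lin: "linear_on V (sm p u \<epsilon>)"
        by (simp add: linear_on_def sm_def cv.scale_right_distrib mult.commute)
      have equi: "sm p u \<epsilon> (tact p A x) = spin_act p A (sm p u \<epsilon> x)" if "A \<in> sp_alg p" "x \<in> V" for A x
        unfolding sm_def mu_tact[OF that(1) u4(1)] mu_tact[OF that(1) u4(2)] by (simp add: spin_act_eq)
      have act0: "spin_act p A 0 = 0" for A by (simp add: spin_act_eq)
      note im = irred_image[where ?act2.0 = "spin_act p", OF V(2) lin equi act0 t nz]
      obtain d where d: "\<And>t. (\<forall>a\<in>NN p. sl t a \<in> Sdeg p r) \<Longrightarrow> sm p u \<epsilon> t \<in> Sdeg p d"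
        using sm_degree[OF u \<epsilon>, of p r] by blast
      have deg: "sm p u \<epsilon> ` V \<subseteq> Sdeg p d"
      proof
        fix z assume "z \<in> sm p u \<epsilon> ` V"
        then obtain x where x: "x \<in> V" "z = sm p u \<epsilon> x" by blast
        then have "\<forall>a\<in>NN p. sl x a \<in> Sdeg p r" using slU VT U(2) by blast
        then show "z \<in> Sdeg p d" unfolding x(2) by (rule d)
      qed
      have RO: "ap (RO p (yval p s)) z = 0" if z: "z \<in> sm p u \<epsilon> ` V" for z
      proof -
        obtain x where x: "x \<in> V" "z = sm p u \<epsilon> x" using z by blast
        have "ap (om2 p) (sl x a) = cscale (yval p s) (sl x a)" for a
          by (rule om2_yval[OF cas]) (use x VT in blast)
        then show ?thesis unfolding x(2) sm_def ap_add ap_scale by (simp only: RO_mu) simp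
      qed
      obtain e y where e: "e \<le> p" "mod_iso p (spin_act p) (sm p u \<epsilon> ` V) (spin_act p) (cell0 p e)"
        and y: "y \<in> cell0 p e" "y \<noteq> 0" "ap (RO p (yval p s)) y = 0"
        using irred_type[OF im(2) deg RO] by blast
      have "e = s + 1 \<or> s = e + 1" by (rule RO_root[OF y e(1) sp])
      then have "cell0 p e \<in> {tau_plus p s, tau_minus p s}" by (rule tau_attained[OF e(1)])
      then show False using not_iso mod_iso_trans[OF im(1) e(2)] by blast
    qed
    show ?thesis
    proof (intro subsetI CollectI allI impI)
      fix t u assume t: "t \<in> V" and u4: "u < (4::nat)"
      \<comment> \<open>The two symbols are recovered from their conjugate combinations.\<close>
      have z: "mu p v t = 0 \<and> mu p (v + 1) t = 0" if v: "v \<in> {0, 2}" for v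
      proof -
        have "mu p v t + cscale \<i> (mu p (v + 1) t) = 0" "mu p v t - cscale \<i> (mu p (v + 1) t) = 0"
          using sm0[OF v _ t, of \<i>] sm0[OF v _ t, of "- \<i>"] by (simp_all add: sm_def)
        then have *: "mu p v t C + \<i> * mu p (v + 1) t C = 0" "mu p v t C - \<i> * mu p (v + 1) t C = 0" for C
          by (metis cscale_apply plus_fun_apply zero_fun_apply, metis cscale_apply minus_apply zero_fun_apply)
        have "mu p v t C = 0 \<and> mu p (v + 1) t C = 0" for C
          using *[of C] by (simp add: eq_neg_iff_add_eq_0[symmetric])
        then show ?thesis by (simp add: fun_eq_iff zero_fun_apply)
      qed
      show "mu p u t = 0" using z[of 0] z[of 2] u4 unfolding less_4_cases by auto
    qed
  qed
  have "N \<subseteq> {t. \<forall>u<4. mu p u t = 0}"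
  proof -
    have "cv.subspace {t. \<forall>u<4. mu p u t = 0}" unfolding cv.subspace_def by auto
    then have "cv.span (\<Union>{V. V \<subseteq> N \<and> irred p (tact p) V}) \<subseteq> {t. \<forall>u<4. mu p u t = 0}"
      using V_K by (intro cv.span_minimal) blast+
    then show ?thesis using complete_reducibility[OF sN order_trans[OF NT TZ]] by blast
  qed
  moreover have "x \<in> N" if "\<forall>u<4. mu p u x = 0"
    using K_noniso x that unfolding N_def K_def by blast
  ultimately show ?thesis unfolding N_def by blast
qed

section \<open>Differentiation inside a cell\<close>

lemma pd_has_derivative:
  fixes f :: "real^'n::finite \<Rightarrow> cl"
  assumes "(\<lambda>y. f y B) differentiable (at x)"
  shows "((\<lambda>t. f (x + t *\<^sub>R axis (b a) 1) B) has_vector_derivative pd b f a x B) (at 0)"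
proof -
  have "((\<lambda>y. f y B) \<circ> (\<lambda>t::real. x + t *\<^sub>R axis (b a) 1)) differentiable (at 0)"
    by (rule differentiable_chain_at) (use assms in \<open>auto intro!: derivative_intros\<close>)
  then have "(\<lambda>t. f (x + t *\<^sub>R axis (b a) 1) B) differentiable (at 0)"
    by (simp add: o_def)
  then show ?thesis unfolding pd_def by (rule vector_derivative_works[THEN iffD1])
qed

lemma pd_annihilator:
  fixes f :: "real^'n::finite \<Rightarrow> cl"
  assumes \<Omega>: "open \<Omega>" "x \<in> \<Omega>" and diff: "cdifferentiable_on f \<Omega>"
    and zero: "\<And>y. y \<in> \<Omega> \<Longrightarrow> (\<Sum>B\<in>Z. f y B * c B) = 0"
  shows "(\<Sum>B\<in>Z. pd b f a x B * c B) = 0"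
proof -
  let ?v = "axis (b a) (1::real) :: real^'n"
  let ?g = "\<lambda>t::real. \<Sum>B\<in>Z. f (x + t *\<^sub>R ?v) B * c B"
  have "(?g has_vector_derivative (\<Sum>B\<in>Z. pd b f a x B * c B)) (at 0)"
  proof (rule has_vector_derivative_sum)
    fix B
    have "((\<lambda>t. f (x + t *\<^sub>R ?v) B) has_vector_derivative pd b f a x B) (at 0)"
      by (rule pd_has_derivative) (use diff \<Omega>(2) in \<open>auto simp: cdifferentiable_on_def\<close>)
    then show "((\<lambda>t. f (x + t *\<^sub>R ?v) B * c B) has_vector_derivative pd b f a x B * c B) (at 0)"
      by (rule has_vector_derivative_mult_left)
  qed
  moreover have "open {t::real. x + t *\<^sub>R ?v \<in> \<Omega>}"
    using open_vimage[OF \<Omega>(1), of "\<lambda>t::real. x + t *\<^sub>R ?v"]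
    by (simp add: vimage_def continuous_intros)
  moreover have "0 \<in> {t::real. x + t *\<^sub>R ?v \<in> \<Omega>}" using \<Omega>(2) by simp
  moreover have "?g t = 0" if "t \<in> {t::real. x + t *\<^sub>R ?v \<in> \<Omega>}" for t
    using zero that by simp
  ultimately have "((\<lambda>_. 0) has_vector_derivative (\<Sum>B\<in>Z. pd b f a x B * c B)) (at (0::real))"
    by (rule has_vector_derivative_transform_within_open)
  then show ?thesis
    using vector_derivative_unique_at[OF _ has_vector_derivative_const] by blast
qed

text \<open>Derivatives are taken coefficientwise, so \<open>U\<close> is described by linear
  equations: vanishing outside \<open>Z\<close> and orthogonality to its complement. Each of them
  can be differentiated by \<open>pd_annihilator\<close>.\<close>

lemma pd_mem:
  fixes f :: "real^'n::finite \<Rightarrow> cl"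
  assumes \<Omega>: "open \<Omega>" "x \<in> \<Omega>" and diff: "cdifferentiable_on f \<Omega>"
    and U: "cv.subspace U" "U \<subseteq> supported Z" "finite Z" and f: "\<And>y. y \<in> \<Omega> \<Longrightarrow> f y \<in> U"
  shows "pd b f a x \<in> U"
proof -
  let ?d = "pd b f a x"
  have supp: "?d \<in> supported Z"
    unfolding supported_def mem_Collect_eq
  proof (intro allI impI)
    fix B assume B: "B \<notin> Z"
    have "(\<Sum>C\<in>{B}. ?d C * 1) = 0"
      by (rule pd_annihilator[OF \<Omega> diff]) (use f U(2) B in \<open>auto simp: supported_def\<close>)
    then show "?d B = 0" by simp
  qed
  have ann: "ip Z ?d w = 0" if w: "w \<in> orth Z U" for w
    unfolding ip_def
  proof (rule pd_annihilator[OF \<Omega> diff])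
    fix y assume "y \<in> \<Omega>"
    then have "ip Z w (f y) = 0" using w f unfolding orth_def by blast
    then have "ip Z (f y) w = 0" using ip_commute[of Z "f y" w] by simp
    then show "(\<Sum>B\<in>Z. f y B * cnj (w B)) = 0" unfolding ip_def .
  qed
  obtain v w where vw: "v \<in> U" "w \<in> supported Z" "w \<in> orth Z U" "?d = v + w"
    by (rule orth_decomp[OF U(3,1) subspace_supported U(2) supp])
  have "ip Z w v = 0" using vw(1,3) unfolding orth_def by blast
  then have "ip Z v w = 0" using ip_commute[of Z v w] by simp
  then have "ip Z w w = 0" using ann[OF vw(3)] unfolding vw(4) by simp
  then have "w = 0" by (rule supported_eq_0I[OF vw(2) U(3)])
  then show ?thesis using vw(1) unfolding vw(4) by simp
qed

section \<open>The system of Stein-Weiss equations\<close>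

lemma IM_eq: "IM a = clscale (of_real (sg 1 a)) (cle (pm 1 a))"
  by (cases "odd a") (auto simp: IM_def sg_def pm_def clscale_def fun_eq_iff)

lemma JM_eq: "JM a = clscale (of_real (sg 2 a)) (cle (pm 2 a))"
proof -
  consider "a mod 4 = 1" | "a mod 4 = 2" | "a mod 4 = 3" | "a mod 4 = 0" by linarith
  then show ?thesis
    by cases (simp_all add: JM_def sg_def pm_def clscale_def fun_eq_iff)
qed

lemma lm_units:
  assumes a: "a \<in> NN p"
  shows "lm (4*p) (cle a) = Ue p 0 a" "lm (4*p) (IM a) = Ue p 1 a" "lm (4*p) (JM a) = Ue p 2 a"
    "lm (4*p) (KM (4*p) a) = Ue p 3 a"
proof -
  show "lm (4*p) (cle a) = Ue p 0 a" unfolding Ue_0 E_def ..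
  have I: "lm (4*p) (IM c) = Ue p 1 c" for c
    unfolding IM_eq lm_simps Ue_def E_def scaleR_op_def ..
  then show "lm (4*p) (IM a) = Ue p 1 a" .
  show "lm (4*p) (JM a) = Ue p 2 a"
    unfolding JM_eq lm_simps Ue_def E_def scaleR_op_def ..
  have c1: "a \<ge> 1" using a by simp
  have "KM (4*p) a = (\<lambda>A. \<Sum>c\<in>NN p. if c = pm 2 a then of_real (sg 2 a) * IM c A else 0)"
    unfolding KM_def Ilin_def JM_eq by (intro ext sum.cong refl) (simp add: clscale_def cle_def)
  also have "\<dots> = clscale (of_real (sg 2 a)) (IM (pm 2 a))"
    using pm_range[OF a, of 2] by (simp add: clscale_def)
  finally have "lm (4*p) (KM (4*p) a) = sg 2 a *\<^sub>R Ue p 1 (pm 2 a)"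
    by (simp add: lm_simps I scaleR_op_def)
  also have "\<dots> = (sg 2 a * sg 1 (pm 2 a)) *\<^sub>R EE p (pm 1 (pm 2 a))"
    by (simp add: Ue_def)
  also have "\<dots> = Ue p 3 a"
    using pm_comp[OF c1, of 1 2] by (simp add: Ue_def qs_def qx_def)
  finally show "lm (4*p) (KM (4*p) a) = Ue p 3 a" .
qed

lemma dirac_mu:
  assumes "\<And>a. a \<in> NN p \<Longrightarrow> lm (4*p) (M a) = Ue p u a"
  shows "dirac_op p M b f x = mu p u (grad p b f x)"
proof -
  have "sl (grad p b f x) a = pd b f a x" if "a \<in> NN p" for a
    using that by (simp add: sl_def grad_def)
  then show ?thesis
    unfolding dirac_op_def mu_def
    by (intro ext) (simp add: pointwise assms flip: ap_lm)
qed

text \<open>Restates a Stein-Weiss equation as membership in a nonisotypic part, the form in which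
  \<open>kernel_char\<close> speaks of it.\<close>

lemma SW_proj_eq_0_iff:
  assumes "tensor_skew_module Z p"
    and Ti: "Ti = tensor p Wi U" "submodule p (tact p) Ti" "Ti \<subseteq> supported Z"
    and Tj: "Tj = tensor p Wj U" "cv.subspace Tj" "Ti \<inter> Tj = {0}"
    and \<tau>: "\<tau> = {0} \<or> irred p (spin_act p) \<tau>"
    and x: "x \<in> Ti" and v: "v \<in> Tj"
  shows "SW_proj p U Wi Wj \<tau> (x + v) = 0 \<longleftrightarrow> x \<in> nonisotypic p Ti \<tau>"
proof -
  interpret tensor_skew_module Z p by (rule assms(1))
  note sTi = submoduleD(1)[OF Ti(2)]
  obtain u w where uw: "u \<in> isotypic p Ti \<tau>" "w \<in> nonisotypic p Ti \<tau>" "x = u + w"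
    by (rule isotypic_decomp[OF Ti(2,3) x])
  have "SW_proj p U Wi Wj \<tau> (x + v) = u"
    unfolding uw(3) by (rule SW_proj_eq[OF Ti Tj \<tau> uw(1,2) v])
  moreover have "u = 0 \<longleftrightarrow> x \<in> nonisotypic p Ti \<tau>"
  proof
    assume "u = 0"
    then show "x \<in> nonisotypic p Ti \<tau>" using uw(2) unfolding uw(3) by simp
  next
    assume x: "x \<in> nonisotypic p Ti \<tau>"
    have "x - w \<in> nonisotypic p Ti \<tau>"
      by (rule cv.subspace_diff[OF submoduleD(1)[OF submodule_nonisotypic] x uw(2)])
    then have "u \<in> nonisotypic p Ti \<tau>" unfolding uw(3) by simp
    then show "u = 0" by (rule isotypic_Int[OF sTi Ti(3) \<tau> uw(1)])
  qed
  ultimately show ?thesis by simp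
qed

text \<open>The common kernel of the symbols is a Casimir eigenspace, so it is compatible with the
  decomposition into submodules.\<close>

lemma symbols_split:
  assumes ok: "cell_ok p r s"
    and W1: "submodule p (vact p) W1" "W1 \<subseteq> Vc p" and W2: "submodule p (vact p) W2" "W2 \<subseteq> Vc p"
    and W12: "W1 \<inter> W2 = {0}"
    and t1: "t1 \<in> tensor p W1 (cell p r s)" and t2: "t2 \<in> tensor p W2 (cell p r s)"
  shows "(\<forall>u<4. mu p u (t1 + t2) = 0) \<longleftrightarrow> (\<forall>u<4. mu p u t1 = 0) \<and> (\<forall>u<4. mu p u t2 = 0)"
proof
  assume "(\<forall>u<4. mu p u t1 = 0) \<and> (\<forall>u<4. mu p u t2 = 0)"
  then show "\<forall>u<4. mu p u (t1 + t2) = 0" by simp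
next
  interpret tensor_skew_module "Zt p" p by (rule tensor_module)
  assume *: "\<forall>u<4. mu p u (t1 + t2) = 0"
  note U = cell_props[OF ok]
  let ?k = "kap p s - (2 * of_nat p + 3)"
  have casT_add: "casT p (a + b) = casT p a + casT p b" for a b
    unfolding casT_def by (simp add: act_add sum.distrib)
  have casT_mem: "casT p t \<in> tensor p W (cell p r s)" if "submodule p (vact p) W" "t \<in> tensor p W (cell p r s)" for W t
    unfolding casT_def using submoduleD(2)[OF submodule_tensor[OF that(1) U(1)]] Ag_sp_alg that(2)
    by (intro cv.subspace_sum[OF subspace_tensor]) blast
  have US: "cell p r s \<subseteq> Sall p" using U(2) Sdeg_Sall by blast
  have tens: "t \<in> supported (Zt p)" "sl t a \<in> cell p r s" if "W \<subseteq> Vc p" "t \<in> tensor p W (cell p r s)" for W t a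
    using tensor_supported[OF that(1) order_trans[OF U(2) Sdeg_supported]] that(2)
      tensor_slice[OF that(2) submoduleD(1)[OF U(1)]] by auto
  have supp: "t1 \<in> supported (Zt p)" "t2 \<in> supported (Zt p)" "t1 + t2 \<in> supported (Zt p)"
    using tens(1)[OF W1(2) t1] tens(1)[OF W2(2) t2] cv.subspace_add[OF subspace_supported] by auto
  have slU: "sl t1 a \<in> cell p r s" "sl t2 a \<in> cell p r s" "sl (t1 + t2) a \<in> cell p r s" for a
    using tens(2)[OF W1(2) t1] tens(2)[OF W2(2) t2] cv.subspace_add[OF submoduleD(1)[OF U(1)]] by auto
  have char: "(\<forall>u<4. mu p u t = 0) \<longleftrightarrow> (\<forall>c\<in>NN p. sl (casT p t) c = cscale ?k (sl t c))"
    if "t \<in> supported (Zt p)" "\<And>a. sl t a \<in> cell p r s" for t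
    by (rule symbols_casimir[OF that(1)]) (use that(2) US U(3) in blast)+
  have off: "t = 0" if "t \<in> supported (Zt p)" "\<And>c. c \<in> NN p \<Longrightarrow> sl t c = 0" for t
  proof (rule tens_eqI)
    fix c show "sl t c = sl 0 c"
    proof (cases "c \<in> NN p")
      case True
      then show ?thesis using that(2) by simp
    next
      case False
      show ?thesis
      proof
        fix C
        have "(c, C) \<notin> Zt p" using False by (blast dest: SigmaD1)
        then have "t (c, C) = 0" using that(1) unfolding supported_def by blast
        then show "sl t c C = sl 0 c C" by (simp add: sl_def pointwise)
      qed
    qed
  qed
  \<comment> \<open>The failure to be an eigenvector. It stays in the tensor product of each
    summand, so the two failures can only cancel if both are zero.\<close>
  let ?R = "\<lambda>t. casT p t - cscale ?k t"
  have R1: "?R t1 \<in> tensor p W1 (cell p r s)"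
    by (intro cv.subspace_diff[OF subspace_tensor] cv.subspace_scale[OF subspace_tensor] casT_mem W1 t1)
  have R2: "?R t2 \<in> tensor p W2 (cell p r s)"
    by (intro cv.subspace_diff[OF subspace_tensor] cv.subspace_scale[OF subspace_tensor] casT_mem W2 t2)
  have "?R t1 + ?R t2 = 0"
  proof (rule off)
    show "?R t1 + ?R t2 \<in> supported (Zt p)"
      by (rule cv.subspace_add[OF subspace_supported tens(1)[OF W1(2) R1] tens(1)[OF W2(2) R2]])
    fix c assume "c \<in> NN p"
    then have "sl (casT p (t1 + t2)) c = cscale ?k (sl (t1 + t2) c)"
      using char[OF supp(3) slU(3)] * by blast
    moreover have "sl (?R t1 + ?R t2) c = sl (casT p (t1 + t2)) c - cscale ?k (sl (t1 + t2) c)"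
      by (simp add: casT_add cv.scale_right_distrib)
    ultimately show "sl (?R t1 + ?R t2) c = 0" by simp
  qed
  then have "?R t1 = - ?R t2" by (rule add_eq_0_iff2[THEN iffD1])
  then have "?R t1 \<in> tensor p W2 (cell p r s)"
    using cv.subspace_neg[OF subspace_tensor R2] by simp
  then have R10: "?R t1 = 0"
    using R1 tensor_Int[OF submoduleD(1)[OF W1(1)] submoduleD(1)[OF W2(1)] W12] by blast
  then have R20: "?R t2 = 0" using \<open>?R t1 + ?R t2 = 0\<close> by simp
  have z: "\<forall>u<4. mu p u t = 0" if "t \<in> supported (Zt p)" "\<And>a. sl t a \<in> cell p r s" "?R t = 0" for t
  proof -
    have "casT p t = cscale ?k t" using that(3) by simp
    then have "\<forall>c\<in>NN p. sl (casT p t) c = cscale ?k (sl t c)" by simp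
    then show ?thesis using char[OF that(1,2)] by blast
  qed
  show "(\<forall>u<4. mu p u t1 = 0) \<and> (\<forall>u<4. mu p u t2 = 0)"
    using z[OF supp(1) slU(1) R10] z[OF supp(2) slU(2) R20] by blast
qed

theorem theorem1:
  fixes p r s :: nat and \<Omega> :: "(real^'n::finite) set" and b :: "nat \<Rightarrow> 'n"
    and W1 W2 :: "(nat \<Rightarrow> complex) set" and f :: "real^'n \<Rightarrow> cl"
  assumes "p \<ge> 1"
    and "cell_ok p r s"
    and "open \<Omega>"
    and "bij_betw b {1..4*p} UNIV"
    and "W1 \<subseteq> Vc p" and "W2 \<subseteq> Vc p"
    and "irred p (vact p) W1" and "irred p (vact p) W2"
    and "W1 \<inter> W2 = {\<lambda>_. 0}"
    and "{(\<lambda>a. w1 a + w2 a) | w1 w2. w1 \<in> W1 \<and> w2 \<in> W2} = Vc p"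
    and "cdifferentiable_on f \<Omega>"
    and "\<forall>x\<in>\<Omega>. f x \<in> cell p r s"
  shows "qmonogenic p b f \<Omega> \<longleftrightarrow>
    (\<forall>x\<in>\<Omega>. \<forall>i\<in>{1::nat, 2}. \<forall>pl::bool. SW p b r s W1 W2 i pl f x = (\<lambda>_. 0))"
proof -
  note ok = assms(2) and sW1 = irredD(1)[OF assms(7)] and sW2 = irredD(1)[OF assms(8)]
  note U = cell_props[OF ok]
  have W12: "W1 \<inter> W2 = {0}" using assms(9) by (simp add: zero_fun_lambda)
  have sp: "s \<le> p" using ok by (simp add: cell_ok_def)
  define T1 where "T1 = tensor p W1 (cell p r s)"
  define T2 where "T2 = tensor p W2 (cell p r s)"
  have UZ: "cell p r s \<subseteq> supported (Zc (4*p))" using U(2) Sdeg_supported by blast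
  have sT: "submodule p (tact p) T1" "submodule p (tact p) T2"
    unfolding T1_def T2_def by (rule submodule_tensor[OF sW1 U(1)] submodule_tensor[OF sW2 U(1)])+
  have TZ: "T1 \<subseteq> supported (Zt p)" "T2 \<subseteq> supported (Zt p)"
    unfolding T1_def T2_def by (rule tensor_supported[OF assms(5) UZ] tensor_supported[OF assms(6) UZ])+
  have T12: "T1 \<inter> T2 = {0}" "T2 \<inter> T1 = {0}"
    unfolding T1_def T2_def
    using tensor_Int[OF submoduleD(1)[OF sW1] submoduleD(1)[OF sW2] W12] by (simp_all add: Int_commute)
  have pointwise_equiv: "(\<forall>u<4. mu p u (grad p b f x) = 0)
      \<longleftrightarrow> (\<forall>i\<in>{1::nat, 2}. \<forall>pl::bool. SW p b r s W1 W2 i pl f x = 0)" if x: "x \<in> \<Omega>" for x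
  proof -
    \<comment> \<open>Places the gradient in the tensor product of V_c with the cell, where the
      decomposition by \<open>W1\<close> and \<open>W2\<close> is available.\<close>
    have "pd b f a x \<in> cell p r s" for a
      by (rule pd_mem[OF assms(3) x assms(11) submoduleD(1)[OF U(1)] UZ]) (use assms(12) in auto)
    then have g: "sl (grad p b f x) a \<in> cell p r s" if "a \<in> NN p" for a
      using that by (simp add: sl_def grad_def)
    have g0: "sl (grad p b f x) a = 0" if "a \<notin> NN p" for a
      using that by (auto simp: sl_def grad_def fun_eq_iff pointwise)
    obtain t1 t2 where t: "t1 \<in> T1" "t2 \<in> T2" and eq: "grad p b f x = t1 + t2"
      unfolding T1_def T2_def by (rule tensor_sum_decomp[OF assms(10) g g0])
    have eq': "grad p b f x = t2 + t1" unfolding eq by (rule add.commute)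
    have tau: "(if pl then tau_plus p s else tau_minus p s) = {0} \<or> irred p (spin_act p) (if pl then tau_plus p s else tau_minus p s)" for pl
      by (rule tau_irred[OF _ sp]) simp
    have S1: "SW p b r s W1 W2 1 pl f x = 0 \<longleftrightarrow> t1 \<in> nonisotypic p T1 (if pl then tau_plus p s else tau_minus p s)" for pl
      unfolding SW_def eq
      using SW_proj_eq_0_iff[OF tensor_module T1_def sT(1) TZ(1) T2_def submoduleD(1)[OF sT(2)] T12(1) tau t] by simp
    have S2: "SW p b r s W1 W2 2 pl f x = 0 \<longleftrightarrow> t2 \<in> nonisotypic p T2 (if pl then tau_plus p s else tau_minus p s)" for pl
      unfolding SW_def eq'
      using SW_proj_eq_0_iff[OF tensor_module T2_def sT(2) TZ(2) T1_def submoduleD(1)[OF sT(1)] T12(2) tau t(2,1)] by simp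
    have "(\<forall>u<4. mu p u (grad p b f x) = 0) \<longleftrightarrow> (\<forall>u<4. mu p u t1 = 0) \<and> (\<forall>u<4. mu p u t2 = 0)"
      unfolding eq by (rule symbols_split[OF ok sW1 assms(5) sW2 assms(6) W12 t[unfolded T1_def T2_def]])
    also have "\<dots> \<longleftrightarrow> (t1 \<in> nonisotypic p T1 (tau_plus p s) \<and> t1 \<in> nonisotypic p T1 (tau_minus p s))
        \<and> (t2 \<in> nonisotypic p T2 (tau_plus p s) \<and> t2 \<in> nonisotypic p T2 (tau_minus p s))"
      unfolding kernel_char[OF ok sW1 assms(5) T1_def t(1)] kernel_char[OF ok sW2 assms(6) T2_def t(2)] ..
    also have "\<dots> \<longleftrightarrow> (\<forall>pl. SW p b r s W1 W2 1 pl f x = 0) \<and> (\<forall>pl. SW p b r s W1 W2 2 pl f x = 0)"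
      unfolding all_bool_eq S1 S2 by simp
    finally show ?thesis by simp
  qed
  have D: "dirac_op p cle b f x = mu p 0 (grad p b f x)" "dirac_op p IM b f x = mu p 1 (grad p b f x)"
    "dirac_op p JM b f x = mu p 2 (grad p b f x)" "dirac_op p (KM (4*p)) b f x = mu p 3 (grad p b f x)" for x
    by (rule dirac_mu, rule lm_units, assumption)+
  have "(\<forall>u<4. P u) \<longleftrightarrow> P 0 \<and> P 1 \<and> P 2 \<and> P (3::nat)" for P
    unfolding less_4_cases by blast
  then have "qmonogenic p b f \<Omega> \<longleftrightarrow> (\<forall>x\<in>\<Omega>. \<forall>u<4. mu p u (grad p b f x) = 0)"
    unfolding qmonogenic_def D zero_fun_lambda using assms(11) by simp
  then show ?thesis
    unfolding zero_fun_lambda using pointwise_equiv by simp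
qed

end
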